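(* Let $(D_1,D_2,x)$ be an admissible triple. Then, up to isomorphism, the only quaternion algebra over $\mathbb{Q}$ admitting $x$-linked embeddings of $\mathcal{O}_{D_1},\mathcal{O}_{D_2}$ is \[B=\left(\frac{D_1,\;x^2-D_1D_2}{\mathbb{Q}}\right).\] Furthermore, let $N=\gcd(D_1^{\mathrm{fund}},D_2^{\mathrm{fund}})$, and factorize \[\frac{D_1D_2-x^2}{4}=\pm N'\prod_{i=1}^{r}p_i^{2e_i+1}\prod_{i=1}^{s}q_i^{2f_i}\prod_{i=1}^{t}w_i^{g_i},\] where $N'$ is the minimal positive integer such that $\frac{D_1D_2-x^2}{4N'}$ is coprime to $N$, the $p_i$ are the primes with $\epsilon(p_i)=-1$ appearing to an odd power, the $q_i$ are the primes with $\epsilon(q_i)=-1$ appearing to an even power, and the $w_i$ are the primes with $\epsilon(w_i)=1$. Then the set of finite primes at which $B$ is ramified is \[\{p_1,\dots,p_r\}\cup\{p: p\mid N',\ (D_1,x^2-D_1D_2)_p=-1\}.\]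
   Context: A discriminant is a non-square integer $D\equiv0,1\pmod 4$; $p_D$ is its parity, $\mathcal{O}_D=\mathbb{Z}[(p_D+\sqrt D)/2]$, and $D^{\mathrm{fund}}$ is the discriminant of $\mathbb{Q}(\sqrt D)$. A triple $(D_1,D_2,x)$ of integers is admissible if $D_1,D_2$ are positive discriminants, $x\equiv D_1D_2\pmod 2$ and $x^2\neq D_1D_2$. An embedding of $\mathcal{O}_D$ into a quaternion algebra $B$ is a ring homomorphism $\mathcal{O}_D\to B$; a pair $(\phi_1,\phi_2)$ of embeddings of $\mathcal{O}_{D_1},\mathcal{O}_{D_2}$ into $B$ is $x$-linked if $x=\frac12\mathrm{trd}(\phi_1(\sqrt{D_1})\phi_2(\sqrt{D_2}))$. $\left(\frac{a,b}{\mathbb{Q}}\right)$ is the quaternion algebra with basis $1,i,j,k$, $i^2=a$, $j^2=b$, $k=ij=-ji$. The Hilbert symbol $(a,b)_p$ is $1$ if $\left(\frac{a,b}{\mathbb{Q}_p}\right)\cong M_2(\mathbb{Q}_p)$ and $-1$ otherwise. For discriminants $D_1,D_2$ and a prime $p$ with $p\nmid\gcd(D_1^{\mathrm{fund}},D_2^{\mathrm{fund}})$ and $\left(\frac{D_1^{\mathrm{fund}}D_2^{\mathrm{fund}}}{p}\right)\neq-1$, define $\epsilon(p)=\left(\frac{D_1^{\mathrm{fund}}}{p}\right)$ if $p\nmid D_1^{\mathrm{fund}}$ and $\epsilon(p)=\left(\frac{D_2^{\mathrm{fund}}}{p}\right)$ if $p\nmid D_2^{\mathrm{fund}}$ (Kronecker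 symbols).
   Formalization: The displayed factorization is asserted only when ε is defined at every prime dividing (D1D2−x²)/4 but not N; it fails otherwise, e.g. for (45,13,3), where ε(3) is undefined. The description of the ramified primes is proved for all admissible triples. *)

theory Defs
  imports
    "HOL-Algebra.Algebra"
    "HOL-Algebra.Algebraic_Closure_Type"
    "HOL-Number_Theory.Number_Theory"
    "HOL-Analysis.Analysis"
begin

hide_const (open) Divisibility.prime

text \<open>The locale \<open>algebra\<close> of \<open>HOL-Algebra.Module\<close> requires the
  algebra itself to be commutative, so it cannot be used here; only its record type is.\<close>

definition assoc_algebra :: "('k, 'm) ring_scheme \<Rightarrow> ('k, 'b) module \<Rightarrow> bool" where
  "assoc_algebra K B \<longleftrightarrow> Module.module K B \<and> ring B \<and>
     (\<forall>c \<in> carrier K. \<forall>u \<in> carrier B. \<forall>v \<in> carrier B.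
        (c \<odot>\<^bsub>B\<^esub> u) \<otimes>\<^bsub>B\<^esub> v = c \<odot>\<^bsub>B\<^esub> (u \<otimes>\<^bsub>B\<^esub> v) \<and>
        u \<otimes>\<^bsub>B\<^esub> (c \<odot>\<^bsub>B\<^esub> v) = c \<odot>\<^bsub>B\<^esub> (u \<otimes>\<^bsub>B\<^esub> v))"

definition alg_isomorphic ::
    "('k, 'm) ring_scheme \<Rightarrow> ('k, 'a) module \<Rightarrow> ('k, 'b) module \<Rightarrow> bool" where
  "alg_isomorphic K A B \<longleftrightarrow>
     (\<exists>h \<in> ring_iso A B. \<forall>c \<in> carrier K. \<forall>u \<in> carrier A. h (c \<odot>\<^bsub>A\<^esub> u) = c \<odot>\<^bsub>B\<^esub> h u)"

definition division_ring :: "('a, 'm) ring_scheme \<Rightarrow> bool" where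
  "division_ring R \<longleftrightarrow> ring R \<and> Units R = carrier R - {\<zero>\<^bsub>R\<^esub>}"

definition quat_comb :: "('k, 'b) module \<Rightarrow> 'b \<Rightarrow> 'b \<Rightarrow> 'k \<times> 'k \<times> 'k \<times> 'k \<Rightarrow> 'b" where
  "quat_comb B i j = (\<lambda>(t, x, y, z).
     t \<odot>\<^bsub>B\<^esub> \<one>\<^bsub>B\<^esub> \<oplus>\<^bsub>B\<^esub> x \<odot>\<^bsub>B\<^esub> i \<oplus>\<^bsub>B\<^esub> y \<odot>\<^bsub>B\<^esub> j \<oplus>\<^bsub>B\<^esub> z \<odot>\<^bsub>B\<^esub> (i \<otimes>\<^bsub>B\<^esub> j))"

text \<open>\<open>1, i, j, ij\<close> is a \<open>K\<close>-basis of \<open>B\<close> with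
  \<open>i\<^sup>2 = a\<close>, \<open>j\<^sup>2 = b\<close>, \<open>ji = -ij\<close>.  All notions
  below are used for fields of characteristic different from 2 only.\<close>

definition quaternion_basis ::
    "('k, 'm) ring_scheme \<Rightarrow> ('k, 'b) module \<Rightarrow> 'k \<Rightarrow> 'k \<Rightarrow> 'b \<Rightarrow> 'b \<Rightarrow> bool" where
  "quaternion_basis K B a b i j \<longleftrightarrow>
     a \<in> carrier K - {\<zero>\<^bsub>K\<^esub>} \<and> b \<in> carrier K - {\<zero>\<^bsub>K\<^esub>} \<and>
     i \<in> carrier B \<and> j \<in> carrier B \<and>
     i \<otimes>\<^bsub>B\<^esub> i = a \<odot>\<^bsub>B\<^esub> \<one>\<^bsub>B\<^esub> \<and> j \<otimes>\<^bsub>B\<^esub> j = b \<odot>\<^bsub>B\<^esub> \<one>\<^bsub>B\<^esub> \<and>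
     j \<otimes>\<^bsub>B\<^esub> i = \<ominus>\<^bsub>B\<^esub> (i \<otimes>\<^bsub>B\<^esub> j) \<and>
     bij_betw (quat_comb B i j)
       (carrier K \<times> carrier K \<times> carrier K \<times> carrier K) (carrier B)"

definition quaternion_algebra :: "('k, 'm) ring_scheme \<Rightarrow> ('k, 'b) module \<Rightarrow> bool" where
  "quaternion_algebra K B \<longleftrightarrow> assoc_algebra K B \<and> (\<exists>a b i j. quaternion_basis K B a b i j)"

text \<open>The reduced trace: \<open>\<alpha> = t + xi + yj + zk\<close> has
  \<open>\<alpha> + conj \<alpha> = 2t\<close>, whichever quaternion basis is used.\<close>

definition trd :: "('k, 'm) ring_scheme \<Rightarrow> ('k, 'b) module \<Rightarrow> 'b \<Rightarrow> 'k" where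
  "trd K B \<alpha> = (THE s. \<exists>a b i j t x y z. quaternion_basis K B a b i j \<and>
     t \<in> carrier K \<and> x \<in> carrier K \<and> y \<in> carrier K \<and> z \<in> carrier K \<and>
     \<alpha> = quat_comb B i j (t, x, y, z) \<and> s = t \<oplus>\<^bsub>K\<^esub> t)"

text \<open>The algebra \<open>(a, b / K)\<close> in the coordinates of its basis \<open>1, i, j, k\<close>;
  the multiplication table follows from \<open>i\<^sup>2 = a\<close>, \<open>j\<^sup>2 = b\<close>,
  \<open>k = ij = -ji\<close>, whence \<open>k\<^sup>2 = -ab\<close>, \<open>jk = -bi = -kj\<close>,
  \<open>ik = aj = -ki\<close>.\<close>

definition quat_alg ::
    "('k, 'm) ring_scheme \<Rightarrow> 'k \<Rightarrow> 'k \<Rightarrow> ('k, 'k \<times> 'k \<times> 'k \<times> 'k) module" where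
  "quat_alg K a b =
     \<lparr> carrier = carrier K \<times> carrier K \<times> carrier K \<times> carrier K,
       monoid.mult = (\<lambda>(t, x, y, z) (t', x', y', z').
         (t \<otimes>\<^bsub>K\<^esub> t' \<oplus>\<^bsub>K\<^esub> a \<otimes>\<^bsub>K\<^esub> x \<otimes>\<^bsub>K\<^esub> x' \<oplus>\<^bsub>K\<^esub> b \<otimes>\<^bsub>K\<^esub> y \<otimes>\<^bsub>K\<^esub> y'
            \<ominus>\<^bsub>K\<^esub> a \<otimes>\<^bsub>K\<^esub> b \<otimes>\<^bsub>K\<^esub> z \<otimes>\<^bsub>K\<^esub> z',
          t \<otimes>\<^bsub>K\<^esub> x' \<oplus>\<^bsub>K\<^esub> x \<otimes>\<^bsub>K\<^esub> t' \<oplus>\<^bsub>K\<^esub> b \<otimes>\<^bsub>K\<^esub> z \<otimes>\<^bsub>K\<^esub> y' \<ominus>\<^bsub>K\<^esub> b \<otimes>\<^bsub>K\<^esub> y \<otimes>\<^bsub>K\<^esub> z',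
          t \<otimes>\<^bsub>K\<^esub> y' \<oplus>\<^bsub>K\<^esub> y \<otimes>\<^bsub>K\<^esub> t' \<oplus>\<^bsub>K\<^esub> a \<otimes>\<^bsub>K\<^esub> x \<otimes>\<^bsub>K\<^esub> z' \<ominus>\<^bsub>K\<^esub> a \<otimes>\<^bsub>K\<^esub> z \<otimes>\<^bsub>K\<^esub> x',
          t \<otimes>\<^bsub>K\<^esub> z' \<oplus>\<^bsub>K\<^esub> z \<otimes>\<^bsub>K\<^esub> t' \<oplus>\<^bsub>K\<^esub> x \<otimes>\<^bsub>K\<^esub> y' \<ominus>\<^bsub>K\<^esub> y \<otimes>\<^bsub>K\<^esub> x')),
       one = (\<one>\<^bsub>K\<^esub>, \<zero>\<^bsub>K\<^esub>, \<zero>\<^bsub>K\<^esub>, \<zero>\<^bsub>K\<^esub>),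
       ring.zero = (\<zero>\<^bsub>K\<^esub>, \<zero>\<^bsub>K\<^esub>, \<zero>\<^bsub>K\<^esub>, \<zero>\<^bsub>K\<^esub>),
       add = (\<lambda>(t, x, y, z) (t', x', y', z').
         (t \<oplus>\<^bsub>K\<^esub> t', x \<oplus>\<^bsub>K\<^esub> x', y \<oplus>\<^bsub>K\<^esub> y', z \<oplus>\<^bsub>K\<^esub> z')),
       module.smult = (\<lambda>c (t, x, y, z).
         (c \<otimes>\<^bsub>K\<^esub> t, c \<otimes>\<^bsub>K\<^esub> x, c \<otimes>\<^bsub>K\<^esub> y, c \<otimes>\<^bsub>K\<^esub> z)) \<rparr>"

text \<open>\<open>M\<^sub>2(K)\<close>; the tuple \<open>(p, q, r, s)\<close> is the matrix with rows
  \<open>(p, q)\<close> and \<open>(r, s)\<close>.\<close>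

definition mat2_alg :: "('k, 'm) ring_scheme \<Rightarrow> ('k, 'k \<times> 'k \<times> 'k \<times> 'k) module" where
  "mat2_alg K =
     \<lparr> carrier = carrier K \<times> carrier K \<times> carrier K \<times> carrier K,
       monoid.mult = (\<lambda>(p, q, r, s) (p', q', r', s').
         (p \<otimes>\<^bsub>K\<^esub> p' \<oplus>\<^bsub>K\<^esub> q \<otimes>\<^bsub>K\<^esub> r', p \<otimes>\<^bsub>K\<^esub> q' \<oplus>\<^bsub>K\<^esub> q \<otimes>\<^bsub>K\<^esub> s',
          r \<otimes>\<^bsub>K\<^esub> p' \<oplus>\<^bsub>K\<^esub> s \<otimes>\<^bsub>K\<^esub> r', r \<otimes>\<^bsub>K\<^esub> q' \<oplus>\<^bsub>K\<^esub> s \<otimes>\<^bsub>K\<^esub> s')),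
       one = (\<one>\<^bsub>K\<^esub>, \<zero>\<^bsub>K\<^esub>, \<zero>\<^bsub>K\<^esub>, \<one>\<^bsub>K\<^esub>),
       ring.zero = (\<zero>\<^bsub>K\<^esub>, \<zero>\<^bsub>K\<^esub>, \<zero>\<^bsub>K\<^esub>, \<zero>\<^bsub>K\<^esub>),
       add = (\<lambda>(p, q, r, s) (p', q', r', s').
         (p \<oplus>\<^bsub>K\<^esub> p', q \<oplus>\<^bsub>K\<^esub> q', r \<oplus>\<^bsub>K\<^esub> r', s \<oplus>\<^bsub>K\<^esub> s')),
       module.smult = (\<lambda>c (p, q, r, s).
         (c \<otimes>\<^bsub>K\<^esub> p, c \<otimes>\<^bsub>K\<^esub> q, c \<otimes>\<^bsub>K\<^esub> r, c \<otimes>\<^bsub>K\<^esub> s)) \<rparr>"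


abbreviation RatF :: "rat ring" where
  "RatF \<equiv> ring_of_type_algebra"

definition padic_val :: "nat \<Rightarrow> rat \<Rightarrow> int" where
  "padic_val p r = int (multiplicity (int p) (fst (quotient_of r)))
                 - int (multiplicity (int p) (snd (quotient_of r)))"

definition padic_abs :: "nat \<Rightarrow> rat \<Rightarrow> real" where
  "padic_abs p r = (if r = 0 then 0 else real p powi (- padic_val p r))"

text \<open>\<open>\<rat>\<^sub>p\<close> is the completion of the rationals for the p-adic absolute
  value: Cauchy sequences modulo null sequences.\<close>

definition padic_cauchy_ring :: "nat \<Rightarrow> (nat \<Rightarrow> rat) ring" where
  "padic_cauchy_ring p =
     \<lparr> carrier = {s. \<forall>\<delta>>0. \<exists>n0. \<forall>m\<ge>n0. \<forall>n\<ge>n0. padic_abs p (s m - s n) < \<delta>},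
       monoid.mult = (\<lambda>s s' n. s n * s' n),
       one = (\<lambda>n. 1),
       ring.zero = (\<lambda>n. 0),
       add = (\<lambda>s s' n. s n + s' n) \<rparr>"

definition padic_null :: "nat \<Rightarrow> (nat \<Rightarrow> rat) set" where
  "padic_null p = {s. (\<lambda>n. padic_abs p (s n)) \<longlonglongrightarrow> 0}"

definition Qp :: "nat \<Rightarrow> (nat \<Rightarrow> rat) set ring" where
  "Qp p = padic_cauchy_ring p Quot padic_null p"

definition Qp_of_rat :: "nat \<Rightarrow> rat \<Rightarrow> (nat \<Rightarrow> rat) set" where
  "Qp_of_rat p r = padic_null p +>\<^bsub>padic_cauchy_ring p\<^esub> (\<lambda>n. r)"

definition hilbert_symbol :: "nat \<Rightarrow> rat \<Rightarrow> rat \<Rightarrow> int" where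
  "hilbert_symbol p a b =
     (if alg_isomorphic (Qp p) (quat_alg (Qp p) (Qp_of_rat p a) (Qp_of_rat p b)) (mat2_alg (Qp p))
      then 1 else -1)"

text \<open>A rational quaternion algebra is ramified at \<open>p\<close> if its scalar extension to
  \<open>\<rat>\<^sub>p\<close> is a division algebra.  If \<open>1, i, j, ij\<close> is a quaternion basis
  of \<open>B\<close> with constants \<open>a, b\<close>, its image is one of the scalar extension with the
  same constants, so the latter is \<open>(a, b / \<rat>\<^sub>p)\<close>.\<close>

definition ramified_at :: "(rat, 'b) module \<Rightarrow> nat \<Rightarrow> bool" where
  "ramified_at B p \<longleftrightarrow> (\<exists>a b i j. quaternion_basis RatF B a b i j \<and>
     division_ring (quat_alg (Qp p) (Qp_of_rat p a) (Qp_of_rat p b)))"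


definition is_discriminant :: "int \<Rightarrow> bool" where
  "is_discriminant D \<longleftrightarrow> (\<nexists>n. D = n\<^sup>2) \<and> ([D = 0] (mod 4) \<or> [D = 1] (mod 4))"

definition admissible :: "int \<Rightarrow> int \<Rightarrow> int \<Rightarrow> bool" where
  "admissible D1 D2 x \<longleftrightarrow> is_discriminant D1 \<and> D1 > 0 \<and> is_discriminant D2 \<and> D2 > 0 \<and>
     [x = D1 * D2] (mod 2) \<and> x\<^sup>2 \<noteq> D1 * D2"

abbreviation sqrtD :: "int \<Rightarrow> complex" where
  "sqrtD D \<equiv> csqrt (of_int D)"

definition quad_order :: "int \<Rightarrow> complex ring" where
  "quad_order D = ring_of_type_algebra
     \<lparr> carrier := generate_ring ring_of_type_algebra {(of_int (D mod 2) + sqrtD D) / 2} \<rparr>"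

definition quad_field_integers :: "int \<Rightarrow> complex set" where
  "quad_field_integers D =
     {z. algebraic_int z \<and> (\<exists>u v. z = of_rat u + of_rat v * sqrtD D)}"

definition quad_conj :: "int \<Rightarrow> complex \<Rightarrow> complex" where
  "quad_conj D z =
     (THE w. \<exists>u v. z = of_rat u + of_rat v * sqrtD D \<and> w = of_rat u - of_rat v * sqrtD D)"

text \<open>The discriminant of \<open>\<rat>(\<surd>D)\<close>, i.e. the square of the determinant of
  the two embeddings on a \<open>\<int>\<close>-basis of the ring of integers.\<close>

definition fund_disc :: "int \<Rightarrow> int" where
  "fund_disc D = (THE d. \<exists>\<alpha> \<beta>.
     bij_betw (\<lambda>(m, n). of_int m * \<alpha> + of_int n * \<beta>) UNIV (quad_field_integers D) \<and>
     of_int d = (\<alpha> * quad_conj D \<beta> - \<beta> * quad_conj D \<alpha>)\<^sup>2)"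

definition x_linked ::
    "(rat, 'b) module \<Rightarrow> int \<Rightarrow> int \<Rightarrow> int \<Rightarrow> (complex \<Rightarrow> 'b) \<Rightarrow> (complex \<Rightarrow> 'b) \<Rightarrow> bool" where
  "x_linked B D1 D2 x \<phi>1 \<phi>2 \<longleftrightarrow>
     of_int x = trd RatF B (\<phi>1 (sqrtD D1) \<otimes>\<^bsub>B\<^esub> \<phi>2 (sqrtD D2)) / 2"

definition admits_linked_embeddings :: "(rat, 'b) module \<Rightarrow> int \<Rightarrow> int \<Rightarrow> int \<Rightarrow> bool" where
  "admits_linked_embeddings B D1 D2 x \<longleftrightarrow>
     (\<exists>\<phi>1 \<in> ring_hom (quad_order D1) B. \<exists>\<phi>2 \<in> ring_hom (quad_order D2) B.
        x_linked B D1 D2 x \<phi>1 \<phi>2)"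


text \<open>The Kronecker symbol \<open>(a / p)\<close> for \<open>p\<close> prime.\<close>

definition kronecker :: "int \<Rightarrow> nat \<Rightarrow> int" where
  "kronecker a p =
     (if p = 2 then (if even a then 0 else if a mod 8 = 1 \<or> a mod 8 = 7 then 1 else -1)
      else Legendre a (int p))"

text \<open>The function \<open>\<epsilon>\<close> is partial; \<open>eps_dom\<close> is its domain, outside of which
  the value of \<open>eps\<close> is meaningless.  On \<open>eps_dom\<close> the two branches agree when
  both are applicable.\<close>

definition eps_dom :: "int \<Rightarrow> int \<Rightarrow> nat \<Rightarrow> bool" where
  "eps_dom D1 D2 p \<longleftrightarrow> prime p \<and>
     \<not> int p dvd gcd (fund_disc D1) (fund_disc D2) \<and>
     kronecker (fund_disc D1 * fund_disc D2) p \<noteq> -1"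

definition eps :: "int \<Rightarrow> int \<Rightarrow> nat \<Rightarrow> int" where
  "eps D1 D2 p =
     (if \<not> int p dvd fund_disc D1 then kronecker (fund_disc D1) p
      else kronecker (fund_disc D2) p)"

end

theory Submission
  imports Defs
begin

text \<open>
  Linked embeddings send \<open>\<surd>D\<^sub>1\<close>, \<open>\<surd>D\<^sub>2\<close> to pure quaternions \<open>I\<close>, \<open>J\<close> with
  \<open>I\<^sup>2 = D\<^sub>1\<close>, \<open>J\<^sup>2 = D\<^sub>2\<close>, \<open>IJ + JI = 2x\<close>.  Then \<open>K = IJ - x\<close> anticommutes with \<open>I\<close> and
  \<open>K\<^sup>2 = x\<^sup>2 - D\<^sub>1D\<^sub>2\<close>, so \<open>1, I, K, IK\<close> is a quaternion basis with the constants of \<open>B\<close>; conversely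
  \<open>I = i\<close>, \<open>J = (xi + k) / D\<^sub>1\<close> are linked in \<open>B\<close>.

  Locally, \<open>(a, b / \<rat>\<^sub>p)\<close> is a division algebra or \<open>M\<^sub>2(\<rat>\<^sub>p)\<close>, and it is the latter iff
  \<open>b = u\<^sup>2 - a v\<^sup>2\<close> is solvable in \<open>\<rat>\<^sub>p\<close>.  With \<open>4M = D\<^sub>1D\<^sub>2 - x\<^sup>2\<close> and \<open>F\<^sub>i\<close> the fundamental discriminants,
  \<open>B\<close> is locally both \<open>(F\<^sub>1, -M)\<close> and \<open>(F\<^sub>2, -M)\<close>, the latter because \<open>D\<^sub>1D\<^sub>2 = x\<^sup>2 + 4M\<close> is a norm from
  \<open>\<rat>(\<surd>-M)\<close>.  If \<open>p\<close> does not divide \<open>F\<^sub>i\<close>, then \<open>\<rat>\<^sub>p(\<surd>F\<^sub>i)\<close> is split or unramified and \<open>-M\<close> is a norm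
  from it iff \<open>(F\<^sub>i / p) = 1\<close> or \<open>p\<close> divides \<open>M\<close> to an even power.  If \<open>p\<close> divides both \<open>F\<^sub>i\<close> but not \<open>M\<close>,
  then \<open>-4M \<equiv> x\<^sup>2\<close> modulo \<open>p\<close> (modulo 8 up to an unramified twist if \<open>p = 2\<close>), and \<open>B\<close> splits.

  Identities in \<open>\<rat>\<^sub>p\<close> are checked pointwise on rational Cauchy sequences.
\<close>

section \<open>p-adic Cauchy sequences\<close>

text \<open>Splitting, isotropy of the reduced norm form and being a division algebra are kept apart
  because each serves a different purpose. \<open>padic_split\<close> is what Hensel lifting and
  valuations can decide; \<open>padic_isotropic\<close> is symmetric in a and b and can be moved
  between rational quaternion bases. The latter matters because \<open>trd\<close> and
  \<open>ramified_at\<close> refer to an arbitrary quaternion basis, so their values must be shown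
  independent of it. The parameters a, b stay rational while solutions are p-adic. Hence the norm
  equation holds only up to a null sequence, and every explicit formula has to say where that error
  goes. Of the bilinearity of the Hilbert symbol a single instance occurs, the passage from D1 to
  D2, done by dividing two norms explicitly. At p = 2 the condition \<open>D mod 4 = 1\<close>
  accompanies the discriminants prime to p. It makes the quadratic extension unramified or split and
  leaves only the residues 1 and 5 modulo 8, so that the residue 7, where \<open>kronecker\<close>
  also returns 1, never occurs.\<close>

lemma padic_val_divide:
  assumes p: "prime p" and "a \<noteq> 0" "b \<noteq> 0"
  shows "padic_val p (of_int a / of_int b) =
    int (multiplicity (int p) a) - int (multiplicity (int p) b)"
proof -
  let ?r = "(of_int a :: rat) / of_int b"
  obtain n d where nd: "quotient_of ?r = (n, d)" by (cases "quotient_of ?r")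
  have d: "d > 0" and r: "?r = of_int n / of_int d"
    using nd quotient_of_denom_pos quotient_of_div by auto
  \<comment> \<open>\<open>quotient_of\<close> yields the reduced fraction n/d; cross-multiplication
    compares it with a/b, which may be unreduced.\<close>
  have "(of_int (a * d) :: rat) = of_int (n * b)"
    using r d assms by (simp add: field_simps)
  then have eq: "a * d = n * b" by linarith
  have n: "n \<noteq> 0" using eq d assms by auto
  have pe: "prime_elem (int p)" using p by simp
  have "multiplicity (int p) a + multiplicity (int p) d = multiplicity (int p) n + multiplicity (int p) b"
    using eq prime_elem_multiplicity_mult_distrib[OF pe] n d assms by (metis less_irrefl)
  then show ?thesis unfolding padic_val_def nd by simp
qed

text \<open>Over one denominator, sums and norms of rationals become those of their numerators;
  \<open>padic_val_divide\<close> accepts the resulting unreduced fractions.\<close>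

lemma rat_common_denominator:
  fixes x y :: rat
  obtains a b d where "d > 0" "x = of_int a / of_int d" "y = of_int b / of_int d"
proof -
  obtain n d where x: "d > 0" "x = of_int n / of_int d"
    by (metis quotient_of_denom_pos quotient_of_div surj_pair)
  obtain m e where y: "e > 0" "y = of_int m / of_int e"
    by (metis quotient_of_denom_pos quotient_of_div surj_pair)
  show thesis
    by (rule that[of "d * e" "n * e" "m * d"]) (use x y in \<open>auto simp: field_simps\<close>)
qed

lemma padic_val_mult:
  assumes p: "prime p" and "x \<noteq> 0" "y \<noteq> 0"
  shows "padic_val p (x * y) = padic_val p x + padic_val p y"
proof -
  obtain a b d where abd: "d > 0" "x = of_int a / of_int d" "y = of_int b / of_int d"
    by (rule rat_common_denominator)
  have nz: "a \<noteq> 0" "b \<noteq> 0" "d \<noteq> 0" using abd assms by auto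
  have pe: "prime_elem (int p)" using p by simp
  have "x * y = of_int (a * b) / of_int (d * d)" using abd by simp
  then show ?thesis
    using nz abd padic_val_divide[OF p] by (simp add: prime_elem_multiplicity_mult_distrib[OF pe] del:
      of_int_mult)
qed

lemma padic_val_add:
  assumes p: "prime p" and "x \<noteq> 0" "y \<noteq> 0" "x + y \<noteq> 0"
  shows "padic_val p (x + y) \<ge> min (padic_val p x) (padic_val p y)"
proof -
  obtain a b d where abd: "d > 0" "x = of_int a / of_int d" "y = of_int b / of_int d"
    by (rule rat_common_denominator)
  have s: "x + y = of_int (a + b) / of_int d" using abd by (simp add: add_divide_distrib)
  have nz: "a \<noteq> 0" "b \<noteq> 0" "d \<noteq> 0" "a + b \<noteq> 0" using abd assms s by auto
  let ?k = "min (multiplicity (int p) a) (multiplicity (int p) b)"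
  have "int p ^ ?k dvd a" "int p ^ ?k dvd b" by (simp_all add: multiplicity_dvd')
  then have "int p ^ ?k dvd a + b" by simp
  then have "?k \<le> multiplicity (int p) (a + b)"
    using nz p by (intro multiplicity_geI) auto
  then show ?thesis
    unfolding s using abd nz by (simp add: padic_val_divide[OF p] del: of_int_add)
qed

lemma padic_abs_0 [simp]: "padic_abs p 0 = 0"
  by (simp add: padic_abs_def)

lemma padic_abs_nonneg [simp]: "padic_abs p x \<ge> 0"
  by (simp add: padic_abs_def)

lemma padic_abs_eq_0_iff: "prime p \<Longrightarrow> padic_abs p x = 0 \<longleftrightarrow> x = 0"
  by (auto simp: padic_abs_def dest: prime_gt_0_nat)

lemma padic_abs_mult: "prime p \<Longrightarrow> padic_abs p (x * y) = padic_abs p x * padic_abs p y"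
  by (auto simp: padic_abs_def padic_val_mult simp flip: power_int_add dest: prime_gt_0_nat)

lemma padic_abs_minus [simp]: "padic_abs p (- x) = padic_abs p x"
  by (cases "quotient_of x") (simp add: padic_abs_def padic_val_def rat_uminus_code Let_def)

lemma padic_abs_minus_commute: "padic_abs p (x - y) = padic_abs p (y - x)"
  by (metis minus_diff_eq padic_abs_minus)

lemma padic_abs_add_max:
  assumes p: "prime p"
  shows "padic_abs p (x + y) \<le> max (padic_abs p x) (padic_abs p y)"
proof (cases "x = 0 \<or> y = 0 \<or> x + y = 0")
  case True then show ?thesis by (auto simp: max_def)
next
  case False
  have p1: "real p \<ge> 1" using p prime_ge_1_nat by auto
  have "padic_val p (x + y) \<ge> padic_val p x \<or> padic_val p (x + y) \<ge> padic_val p y"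
    using padic_val_add[OF p, of x y] False by auto
  then show ?thesis
    using False p1 by (auto simp: padic_abs_def le_max_iff_disj intro!: power_int_increasing)
qed

lemma padic_abs_triangle: "prime p \<Longrightarrow> padic_abs p (x + y) \<le> padic_abs p x + padic_abs p y"
  using padic_abs_add_max[of p x y] padic_abs_nonneg[of p x] padic_abs_nonneg[of p y] by linarith

text \<open>Translates congruences modulo powers of p into p-adic smallness, for the integer
  sequences produced by Hensel lifting.\<close>

lemma padic_abs_of_int_le:
  assumes p: "prime p" and "int p ^ k dvd n"
  shows "padic_abs p (of_int n) \<le> 1 / real p ^ k"
proof (cases "n = 0")
  case False
  have p1: "real p \<ge> 1" using p prime_ge_1_nat by auto
  have "k \<le> multiplicity (int p) n"
    using assms False p by (intro multiplicity_geI) auto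
  moreover have "padic_val p (of_int n) = int (multiplicity (int p) n)"
    using padic_val_divide[OF p False, of 1] by simp
  ultimately have "padic_abs p (of_int n) \<le> real p powi (- int k)"
    unfolding padic_abs_def using False p1 by (auto intro!: power_int_increasing)
  then show ?thesis by (simp add: power_int_minus inverse_eq_divide)
qed (use p in \<open>simp add: prime_gt_0_nat\<close>)

abbreviation padic_cauchy :: "nat \<Rightarrow> (nat \<Rightarrow> rat) set" where
  "padic_cauchy p \<equiv> carrier (padic_cauchy_ring p)"

lemma padic_cauchy_iff:
  "s \<in> padic_cauchy p \<longleftrightarrow> (\<forall>\<delta>>0. \<exists>n0. \<forall>m\<ge>n0. \<forall>n\<ge>n0. padic_abs p (s m - s n) < \<delta>)"
  by (simp add: padic_cauchy_ring_def)

lemma padic_null_iff: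
  "s \<in> padic_null p \<longleftrightarrow> (\<forall>\<delta>>0. \<exists>n0. \<forall>n\<ge>n0. padic_abs p (s n) < \<delta>)"
  unfolding padic_null_def LIMSEQ_def by (simp add: dist_real_def)

lemma padic_cauchy_const: "(\<lambda>n. c) \<in> padic_cauchy p"
  by (simp add: padic_cauchy_iff)

lemma padic_null_zero: "(\<lambda>n. 0) \<in> padic_null p"
  by (simp add: padic_null_iff)

lemma padic_cauchy_add:
  assumes p: "prime p" and "s \<in> padic_cauchy p" "t \<in> padic_cauchy p"
  shows "(\<lambda>n. s n + t n) \<in> padic_cauchy p"
  unfolding padic_cauchy_iff
proof (intro allI impI)
  fix \<delta> :: real assume d: "\<delta> > 0"
  obtain n1 n2 where n: "\<And>m n. m \<ge> n1 \<Longrightarrow> n \<ge> n1 \<Longrightarrow> padic_abs p (s m - s n) < \<delta>"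
    "\<And>m n. m \<ge> n2 \<Longrightarrow> n \<ge> n2 \<Longrightarrow> padic_abs p (t m - t n) < \<delta>"
    using assms d unfolding padic_cauchy_iff by metis
  have "padic_abs p (s m + t m - (s n + t n)) < \<delta>" if "m \<ge> max n1 n2" "n \<ge> max n1 n2" for m n
    using padic_abs_add_max[OF p, of "s m - s n" "t m - t n"] n(1)[of m n] n(2)[of m n] that
    by (simp add: algebra_simps)
  then show "\<exists>n0. \<forall>m\<ge>n0. \<forall>n\<ge>n0. padic_abs p (s m + t m - (s n + t n)) < \<delta>" by blast
qed

lemma padic_cauchy_minus:
  assumes "s \<in> padic_cauchy p"
  shows "(\<lambda>n. - s n) \<in> padic_cauchy p"
proof -
  have "padic_abs p (- s m - - s n) = padic_abs p (s m - s n)" for m n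
    by (metis minus_diff_minus padic_abs_minus)
  then show ?thesis using assms by (simp add: padic_cauchy_iff del: diff_minus_eq_add)
qed

lemma padic_cauchy_diff:
  assumes p: "prime p" and "s \<in> padic_cauchy p" "t \<in> padic_cauchy p"
  shows "(\<lambda>n. s n - t n) \<in> padic_cauchy p"
  using padic_cauchy_add[OF p assms(2) padic_cauchy_minus[OF assms(3)]] by simp

lemma padic_cauchy_bounded:
  assumes p: "prime p" and s: "s \<in> padic_cauchy p"
  obtains K where "K > 0" "\<And>n. padic_abs p (s n) \<le> K"
proof -
  obtain n0 where n0: "\<And>m n. m \<ge> n0 \<Longrightarrow> n \<ge> n0 \<Longrightarrow> padic_abs p (s m - s n) < 1"
    using s unfolding padic_cauchy_iff by (metis zero_less_one)
  define K where "K = Max ((\<lambda>n. padic_abs p (s n)) ` {..n0}) + 1"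
  have K: "padic_abs p (s n) \<le> K - 1" if "n \<le> n0" for n
    unfolding K_def using that by (auto intro: Max_ge)
  have "padic_abs p (s n) \<le> K" for n
  proof (cases "n \<le> n0")
    case True then show ?thesis using K[of n] by linarith
  next
    case False
    then show ?thesis
      using padic_abs_triangle[OF p, of "s n - s n0" "s n0"] n0[of n n0] K[of n0] by simp
  qed
  moreover have "K > 0" using K[of 0] padic_abs_nonneg[of p "s 0"] by linarith
  ultimately show thesis using that by blast
qed

lemma padic_cauchy_mult:
  assumes p: "prime p" and s: "s \<in> padic_cauchy p" and t: "t \<in> padic_cauchy p"
  shows "(\<lambda>n. s n * t n) \<in> padic_cauchy p"
  unfolding padic_cauchy_iff
proof (intro allI impI)
  fix \<delta> :: real assume d: "\<delta> > 0"
  obtain K L where K: "K > 0" "\<And>n. padic_abs p (s n) \<le> K" and L: "L > 0" "\<And>n. padic_abs p (t n) \<le> L"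
    using padic_cauchy_bounded[OF p s] padic_cauchy_bounded[OF p t] by metis
  have "\<delta> / L > 0" "\<delta> / K > 0" using d K L by auto
  then obtain n1 n2 where n: "\<And>m n. m \<ge> n1 \<Longrightarrow> n \<ge> n1 \<Longrightarrow> padic_abs p (s m - s n) < \<delta> / L"
    "\<And>m n. m \<ge> n2 \<Longrightarrow> n \<ge> n2 \<Longrightarrow> padic_abs p (t m - t n) < \<delta> / K"
    using s t unfolding padic_cauchy_iff by metis
  have "padic_abs p (s m * t m - s n * t n) < \<delta>" if mn: "m \<ge> max n1 n2" "n \<ge> max n1 n2" for m n
  proof -
    have "s m * t m - s n * t n = (s m - s n) * t m + s n * (t m - t n)" by (simp add: algebra_simps)
    then have "padic_abs p (s m * t m - s n * t n) \<le>
        max (padic_abs p (s m - s n) * padic_abs p (t m)) (padic_abs p (s n) * padic_abs p (t m - t n))"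
      using padic_abs_add_max[OF p] by (metis padic_abs_mult[OF p])
    also have "\<dots> \<le> max (padic_abs p (s m - s n) * L) (K * padic_abs p (t m - t n))"
      by (intro max.mono mult_mono) (use K L in auto)
    also have "\<dots> < \<delta>"
      using n(1)[of m n] n(2)[of m n] mn K(1) L(1) by (simp add: field_simps)
    finally show ?thesis .
  qed
  then show "\<exists>n0. \<forall>m\<ge>n0. \<forall>n\<ge>n0. padic_abs p (s m * t m - s n * t n) < \<delta>" by blast
qed

lemma padic_null_mult:
  assumes p: "prime p" and s: "s \<in> padic_cauchy p" and t: "t \<in> padic_null p"
  shows "(\<lambda>n. s n * t n) \<in> padic_null p"
  unfolding padic_null_iff
proof (intro allI impI)
  fix \<delta> :: real assume d: "\<delta> > 0"
  obtain K where K: "K > 0" "\<And>n. padic_abs p (s n) \<le> K"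
    using padic_cauchy_bounded[OF p s] by metis
  have "\<delta> / K > 0" using d K by auto
  then obtain n1 where n: "\<And>n. n \<ge> n1 \<Longrightarrow> padic_abs p (t n) < \<delta> / K"
    using t unfolding padic_null_iff by metis
  have "padic_abs p (s n * t n) < \<delta>" if "n \<ge> n1" for n
  proof -
    have "padic_abs p (s n * t n) \<le> K * padic_abs p (t n)"
      unfolding padic_abs_mult[OF p] by (intro mult_right_mono K) auto
    also have "\<dots> < \<delta>" using n[OF that] K(1) by (simp add: field_simps)
    finally show ?thesis .
  qed
  then show "\<exists>n0. \<forall>n\<ge>n0. padic_abs p (s n * t n) < \<delta>" by blast
qed

lemma padic_null_add:
  assumes p: "prime p" and "s \<in> padic_null p" "t \<in> padic_null p"
  shows "(\<lambda>n. s n + t n) \<in> padic_null p"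
  unfolding padic_null_iff
proof (intro allI impI)
  fix \<delta> :: real assume d: "\<delta> > 0"
  obtain n1 n2 where n: "\<And>n. n \<ge> n1 \<Longrightarrow> padic_abs p (s n) < \<delta>"
    "\<And>n. n \<ge> n2 \<Longrightarrow> padic_abs p (t n) < \<delta>"
    using assms d unfolding padic_null_iff by metis
  have "padic_abs p (s n + t n) < \<delta>" if "n \<ge> max n1 n2" for n
    using padic_abs_add_max[OF p, of "s n" "t n"] n(1)[of n] n(2)[of n] that by simp
  then show "\<exists>n0. \<forall>n\<ge>n0. padic_abs p (s n + t n) < \<delta>" by blast
qed

lemma padic_null_minus: "s \<in> padic_null p \<Longrightarrow> (\<lambda>n. - s n) \<in> padic_null p"
  by (simp add: padic_null_iff)

lemma padic_null_diff:
  assumes p: "prime p" and "s \<in> padic_null p" "t \<in> padic_null p"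
  shows "(\<lambda>n. s n - t n) \<in> padic_null p"
  using padic_null_add[OF p assms(2) padic_null_minus[OF assms(3)]] by simp

lemma padic_null_imp_cauchy:
  assumes p: "prime p" and s: "s \<in> padic_null p"
  shows "s \<in> padic_cauchy p"
  unfolding padic_cauchy_iff
proof (intro allI impI)
  fix \<delta> :: real assume d: "\<delta> > 0"
  obtain n1 where n: "\<And>n. n \<ge> n1 \<Longrightarrow> padic_abs p (s n) < \<delta>"
    using s d unfolding padic_null_iff by metis
  have "padic_abs p (s m - s n) < \<delta>" if "m \<ge> n1" "n \<ge> n1" for m n
    using padic_abs_add_max[OF p, of "s m" "- s n"] n[of n] n[of m] that by simp
  then show "\<exists>n0. \<forall>m\<ge>n0. \<forall>n\<ge>n0. padic_abs p (s m - s n) < \<delta>" by blast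
qed

lemma padic_null_const_iff: "prime p \<Longrightarrow> (\<lambda>n. c) \<in> padic_null p \<longleftrightarrow> c = 0"
  unfolding padic_null_def by (auto simp: LIMSEQ_const_iff padic_abs_eq_0_iff)

text \<open>By the ultrametric inequality the same \<delta> serves as bound: beyond n0 the terms
  differ by less than \<delta>, and one of them has absolute value at least \<delta>, so none can be
  smaller.\<close>

lemma padic_cauchy_not_null_bound:
  assumes p: "prime p" and s: "s \<in> padic_cauchy p" and nn: "s \<notin> padic_null p"
  obtains \<delta> n0 where "\<delta> > 0" "\<And>n. n \<ge> n0 \<Longrightarrow> padic_abs p (s n) \<ge> \<delta>"
proof -
  obtain \<delta> where d: "\<delta> > 0" "\<And>n0. \<exists>n\<ge>n0. padic_abs p (s n) \<ge> \<delta>"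
    using nn unfolding padic_null_iff by (metis not_less)
  obtain n0 where n0: "\<And>m n. m \<ge> n0 \<Longrightarrow> n \<ge> n0 \<Longrightarrow> padic_abs p (s m - s n) < \<delta>"
    using s d(1) unfolding padic_cauchy_iff by metis
  have "padic_abs p (s n) \<ge> \<delta>" if "n \<ge> n0" for n
  proof -
    obtain m where m: "m \<ge> n0" "padic_abs p (s m) \<ge> \<delta>" using d(2) by blast
    then show ?thesis
      using padic_abs_add_max[OF p, of "s m - s n" "s n"] n0[OF m(1) that] by auto
  qed
  then show thesis using that d(1) by blast
qed

text \<open>The inverse is taken termwise. Finitely many terms of s may vanish; there
  \<open>inverse 0 = 0\<close> spoils the product, which a statement modulo null sequences
  tolerates.\<close>

lemma padic_cauchy_inverse:
  assumes p: "prime p" and s: "s \<in> padic_cauchy p" and nn: "s \<notin> padic_null p"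
  obtains r where "r \<in> padic_cauchy p" "(\<lambda>n. s n * r n - 1) \<in> padic_null p"
proof -
  obtain d n0 where d: "d > 0" "\<And>n. n \<ge> n0 \<Longrightarrow> padic_abs p (s n) \<ge> d"
    using padic_cauchy_not_null_bound[OF assms] by metis
  have nz: "s n \<noteq> 0" if "n \<ge> n0" for n using d(2)[OF that] d(1) by auto
  have "(\<lambda>n. inverse (s n)) \<in> padic_cauchy p"
    unfolding padic_cauchy_iff
  proof (intro allI impI)
    fix \<delta> :: real assume "\<delta> > 0"
    then have "\<delta> * (d * d) > 0" using d by simp
    then obtain n1 where n1: "\<And>m n. m \<ge> n1 \<Longrightarrow> n \<ge> n1 \<Longrightarrow> padic_abs p (s m - s n) < \<delta> * (d * d)"
      using s unfolding padic_cauchy_iff by metis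
    have "padic_abs p (inverse (s m) - inverse (s n)) < \<delta>" if mn: "m \<ge> max n0 n1" "n \<ge> max n0 n1" for m n
    proof -
      let ?e = "padic_abs p (inverse (s m) - inverse (s n))"
      have "(inverse (s m) - inverse (s n)) * (s m * s n) = s n - s m"
        using nz[of m] nz[of n] mn by (simp add: field_simps)
      then have "?e * (padic_abs p (s m) * padic_abs p (s n)) = padic_abs p (s n - s m)"
        by (metis padic_abs_mult[OF p])
      moreover have "?e * (d * d) \<le> ?e * (padic_abs p (s m) * padic_abs p (s n))"
        using d mn by (intro mult_left_mono mult_mono) auto
      ultimately have "?e * (d * d) < \<delta> * (d * d)" using n1[of n m] mn by auto
      then show ?thesis using d(1) by simp
    qed
    then show "\<exists>n0. \<forall>m\<ge>n0. \<forall>n\<ge>n0. padic_abs p (inverse (s m) - inverse (s n)) < \<delta>" by blast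
  qed
  moreover have "(\<lambda>n. s n * inverse (s n) - 1) \<in> padic_null p"
    unfolding padic_null_iff using nz by (auto intro!: exI[of _ n0])
  ultimately show thesis using that by blast
qed

text \<open>If s has an inverse r modulo null sequences, then t = r (s t) - t (s r - 1) is a
  combination of null sequences.\<close>

lemma padic_null_mult_imp:
  assumes p: "prime p" and s: "s \<in> padic_cauchy p" and t: "t \<in> padic_cauchy p"
    and "(\<lambda>n. s n * t n) \<in> padic_null p"
  shows "s \<in> padic_null p \<or> t \<in> padic_null p"
proof (rule ccontr)
  assume "\<not> (s \<in> padic_null p \<or> t \<in> padic_null p)"
  then have "s \<notin> padic_null p" and nt: "t \<notin> padic_null p" by auto
  then obtain r where r: "r \<in> padic_cauchy p" "(\<lambda>n. s n * r n - 1) \<in> padic_null p"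
    using padic_cauchy_inverse[OF p s] by metis
  have "(\<lambda>n. r n * (s n * t n) - t n * (s n * r n - 1)) \<in> padic_null p"
    by (intro padic_null_diff padic_null_mult p r t assms)
  then show False using nt by (simp add: algebra_simps)
qed

lemma padic_cauchy_power: "prime p \<Longrightarrow> s \<in> padic_cauchy p \<Longrightarrow> (\<lambda>n. s n ^ k) \<in> padic_cauchy p"
  by (induction k) (simp_all add: padic_cauchy_const padic_cauchy_mult)

lemma padic_cauchy_divide: "prime p \<Longrightarrow> s \<in> padic_cauchy p \<Longrightarrow> (\<lambda>n. s n / c) \<in> padic_cauchy p"
  using padic_cauchy_mult[OF _ _ padic_cauchy_const, of p s "1 / c"] by simp

lemmas padic_cauchy_intros =
  padic_cauchy_const padic_cauchy_divide padic_cauchy_add padic_cauchy_minus padic_cauchy_diff padic_cauchy_mult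
    padic_cauchy_power

lemma padic_cauchy_ring_simps:
  "\<one>\<^bsub>padic_cauchy_ring p\<^esub> = (\<lambda>n. 1)" "\<zero>\<^bsub>padic_cauchy_ring p\<^esub> = (\<lambda>n. 0)"
  "s \<otimes>\<^bsub>padic_cauchy_ring p\<^esub> t = (\<lambda>n. s n * t n)" "s \<oplus>\<^bsub>padic_cauchy_ring p\<^esub> t = (\<lambda>n. s n + t n)"
  by (simp_all add: padic_cauchy_ring_def)

lemma padic_cauchy_cring:
  assumes p: "prime p"
  shows "cring (padic_cauchy_ring p)"
proof (rule cringI)
  show "abelian_group (padic_cauchy_ring p)"
  proof (rule abelian_groupI)
    fix s assume s: "s \<in> padic_cauchy p"
    show "\<exists>y\<in>padic_cauchy p. y \<oplus>\<^bsub>padic_cauchy_ring p\<^esub> s = \<zero>\<^bsub>padic_cauchy_ring p\<^esub>"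
      by (rule bexI[OF _ padic_cauchy_minus[OF s]]) (simp add: padic_cauchy_ring_simps)
  qed (auto simp: padic_cauchy_ring_simps padic_cauchy_intros p add_ac)
  show "Group.comm_monoid (padic_cauchy_ring p)"
    by (rule comm_monoidI) (auto simp: padic_cauchy_ring_simps padic_cauchy_intros p mult_ac)
qed (auto simp: padic_cauchy_ring_simps padic_cauchy_intros p algebra_simps)

lemma padic_null_ideal:
  assumes p: "prime p"
  shows "ideal (padic_null p) (padic_cauchy_ring p)"
proof -
  interpret cring "padic_cauchy_ring p" by (rule padic_cauchy_cring[OF p])
  have inv: "\<ominus>\<^bsub>padic_cauchy_ring p\<^esub> s = (\<lambda>n. - s n)" if "s \<in> padic_cauchy p" for s
    by (rule minus_equality) (use that in \<open>auto simp: padic_cauchy_ring_simps padic_cauchy_intros p\<close>)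
  have null_mult': "(\<lambda>n. a n * s n) \<in> padic_null p" if "a \<in> padic_null p" "s \<in> padic_cauchy p" for a s
    using padic_null_mult[OF p that(2,1)] by (simp add: mult.commute)
  show ?thesis
  proof (rule idealI)
    show "subgroup (padic_null p) (add_monoid (padic_cauchy_ring p))"
    proof (rule group.subgroupI)
      show "group (add_monoid (padic_cauchy_ring p))" by (rule add.is_group)
      show "padic_null p \<noteq> {}" using padic_null_zero by blast
      show "inv\<^bsub>add_monoid (padic_cauchy_ring p)\<^esub> s \<in> padic_null p" if "s \<in> padic_null p" for s
        using inv[OF padic_null_imp_cauchy[OF p that]] padic_null_minus[OF that] by (simp add: a_inv_def)
    qed (auto simp: padic_cauchy_ring_simps padic_null_add p padic_null_imp_cauchy)
  qed (auto simp: padic_cauchy_ring_simps ring_axioms padic_null_mult p null_mult')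
qed

section \<open>Elements of Q_p as classes of rational Cauchy sequences\<close>

definition padic_class :: "nat \<Rightarrow> (nat \<Rightarrow> rat) \<Rightarrow> (nat \<Rightarrow> rat) set" where
  "padic_class p s = padic_null p +>\<^bsub>padic_cauchy_ring p\<^esub> s"

lemma Qp_of_rat_eq: "Qp_of_rat p r = padic_class p (\<lambda>n. r)"
  by (simp add: Qp_of_rat_def padic_class_def)

lemma carrier_Qp: "carrier (Qp p) = padic_class p ` padic_cauchy p"
  by (auto simp: Qp_def FactRing_def A_RCOSETS_def' padic_class_def)

lemma padic_class_closed: "s \<in> padic_cauchy p \<Longrightarrow> padic_class p s \<in> carrier (Qp p)"
  by (auto simp: carrier_Qp)

context
  fixes p :: nat
  assumes p: "prime p"
begin

lemma Qp_cring: "cring (Qp p)"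
  unfolding Qp_def by (rule ideal.quotient_is_cring[OF padic_null_ideal[OF p] padic_cauchy_cring[OF p]])

lemma padic_class_hom: "padic_class p \<in> ring_hom (padic_cauchy_ring p) (Qp p)"
  using ideal.rcos_ring_hom[OF padic_null_ideal[OF p]] by (simp add: padic_class_def[abs_def] Qp_def)

lemma padic_class_add:
  "s \<in> padic_cauchy p \<Longrightarrow> t \<in> padic_cauchy p \<Longrightarrow>
    padic_class p s \<oplus>\<^bsub>Qp p\<^esub> padic_class p t = padic_class p (\<lambda>n. s n + t n)"
  using ring_hom_add[OF padic_class_hom] by (simp add: padic_cauchy_ring_simps)

lemma padic_class_mult:
  "s \<in> padic_cauchy p \<Longrightarrow> t \<in> padic_cauchy p \<Longrightarrow>
    padic_class p s \<otimes>\<^bsub>Qp p\<^esub> padic_class p t = padic_class p (\<lambda>n. s n * t n)"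
  using ring_hom_mult[OF padic_class_hom] by (simp add: padic_cauchy_ring_simps)

lemma padic_class_one: "\<one>\<^bsub>Qp p\<^esub> = padic_class p (\<lambda>n. 1)"
  using ring_hom_one[OF padic_class_hom] by (simp add: padic_cauchy_ring_simps)

lemma padic_class_zero: "\<zero>\<^bsub>Qp p\<^esub> = padic_class p (\<lambda>n. 0)"
  using ring_hom_zero[OF padic_class_hom cring.axioms(1)[OF padic_cauchy_cring[OF p]] cring.axioms(1)[OF
    Qp_cring]]
  by (simp add: padic_cauchy_ring_simps)

lemma padic_class_uminus:
  assumes s: "s \<in> padic_cauchy p"
  shows "\<ominus>\<^bsub>Qp p\<^esub> padic_class p s = padic_class p (\<lambda>n. - s n)"
proof -
  interpret cring "Qp p" by (rule Qp_cring)
  show ?thesis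
    by (rule minus_equality)
      (use s in \<open>auto simp: padic_class_add padic_class_zero padic_class_closed padic_cauchy_intros\<close>)
qed

lemma padic_class_minus:
  "s \<in> padic_cauchy p \<Longrightarrow> t \<in> padic_cauchy p \<Longrightarrow>
    padic_class p s \<ominus>\<^bsub>Qp p\<^esub> padic_class p t = padic_class p (\<lambda>n. s n - t n)"
  by (simp add: a_minus_def padic_class_uminus padic_class_add padic_cauchy_intros)

lemma padic_class_eq_iff:
  assumes s: "s \<in> padic_cauchy p" and t: "t \<in> padic_cauchy p"
  shows "padic_class p s = padic_class p t \<longleftrightarrow> (\<lambda>n. s n - t n) \<in> padic_null p"
proof -
  interpret C: cring "padic_cauchy_ring p" by (rule padic_cauchy_cring[OF p])
  interpret ideal "padic_null p" "padic_cauchy_ring p" by (rule padic_null_ideal[OF p])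
  have inv: "\<ominus>\<^bsub>padic_cauchy_ring p\<^esub> t = (\<lambda>n. - t n)"
    by (rule C.minus_equality) (use t in \<open>auto simp: padic_cauchy_ring_simps padic_cauchy_intros p\<close>)
  show ?thesis
    using C.quotient_eq_iff_same_a_r_cos[OF padic_null_ideal[OF p] s t]
    by (simp add: padic_class_def a_minus_def inv padic_cauchy_ring_simps)
qed

text \<open>Serves the identities that use an equation valid only in Q_p: the two representatives
  then differ termwise by a multiple of the null sequence expressing that equation.\<close>

lemma padic_class_eqI:
  assumes "s \<in> padic_cauchy p" "t \<in> padic_cauchy p" "f \<in> padic_cauchy p" "e \<in> padic_null p"
    and "\<And>n. s n - t n = f n * e n"
  shows "padic_class p s = padic_class p t"
  using assms padic_null_mult[OF p assms(3,4)] by (simp add: padic_class_eq_iff)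

lemma padic_class_eq_zero_iff:
  "s \<in> padic_cauchy p \<Longrightarrow> padic_class p s = \<zero>\<^bsub>Qp p\<^esub> \<longleftrightarrow> s \<in> padic_null p"
  by (simp add: padic_class_zero padic_class_eq_iff padic_cauchy_const)

end

lemma padic_class_cong: "(\<And>n. s n = t n) \<Longrightarrow> padic_class p s = padic_class p t"
  by presburger

section \<open>Quaternion algebras over the p-adic numbers\<close>

text \<open>For a not a square in Q_p this says that b is a norm from Q_p(sqrt a). It is phrased on
  representatives, so that it can be handled by rational arithmetic alone.\<close>

definition padic_split :: "nat \<Rightarrow> rat \<Rightarrow> rat \<Rightarrow> bool" where
  "padic_split p a b \<longleftrightarrow>
     (\<exists>u \<in> padic_cauchy p. \<exists>v \<in> padic_cauchy p. (\<lambda>n. u n ^ 2 - a * v n ^ 2 - b) \<in> padic_null p)"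

text \<open>The quadratic form is the reduced norm of (a, b / Q_p), and the sequences represent a
  nontrivial zero of it.\<close>

definition padic_isotropic :: "nat \<Rightarrow> rat \<Rightarrow> rat \<Rightarrow> bool" where
  "padic_isotropic p a b \<longleftrightarrow>
     (\<exists>t \<in> padic_cauchy p. \<exists>x \<in> padic_cauchy p. \<exists>y \<in> padic_cauchy p. \<exists>z \<in> padic_cauchy p.
        \<not> (t \<in> padic_null p \<and> x \<in> padic_null p \<and> y \<in> padic_null p \<and> z \<in> padic_null p) \<and>
        (\<lambda>n. t n ^ 2 - a * x n ^ 2 - b * y n ^ 2 + a * b * z n ^ 2) \<in> padic_null p)"

lemma quat_alg_simps:
  "carrier (quat_alg K a b) = carrier K \<times> carrier K \<times> carrier K \<times> carrier K"
  "\<one>\<^bsub>quat_alg K a b\<^esub> = (\<one>\<^bsub>K\<^esub>, \<zero>\<^bsub>K\<^esub>, \<zero>\<^bsub>K\<^esub>, \<zero>\<^bsub>K\<^esub>)"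
  "\<zero>\<^bsub>quat_alg K a b\<^esub> = (\<zero>\<^bsub>K\<^esub>, \<zero>\<^bsub>K\<^esub>, \<zero>\<^bsub>K\<^esub>, \<zero>\<^bsub>K\<^esub>)"
  "(t, x, y, z) \<oplus>\<^bsub>quat_alg K a b\<^esub> (t', x', y', z') =
     (t \<oplus>\<^bsub>K\<^esub> t', x \<oplus>\<^bsub>K\<^esub> x', y \<oplus>\<^bsub>K\<^esub> y', z \<oplus>\<^bsub>K\<^esub> z')"
  "c \<odot>\<^bsub>quat_alg K a b\<^esub> (t, x, y, z) = (c \<otimes>\<^bsub>K\<^esub> t, c \<otimes>\<^bsub>K\<^esub> x, c \<otimes>\<^bsub>K\<^esub> y, c \<otimes>\<^bsub>K\<^esub> z)"
  "(t, x, y, z) \<otimes>\<^bsub>quat_alg K a b\<^esub> (t', x', y', z') =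
     (t \<otimes>\<^bsub>K\<^esub> t' \<oplus>\<^bsub>K\<^esub> a \<otimes>\<^bsub>K\<^esub> x \<otimes>\<^bsub>K\<^esub> x' \<oplus>\<^bsub>K\<^esub> b \<otimes>\<^bsub>K\<^esub> y \<otimes>\<^bsub>K\<^esub> y'
        \<ominus>\<^bsub>K\<^esub> a \<otimes>\<^bsub>K\<^esub> b \<otimes>\<^bsub>K\<^esub> z \<otimes>\<^bsub>K\<^esub> z',
      t \<otimes>\<^bsub>K\<^esub> x' \<oplus>\<^bsub>K\<^esub> x \<otimes>\<^bsub>K\<^esub> t' \<oplus>\<^bsub>K\<^esub> b \<otimes>\<^bsub>K\<^esub> z \<otimes>\<^bsub>K\<^esub> y' \<ominus>\<^bsub>K\<^esub> b \<otimes>\<^bsub>K\<^esub> y \<otimes>\<^bsub>K\<^esub> z',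
      t \<otimes>\<^bsub>K\<^esub> y' \<oplus>\<^bsub>K\<^esub> y \<otimes>\<^bsub>K\<^esub> t' \<oplus>\<^bsub>K\<^esub> a \<otimes>\<^bsub>K\<^esub> x \<otimes>\<^bsub>K\<^esub> z' \<ominus>\<^bsub>K\<^esub> a \<otimes>\<^bsub>K\<^esub> z \<otimes>\<^bsub>K\<^esub> x',
      t \<otimes>\<^bsub>K\<^esub> z' \<oplus>\<^bsub>K\<^esub> z \<otimes>\<^bsub>K\<^esub> t' \<oplus>\<^bsub>K\<^esub> x \<otimes>\<^bsub>K\<^esub> y' \<ominus>\<^bsub>K\<^esub> y \<otimes>\<^bsub>K\<^esub> x')"
  by (simp_all add: quat_alg_def)

lemma mat2_alg_simps:
  "carrier (mat2_alg K) = carrier K \<times> carrier K \<times> carrier K \<times> carrier K"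
  "\<one>\<^bsub>mat2_alg K\<^esub> = (\<one>\<^bsub>K\<^esub>, \<zero>\<^bsub>K\<^esub>, \<zero>\<^bsub>K\<^esub>, \<one>\<^bsub>K\<^esub>)"
  "\<zero>\<^bsub>mat2_alg K\<^esub> = (\<zero>\<^bsub>K\<^esub>, \<zero>\<^bsub>K\<^esub>, \<zero>\<^bsub>K\<^esub>, \<zero>\<^bsub>K\<^esub>)"
  "(t, x, y, z) \<oplus>\<^bsub>mat2_alg K\<^esub> (t', x', y', z') =
     (t \<oplus>\<^bsub>K\<^esub> t', x \<oplus>\<^bsub>K\<^esub> x', y \<oplus>\<^bsub>K\<^esub> y', z \<oplus>\<^bsub>K\<^esub> z')"
  "c \<odot>\<^bsub>mat2_alg K\<^esub> (t, x, y, z) = (c \<otimes>\<^bsub>K\<^esub> t, c \<otimes>\<^bsub>K\<^esub> x, c \<otimes>\<^bsub>K\<^esub> y, c \<otimes>\<^bsub>K\<^esub> z)"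
  "(t, x, y, z) \<otimes>\<^bsub>mat2_alg K\<^esub> (t', x', y', z') =
     (t \<otimes>\<^bsub>K\<^esub> t' \<oplus>\<^bsub>K\<^esub> x \<otimes>\<^bsub>K\<^esub> y', t \<otimes>\<^bsub>K\<^esub> x' \<oplus>\<^bsub>K\<^esub> x \<otimes>\<^bsub>K\<^esub> z',
      y \<otimes>\<^bsub>K\<^esub> t' \<oplus>\<^bsub>K\<^esub> z \<otimes>\<^bsub>K\<^esub> y', y \<otimes>\<^bsub>K\<^esub> x' \<oplus>\<^bsub>K\<^esub> z \<otimes>\<^bsub>K\<^esub> z')"
  by (simp_all add: mat2_alg_def)

lemma Qp_tuple_cases:
  assumes "w \<in> carrier (Qp p) \<times> carrier (Qp p) \<times> carrier (Qp p) \<times> carrier (Qp p)"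
  obtains t x y z where "t \<in> padic_cauchy p" "x \<in> padic_cauchy p" "y \<in> padic_cauchy p" "z \<in> padic_cauchy p"
    "w = (padic_class p t, padic_class p x, padic_class p y, padic_class p z)"
  using assms by (auto simp: carrier_Qp)

context
  fixes p :: nat
  assumes p: "prime p"
begin

lemmas Qp_simps = padic_class_add[OF p] padic_class_mult[OF p] padic_class_minus[OF p]
  padic_class_uminus[OF p] padic_class_one[OF p] padic_class_zero[OF p] padic_class_closed
  padic_cauchy_intros p

lemma quat_alg_Qp_ring:
  assumes a: "\<alpha> \<in> padic_cauchy p" and b: "\<beta> \<in> padic_cauchy p"
  shows "ring (quat_alg (Qp p) (padic_class p \<alpha>) (padic_class p \<beta>))" (is "ring ?H")
proof -
  \<comment> \<open>With representatives chosen for all four coordinates, each ring axiom becomes a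
    polynomial identity between rationals at every index.\<close>
  have E: thesis if "w \<in> carrier ?H"
    "\<And>t x y z. t \<in> padic_cauchy p \<Longrightarrow> x \<in> padic_cauchy p \<Longrightarrow> y \<in> padic_cauchy p \<Longrightarrow> z \<in> padic_cauchy p
      \<Longrightarrow> w = (padic_class p t, padic_class p x, padic_class p y, padic_class p z) \<Longrightarrow> thesis" for w thesis
    using that Qp_tuple_cases unfolding quat_alg_simps by metis
  show ?thesis
  proof (rule ringI)
    show "abelian_group ?H"
    proof (rule abelian_groupI)
      fix w assume w: "w \<in> carrier ?H"
      then obtain t x y z where wt: "t \<in> padic_cauchy p" "x \<in> padic_cauchy p" "y \<in> padic_cauchy p"
        "z \<in> padic_cauchy p"
        "w = (padic_class p t, padic_class p x, padic_class p y, padic_class p z)" by (rule E)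
      show "\<exists>y\<in>carrier ?H. y \<oplus>\<^bsub>?H\<^esub> w = \<zero>\<^bsub>?H\<^esub>"
        by (rule bexI[of _ "(padic_class p (\<lambda>n. - t n), padic_class p (\<lambda>n. - x n), padic_class p (\<lambda>n. - y n),
          padic_class p (\<lambda>n. - z n))"])
          (use wt in \<open>simp_all add: quat_alg_simps Qp_simps\<close>)
      show "\<zero>\<^bsub>?H\<^esub> \<oplus>\<^bsub>?H\<^esub> w = w"
        using wt by (simp add: quat_alg_simps Qp_simps)
    next
      fix u v w assume uvw: "u \<in> carrier ?H" "v \<in> carrier ?H" "w \<in> carrier ?H"
      show "u \<oplus>\<^bsub>?H\<^esub> v \<oplus>\<^bsub>?H\<^esub> w = u \<oplus>\<^bsub>?H\<^esub> (v \<oplus>\<^bsub>?H\<^esub> w)"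
        using uvw by (elim E) (simp add: quat_alg_simps Qp_simps add.assoc)
    next
      fix u v assume uvw: "u \<in> carrier ?H" "v \<in> carrier ?H"
      show "u \<oplus>\<^bsub>?H\<^esub> v \<in> carrier ?H"
        using uvw by (elim E) (simp add: quat_alg_simps Qp_simps)
      show "u \<oplus>\<^bsub>?H\<^esub> v = v \<oplus>\<^bsub>?H\<^esub> u"
        using uvw by (elim E) (simp add: quat_alg_simps Qp_simps add.commute)
    qed (simp add: quat_alg_simps Qp_simps)
    show "Group.monoid ?H"
    proof (rule monoidI)
      fix u v assume uvw: "u \<in> carrier ?H" "v \<in> carrier ?H"
      show "u \<otimes>\<^bsub>?H\<^esub> v \<in> carrier ?H"
        using uvw a b by (elim E) (simp add: quat_alg_simps Qp_simps)
    next
      fix w assume w: "w \<in> carrier ?H"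
      show "\<one>\<^bsub>?H\<^esub> \<otimes>\<^bsub>?H\<^esub> w = w"
        using w a b by (elim E) (simp add: quat_alg_simps Qp_simps)
      show "w \<otimes>\<^bsub>?H\<^esub> \<one>\<^bsub>?H\<^esub> = w"
        using w a b by (elim E) (simp add: quat_alg_simps Qp_simps)
    next
      fix u v w assume uvw: "u \<in> carrier ?H" "v \<in> carrier ?H" "w \<in> carrier ?H"
      show "u \<otimes>\<^bsub>?H\<^esub> v \<otimes>\<^bsub>?H\<^esub> w = u \<otimes>\<^bsub>?H\<^esub> (v \<otimes>\<^bsub>?H\<^esub> w)"
        using uvw a b
        by (elim E) (simp add: quat_alg_simps Qp_simps, intro conjI padic_class_cong; simp add: algebra_simps
          power2_eq_square)
    qed (simp add: quat_alg_simps Qp_simps)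
  next
    fix u v w assume uvw: "u \<in> carrier ?H" "v \<in> carrier ?H" "w \<in> carrier ?H"
    show "(u \<oplus>\<^bsub>?H\<^esub> v) \<otimes>\<^bsub>?H\<^esub> w = u \<otimes>\<^bsub>?H\<^esub> w \<oplus>\<^bsub>?H\<^esub> v \<otimes>\<^bsub>?H\<^esub> w"
      using uvw a b
      by (elim E) (simp add: quat_alg_simps Qp_simps, intro conjI padic_class_cong; simp add: algebra_simps
        power2_eq_square)
    show "w \<otimes>\<^bsub>?H\<^esub> (u \<oplus>\<^bsub>?H\<^esub> v) = w \<otimes>\<^bsub>?H\<^esub> u \<oplus>\<^bsub>?H\<^esub> w \<otimes>\<^bsub>?H\<^esub> v"
      using uvw a b
      by (elim E) (simp add: quat_alg_simps Qp_simps, intro conjI padic_class_cong; simp add: algebra_simps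
        power2_eq_square)
  qed
qed

lemma padic_class_one_neq_zero: "padic_class p (\<lambda>n. 1) \<noteq> padic_class p (\<lambda>n. 0)"
  by (simp add: padic_class_eq_iff[OF p] padic_cauchy_const padic_null_const_iff[OF p])

text \<open>The inverse of a nonzero w is its conjugate divided by its reduced norm N. Anisotropy
  says that N is not a null sequence, so it has an inverse r.\<close>

lemma quat_alg_Qp_division_ring:
  assumes ni: "\<not> padic_isotropic p a b"
  shows "division_ring (quat_alg (Qp p) (Qp_of_rat p a) (Qp_of_rat p b))" (is "division_ring ?H")
  unfolding division_ring_def
proof
  show "ring ?H" unfolding Qp_of_rat_eq by (rule quat_alg_Qp_ring) (rule padic_cauchy_const)+
  show "Units ?H = carrier ?H - {\<zero>\<^bsub>?H\<^esub>}"
  proof (intro equalityI subsetI)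
    fix w assume w: "w \<in> Units ?H"
    have "w \<noteq> \<zero>\<^bsub>?H\<^esub>"
    proof
      assume w0: "w = \<zero>\<^bsub>?H\<^esub>"
      obtain v where v: "v \<in> carrier ?H" "v \<otimes>\<^bsub>?H\<^esub> w = \<one>\<^bsub>?H\<^esub>" using w unfolding Units_def by auto
      obtain t x y z where "t \<in> padic_cauchy p" "x \<in> padic_cauchy p" "y \<in> padic_cauchy p" "z \<in> padic_cauchy p"
        "v = (padic_class p t, padic_class p x, padic_class p y, padic_class p z)"
        using v(1) unfolding quat_alg_simps by (rule Qp_tuple_cases)
      then show False
        using v(2) padic_class_one_neq_zero unfolding w0 Qp_of_rat_eq
        by (simp add: quat_alg_simps Qp_simps)
    qed
    then show "w \<in> carrier ?H - {\<zero>\<^bsub>?H\<^esub>}" using w by (simp add: Units_def)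
  next
    fix w assume w: "w \<in> carrier ?H - {\<zero>\<^bsub>?H\<^esub>}"
    then have "w \<in> carrier ?H" by simp
    then obtain t x y z where wt: "t \<in> padic_cauchy p" "x \<in> padic_cauchy p" "y \<in> padic_cauchy p"
      "z \<in> padic_cauchy p"
      and weq: "w = (padic_class p t, padic_class p x, padic_class p y, padic_class p z)"
      unfolding quat_alg_simps by (rule Qp_tuple_cases)
    define N where "N = (\<lambda>n. t n ^ 2 - a * x n ^ 2 - b * y n ^ 2 + a * b * z n ^ 2)"
    have NC: "N \<in> padic_cauchy p" unfolding N_def by (intro padic_cauchy_intros wt p)
    have "\<not> (t \<in> padic_null p \<and> x \<in> padic_null p \<and> y \<in> padic_null p \<and> z \<in> padic_null p)"
      using w wt unfolding weq by (simp add: quat_alg_simps padic_class_eq_zero_iff[OF p])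
    then have "N \<notin> padic_null p"
      using ni wt unfolding padic_isotropic_def N_def by blast
    then obtain r where r: "r \<in> padic_cauchy p" "(\<lambda>n. N n * r n - 1) \<in> padic_null p"
      using padic_cauchy_inverse[OF p NC] by metis
    have N1: "padic_class p s = padic_class p (\<lambda>n. 1)"
      if "s \<in> padic_cauchy p" "\<And>n. s n = N n * r n" for s
      using r that by (simp add: padic_class_eq_iff[OF p] padic_cauchy_const)
    let ?v = "(padic_class p (\<lambda>n. t n * r n), padic_class p (\<lambda>n. - x n * r n),
      padic_class p (\<lambda>n. - y n * r n), padic_class p (\<lambda>n. - z n * r n))"
    have "?v \<in> carrier ?H" using wt r by (simp add: quat_alg_simps Qp_simps)
    moreover have "w \<otimes>\<^bsub>?H\<^esub> ?v = \<one>\<^bsub>?H\<^esub>"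
      unfolding weq Qp_of_rat_eq using wt r(1)
      by (simp add: quat_alg_simps Qp_simps, intro conjI N1)
        (auto intro!: padic_class_cong padic_cauchy_intros p simp: N_def algebra_simps power2_eq_square)
    moreover have "?v \<otimes>\<^bsub>?H\<^esub> w = \<one>\<^bsub>?H\<^esub>"
      unfolding weq Qp_of_rat_eq using wt r(1)
      by (simp add: quat_alg_simps Qp_simps, intro conjI N1)
        (auto intro!: padic_class_cong padic_cauchy_intros p simp: N_def algebra_simps power2_eq_square)
    ultimately show "w \<in> Units ?H" using w by (auto simp: Units_def)
  qed
qed

section \<open>Equivalence of isotropy, splitting and being a matrix algebra\<close>

lemma split_imp_isotropic:
  assumes "padic_split p a b"
  shows "padic_isotropic p a b"
proof -
  obtain u v where uv: "u \<in> padic_cauchy p" "v \<in> padic_cauchy p"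
    "(\<lambda>n. u n ^ 2 - a * v n ^ 2 - b) \<in> padic_null p"
    using assms unfolding padic_split_def by blast
  have "(\<lambda>n. (1::rat)) \<notin> padic_null p" by (simp add: padic_null_const_iff[OF p])
  then show ?thesis
    unfolding padic_isotropic_def using uv
    by (intro bexI[of _ u] bexI[of _ v] bexI[of _ "\<lambda>n. 1"] bexI[of _ "\<lambda>n. 0"])
      (auto simp: padic_cauchy_const)
qed

text \<open>With N(u, v) = u^2 - a v^2 the isotropy equation reads N(t, x) = b N(y, z). If N(y, z)
  is nonzero, b is a quotient of values of N and N is multiplicative. Otherwise N itself has a
  nontrivial zero, a is a square in Q_p, and N takes every value.\<close>

lemma isotropic_imp_split:
  assumes iso: "padic_isotropic p a b" and a: "a \<noteq> 0"
  shows "padic_split p a b"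
proof -
  obtain t x y z where C: "t \<in> padic_cauchy p" "x \<in> padic_cauchy p" "y \<in> padic_cauchy p" "z \<in> padic_cauchy p"
    and nn: "\<not> (t \<in> padic_null p \<and> x \<in> padic_null p \<and> y \<in> padic_null p \<and> z \<in> padic_null p)"
    and e: "(\<lambda>n. t n ^ 2 - a * x n ^ 2 - b * y n ^ 2 + a * b * z n ^ 2) \<in> padic_null p"
    using iso unfolding padic_isotropic_def by blast
  have square: "padic_split p a b"
    if yz: "y \<in> padic_cauchy p" "z \<in> padic_cauchy p" and nn: "\<not> (y \<in> padic_null p \<and> z \<in> padic_null p)"
      and e: "(\<lambda>n. y n ^ 2 - a * z n ^ 2) \<in> padic_null p" for y z
  proof -
    have "z \<notin> padic_null p"
    proof
      assume z: "z \<in> padic_null p"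
      have "(\<lambda>n. (y n ^ 2 - a * z n ^ 2) + (a * z n) * z n) \<in> padic_null p"
        by (intro padic_null_add padic_null_mult padic_cauchy_intros p e z yz)
      then have "(\<lambda>n. y n * y n) \<in> padic_null p" by (simp add: power2_eq_square algebra_simps)
      then have "y \<in> padic_null p" using padic_null_mult_imp[OF p yz(1) yz(1)] by blast
      then show False using nn z by blast
    qed
    then have "y \<notin> padic_null p"
    proof (rule contrapos_nn)
      assume y: "y \<in> padic_null p"
      have "(\<lambda>n. inverse a * (y n * y n - (y n ^ 2 - a * z n ^ 2))) \<in> padic_null p"
        by (intro padic_null_diff padic_null_mult padic_cauchy_intros p e y yz)
      then have "(\<lambda>n. z n * z n) \<in> padic_null p" using a by (simp add: power2_eq_square flip: mult.assoc)
      then show "z \<in> padic_null p" using padic_null_mult_imp[OF p yz(2) yz(2)] by blast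
    qed
    then obtain r where r: "r \<in> padic_cauchy p" "(\<lambda>n. y n * r n - 1) \<in> padic_null p"
      using padic_cauchy_inverse[OF p yz(1)] by metis
    \<comment> \<open>Since a (z/y)^2 = 1, the solution comes from ((b + 1)/2)^2 - ((b - 1)/2)^2 =
      b, with r in place of 1/y.\<close>
    define v where "v = (\<lambda>n. (b - 1) / 2 * (z n * r n))"
    have vC: "v \<in> padic_cauchy p" unfolding v_def by (intro padic_cauchy_intros p yz r)
    let ?c = "((b - 1) / 2)\<^sup>2"
    have "(\<lambda>n. (?c * r n ^ 2) * (y n ^ 2 - a * z n ^ 2) - (?c * (y n * r n + 1)) * (y n * r n - 1)) \<in> padic_null
      p"
      by (intro padic_null_diff padic_null_mult padic_cauchy_intros p e yz r)
    moreover have "(?c * r n ^ 2) * (y n ^ 2 - a * z n ^ 2) - (?c * (y n * r n + 1)) * (y n * r n - 1)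
        = ((b + 1) / 2) ^ 2 - a * v n ^ 2 - b" for n
      unfolding v_def by (simp add: field_simps power2_eq_square)
    ultimately show ?thesis
      unfolding padic_split_def
      by (intro bexI[of _ "\<lambda>n. (b + 1) / 2"] bexI[of _ v] vC padic_cauchy_const) simp
  qed
  define M where "M = (\<lambda>n. y n ^ 2 - a * z n ^ 2)"
  have MC: "M \<in> padic_cauchy p" unfolding M_def by (intro padic_cauchy_intros p C)
  show ?thesis
  proof (cases "M \<in> padic_null p")
    case True
    show ?thesis
    proof (cases "y \<in> padic_null p \<and> z \<in> padic_null p")
      case False then show ?thesis using square[OF C(3,4)] True unfolding M_def by blast
    next
      case yz: True
      have "(\<lambda>n. (t n ^ 2 - a * x n ^ 2 - b * y n ^ 2 + a * b * z n ^ 2) + b * M n) \<in> padic_null p"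
        by (intro padic_null_add padic_null_mult padic_cauchy_intros p e True)
      then have "(\<lambda>n. t n ^ 2 - a * x n ^ 2) \<in> padic_null p" by (simp add: M_def algebra_simps)
      then show ?thesis using square[OF C(1,2)] nn yz by blast
    qed
  next
    case False
    then obtain r where r: "r \<in> padic_cauchy p" "(\<lambda>n. M n * r n - 1) \<in> padic_null p"
      using padic_cauchy_inverse[OF p MC] by metis
    \<comment> \<open>These are the coordinates of (t + x sqrt a)(y - z sqrt a) / N(y, z), that is,
      of the quotient of t + x sqrt a by y + z sqrt a.\<close>
    define u v where "u = (\<lambda>n. (t n * y n - a * x n * z n) * r n)" and "v = (\<lambda>n. (x n * y n - t n * z n) * r n)"
    have uv: "u \<in> padic_cauchy p" "v \<in> padic_cauchy p"
      unfolding u_def v_def by (intro padic_cauchy_intros p C r)+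
    \<comment> \<open>Here u^2 - a v^2 equals M r^2 times N(t, x). Replacing N(t, x) by b M leaves
      the error b ((M r)^2 - 1), which factors through the null sequence M r - 1.\<close>
    have "(\<lambda>n. (M n * r n ^ 2) * (t n ^ 2 - a * x n ^ 2 - b * y n ^ 2 + a * b * z n ^ 2)
        + (b * (M n * r n + 1)) * (M n * r n - 1)) \<in> padic_null p"
      by (intro padic_null_add padic_null_mult padic_cauchy_intros p e MC r)
    moreover have "(M n * r n ^ 2) * (t n ^ 2 - a * x n ^ 2 - b * y n ^ 2 + a * b * z n ^ 2)
        + (b * (M n * r n + 1)) * (M n * r n - 1) = u n ^ 2 - a * v n ^ 2 - b" for n
      unfolding u_def v_def M_def by (simp add: algebra_simps power2_eq_square)
    ultimately show ?thesis unfolding padic_split_def using uv by auto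
  qed
qed

text \<open>The algebra acts on Q_p[X]/(X^2 - a) with basis 1, X: i as multiplication by X, and j as
  the conjugation X -> -X followed by multiplication by u + v X. The square of the latter is u^2 - a
  v^2, which is b. The map \<open>h\<close> writes this action as matrices.\<close>

lemma split_imp_mat2:
  assumes split: "padic_split p a b" and a: "a \<noteq> 0" and b: "b \<noteq> 0"
  shows "alg_isomorphic (Qp p) (quat_alg (Qp p) (Qp_of_rat p a) (Qp_of_rat p b)) (mat2_alg (Qp p))"
proof -
  obtain u v where uv: "u \<in> padic_cauchy p" "v \<in> padic_cauchy p" and e:
    "(\<lambda>n. u n ^ 2 - a * v n ^ 2 - b) \<in> padic_null p"
    using split unfolding padic_split_def by blast
  \<comment> \<open>In Q_p this is b. Working with \<beta> makes \<open>h\<close> multiplicative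
    termwise, without an error; the null sequence \<beta> - b enters only in \<open>bb\<close> and
    in the two inversion identities, because \<open>g\<close> divides by the rational b.\<close>
  define \<beta> where "\<beta> = (\<lambda>n. u n ^ 2 - a * v n ^ 2)"
  have bC: "\<beta> \<in> padic_cauchy p" unfolding \<beta>_def by (intro padic_cauchy_intros p uv)
  have eb: "(\<lambda>n. \<beta> n - b) \<in> padic_null p" using e unfolding \<beta>_def .
  have bb: "Qp_of_rat p b = padic_class p \<beta>"
    unfolding Qp_of_rat_eq using padic_null_minus[OF eb] bC
    by (simp add: padic_class_eq_iff[OF p] padic_cauchy_const)
  let ?K = "Qp p" and ?c = "padic_class p"
  let ?H = "quat_alg ?K (?c (\<lambda>n. a)) (?c \<beta>)"
  define h where "h = (\<lambda>(t, x, y, z).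
    (t \<oplus>\<^bsub>?K\<^esub> y \<otimes>\<^bsub>?K\<^esub> ?c u \<oplus>\<^bsub>?K\<^esub> z \<otimes>\<^bsub>?K\<^esub> ?c (\<lambda>n. a * v n),
     ?c (\<lambda>n. a) \<otimes>\<^bsub>?K\<^esub> (x \<ominus>\<^bsub>?K\<^esub> y \<otimes>\<^bsub>?K\<^esub> ?c v \<ominus>\<^bsub>?K\<^esub> z \<otimes>\<^bsub>?K\<^esub> ?c u),
     x \<oplus>\<^bsub>?K\<^esub> y \<otimes>\<^bsub>?K\<^esub> ?c v \<oplus>\<^bsub>?K\<^esub> z \<otimes>\<^bsub>?K\<^esub> ?c u,
     t \<ominus>\<^bsub>?K\<^esub> y \<otimes>\<^bsub>?K\<^esub> ?c u \<ominus>\<^bsub>?K\<^esub> z \<otimes>\<^bsub>?K\<^esub> ?c (\<lambda>n. a * v n)))"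
  \<comment> \<open>Sums and differences of the matrix entries give t, x, A = u y + a v z and B = v
    y + u z. The last two form a linear system of determinant u^2 - a v^2, whence the factor
    1/b.\<close>
  define g where "g = (\<lambda>(k, l, m, s).
    let A = ?c (\<lambda>n. 1/2) \<otimes>\<^bsub>?K\<^esub> (k \<ominus>\<^bsub>?K\<^esub> s); B = ?c (\<lambda>n. 1/2) \<otimes>\<^bsub>?K\<^esub> (m \<ominus>\<^bsub>?K\<^esub> ?c (\<lambda>n. 1/a) \<otimes>\<^bsub>?K\<^esub> l) in
    (?c (\<lambda>n. 1/2) \<otimes>\<^bsub>?K\<^esub> (k \<oplus>\<^bsub>?K\<^esub> s), ?c (\<lambda>n. 1/2) \<otimes>\<^bsub>?K\<^esub> (m \<oplus>\<^bsub>?K\<^esub> ?c (\<lambda>n. 1/a) \<otimes>\<^bsub>?K\<^esub> l),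
     ?c (\<lambda>n. 1/b) \<otimes>\<^bsub>?K\<^esub> (?c u \<otimes>\<^bsub>?K\<^esub> A \<ominus>\<^bsub>?K\<^esub> ?c (\<lambda>n. a * v n) \<otimes>\<^bsub>?K\<^esub> B),
     ?c (\<lambda>n. 1/b) \<otimes>\<^bsub>?K\<^esub> (?c u \<otimes>\<^bsub>?K\<^esub> B \<ominus>\<^bsub>?K\<^esub> ?c v \<otimes>\<^bsub>?K\<^esub> A)))"
  note S = quat_alg_simps mat2_alg_simps Qp_simps uv bC h_def g_def Let_def
  have E: thesis if "w \<in> carrier ?H"
    "\<And>t x y z. t \<in> padic_cauchy p \<Longrightarrow> x \<in> padic_cauchy p \<Longrightarrow> y \<in> padic_cauchy p \<Longrightarrow> z \<in> padic_cauchy p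
      \<Longrightarrow> w = (?c t, ?c x, ?c y, ?c z) \<Longrightarrow> thesis" for w thesis
    using that Qp_tuple_cases unfolding quat_alg_simps by metis
  have cM: "carrier (mat2_alg ?K) = carrier ?H" by (simp add: S)
  have hC: "h w \<in> carrier ?H" if "w \<in> carrier ?H" for w
    using that by (elim E) (simp add: S)
  have gC: "g w \<in> carrier ?H" if "w \<in> carrier ?H" for w
    using that by (elim E) (simp add: S)
  have gh: "g (h w) = w" if "w \<in> carrier ?H" for w
    using that
  proof (rule E)
    fix t x y z assume C: "t \<in> padic_cauchy p" "x \<in> padic_cauchy p" "y \<in> padic_cauchy p" "z \<in> padic_cauchy p"
      and w: "w = (?c t, ?c x, ?c y, ?c z)"
    have *: "?c s = ?c r" if "s \<in> padic_cauchy p" "r \<in> padic_cauchy p"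
      "\<And>n. s n - r n = (r n / b) * (\<beta> n - b)" for s r
      by (rule padic_class_eqI[OF p that(1,2) _ eb that(3)])
        (use padic_cauchy_mult[OF p that(2) padic_cauchy_const[of "1 / b"]] in simp)
    have **: "q / b - r = (r / b) * (\<beta> n - b)" if "q = \<beta> n * r" for q r n
      using b by (simp add: that field_simps)
    show "g (h w) = w"
      unfolding w using C a b
      by (simp add: S) (intro conjI *; (intro padic_cauchy_intros p uv C)?;
        intro **; simp add: \<beta>_def algebra_simps power2_eq_square)
  qed
  have hg: "h (g w) = w" if "w \<in> carrier ?H" for w
    using that
  proof (rule E)
    fix t x y z assume C: "t \<in> padic_cauchy p" "x \<in> padic_cauchy p" "y \<in> padic_cauchy p" "z \<in> padic_cauchy p"
      and w: "w = (?c t, ?c x, ?c y, ?c z)"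
    have C1: "(\<lambda>n. (t n - z n) / (2 * b)) \<in> padic_cauchy p"
      and C2: "(\<lambda>n. a * ((x n / a - y n) / (2 * b))) \<in> padic_cauchy p"
      and C3: "(\<lambda>n. (y n - x n / a) / (2 * b)) \<in> padic_cauchy p"
      and C4: "(\<lambda>n. (z n - t n) / (2 * b)) \<in> padic_cauchy p"
      by (intro padic_cauchy_intros p C)+
    \<comment> \<open>In each matrix entry the failure of \<open>h (g w) = w\<close> is an explicit
      multiple of u^2 - a v^2 - b; the multipliers are the sequences of \<open>C1\<close> to
      \<open>C4\<close>.\<close>
    have A1: "(t + z) / 2 + (u * (t - z) / 2 - a * v * c / 2) * u / b + (u * c / 2 - v * (t - z) / 2) * (a * v)
      / b - t
        = (t - z) / (2 * b) * (u\<^sup>2 - a * v\<^sup>2 - b)"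
      and A2: "(t + z) / 2 - (u * (t - z) / 2 - a * v * c / 2) * u / b - (u * c / 2 - v * (t - z) / 2) * (a * v)
        / b - z
        = (z - t) / (2 * b) * (u\<^sup>2 - a * v\<^sup>2 - b)"
      and A3: "(y + w) / 2 + (u * t / 2 - a * v * (y - w) / 2) * v / b + (u * (y - w) / 2 - v * t / 2) * u / b -
        y
        = (y - w) / (2 * b) * (u\<^sup>2 - a * v\<^sup>2 - b)"
      and A4: "(y + w) / 2 - (u * t / 2 - a * v * (y - w) / 2) * v / b - (u * (y - w) / 2 - v * t / 2) * u / b -
        w
        = (w - y) / (2 * b) * (u\<^sup>2 - a * v\<^sup>2 - b)" for t z u v c y w :: rat
      using b by (simp_all add: divide_simps) (simp_all add: algebra_simps power2_eq_square)
    have A5: "a * ((y + x / a) / 2 - (u * t / 2 - a * v * (y - x / a) / 2) * v / b - (u * (y - x / a) / 2 - v *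
      t / 2) * u / b) - x
        = a * ((x / a - y) / (2 * b)) * (u\<^sup>2 - a * v\<^sup>2 - b)" (is "a * ?q - x = _") for t u v y x :: rat
    proof -
      have "a * ?q - x = a * (?q - x / a)" using a by (simp add: right_diff_distrib)
      then show ?thesis unfolding A4 by (simp only: mult.assoc)
    qed
    show "h (g w) = w"
      unfolding w using C a b
      apply (simp add: S)
      apply (intro conjI)
      subgoal by (rule padic_class_eqI[OF p _ _ C1 eb]) (intro padic_cauchy_intros p uv C | simp only: A1
        \<beta>_def)+
      subgoal by (rule padic_class_eqI[OF p _ _ C2 eb]) (intro padic_cauchy_intros p uv C | simp only: A5
        \<beta>_def)+
      subgoal by (rule padic_class_eqI[OF p _ _ C3 eb]) (intro padic_cauchy_intros p uv C | simp only: A3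
        \<beta>_def)+
      subgoal by (rule padic_class_eqI[OF p _ _ C4 eb]) (intro padic_cauchy_intros p uv C | simp only: A2
        \<beta>_def)+
      done
  qed
  have "h \<in> ring_iso ?H (mat2_alg ?K)"
  proof (rule ring_iso_memI)
    show "bij_betw h (carrier ?H) (carrier (mat2_alg ?K))"
      unfolding cM by (rule bij_betw_byWitness[of _ g]) (use gh hg gC hC in auto)
    show "h w \<in> carrier (mat2_alg ?K)" if "w \<in> carrier ?H" for w using hC[OF that] cM by simp
    show "h \<one>\<^bsub>?H\<^esub> = \<one>\<^bsub>mat2_alg ?K\<^esub>" by (simp add: S)
    fix w w' assume w: "w \<in> carrier ?H" "w' \<in> carrier ?H"
    show "h (w \<oplus>\<^bsub>?H\<^esub> w') = h w \<oplus>\<^bsub>mat2_alg ?K\<^esub> h w'"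
      using w by (elim E) (simp add: S, intro conjI padic_class_cong; simp add: algebra_simps power2_eq_square)
    show "h (w \<otimes>\<^bsub>?H\<^esub> w') = h w \<otimes>\<^bsub>mat2_alg ?K\<^esub> h w'"
      using w by (elim E) (simp add: S, unfold \<beta>_def, intro conjI padic_class_cong; simp add: algebra_simps
        power2_eq_square)
  qed
  moreover have "h (c \<odot>\<^bsub>?H\<^esub> w) = c \<odot>\<^bsub>mat2_alg ?K\<^esub> h w" if c: "c \<in> carrier ?K" and w: "w \<in> carrier ?H" for c w
  proof -
    obtain r where "r \<in> padic_cauchy p" "c = ?c r" using c by (auto simp: carrier_Qp)
    then show ?thesis
      using w by (elim E) (simp add: S, intro conjI padic_class_cong; simp add: algebra_simps power2_eq_square)
  qed
  ultimately show ?thesis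
    unfolding alg_isomorphic_def bb unfolding Qp_of_rat_eq by blast
qed

text \<open>The preimage of the matrix unit with entry 1 at the top left is nonzero but not
  invertible: its product with any matrix has bottom row zero.\<close>

lemma mat2_not_division_ring:
  assumes "alg_isomorphic (Qp p) H (mat2_alg (Qp p))"
  shows "\<not> division_ring H"
proof
  assume div: "division_ring H"
  let ?K = "Qp p" and ?c = "padic_class p"
  obtain h where h: "h \<in> ring_iso H (mat2_alg ?K)" using assms unfolding alg_isomorphic_def by blast
  have hom: "h \<in> ring_hom H (mat2_alg ?K)" using h by (simp add: ring_iso_def)
  let ?e = "(\<one>\<^bsub>?K\<^esub>, \<zero>\<^bsub>?K\<^esub>, \<zero>\<^bsub>?K\<^esub>, \<zero>\<^bsub>?K\<^esub>)"
  have "?e \<in> carrier (mat2_alg ?K)" by (simp add: mat2_alg_simps Qp_simps)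
  then obtain e where e: "e \<in> carrier H" "h e = ?e"
    using ring_iso_memE(5)[OF h] unfolding bij_betw_def by (metis imageE)
  interpret H: ring H using div by (simp add: division_ring_def)
  have "e \<noteq> \<zero>\<^bsub>H\<^esub>"
  proof
    assume "e = \<zero>\<^bsub>H\<^esub>"
    then have "h e \<oplus>\<^bsub>mat2_alg ?K\<^esub> h e = h e"
      using ring_hom_add[OF hom e(1) e(1)] by simp
    then have "?c (\<lambda>n. 1 + 1) = ?c (\<lambda>n. 1)" unfolding e(2) by (simp add: mat2_alg_simps Qp_simps)
    then show False by (simp add: padic_class_eq_iff[OF p] padic_cauchy_const padic_null_const_iff[OF p])
  qed
  then have "e \<in> Units H" using div e by (simp add: division_ring_def)
  then obtain f where f: "f \<in> carrier H" "e \<otimes>\<^bsub>H\<^esub> f = \<one>\<^bsub>H\<^esub>" by (auto simp: Units_def)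
  have "h f \<in> carrier ?K \<times> carrier ?K \<times> carrier ?K \<times> carrier ?K"
    using ring_hom_closed[OF hom f(1)] by (simp add: mat2_alg_simps)
  then obtain t x y z where hf: "t \<in> padic_cauchy p" "x \<in> padic_cauchy p" "y \<in> padic_cauchy p"
    "z \<in> padic_cauchy p"
    "h f = (?c t, ?c x, ?c y, ?c z)" by (rule Qp_tuple_cases)
  have "?e \<otimes>\<^bsub>mat2_alg ?K\<^esub> h f = \<one>\<^bsub>mat2_alg ?K\<^esub>"
    using ring_hom_mult[OF hom e(1) f(1)] ring_hom_one[OF hom] f(2) e(2) by simp
  then show False
    using hf padic_class_one_neq_zero by (simp add: mat2_alg_simps Qp_simps)
qed

text \<open>Not split, not isotropic, division algebra, not a matrix algebra, not split: each
  implies the next, so the cycle closes and the four notions coincide.\<close>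

lemma division_ring_iff_not_split:
  assumes "a \<noteq> 0" "b \<noteq> 0"
  shows "division_ring (quat_alg (Qp p) (Qp_of_rat p a) (Qp_of_rat p b)) \<longleftrightarrow> \<not> padic_split p a b"
  using assms quat_alg_Qp_division_ring isotropic_imp_split split_imp_mat2 mat2_not_division_ring by blast

lemma hilbert_symbol_iff_not_split:
  assumes "a \<noteq> 0" "b \<noteq> 0"
  shows "hilbert_symbol p a b = -1 \<longleftrightarrow> \<not> padic_split p a b"
proof -
  have "alg_isomorphic (Qp p) (quat_alg (Qp p) (Qp_of_rat p a) (Qp_of_rat p b)) (mat2_alg (Qp p))
      \<longleftrightarrow> padic_split p a b"
    using assms quat_alg_Qp_division_ring isotropic_imp_split split_imp_mat2 mat2_not_division_ring by blast
  then show ?thesis by (simp add: hilbert_symbol_def)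
qed

end

section \<open>Rational quaternion algebras\<close>

lemma RatF_simps:
  "carrier RatF = UNIV" "\<one>\<^bsub>RatF\<^esub> = 1" "\<zero>\<^bsub>RatF\<^esub> = 0" "x \<otimes>\<^bsub>RatF\<^esub> y = x * y" "x \<oplus>\<^bsub>RatF\<^esub> y = x + y"
  by (simp_all add: ring_of_type_algebra_def)

lemma RatF_field: "field RatF"
  by (rule field_from_type_algebra)

lemma RatF_minus: "x \<ominus>\<^bsub>RatF\<^esub> y = x - y"
proof -
  interpret field RatF by (rule RatF_field)
  have "\<ominus>\<^bsub>RatF\<^esub> y = - y" by (rule minus_equality) (simp_all add: RatF_simps)
  then show ?thesis by (simp add: a_minus_def RatF_simps)
qed

lemmas quat_rat_simps = quat_alg_simps RatF_simps RatF_minus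

lemma quat_alg_rat_ring: "ring (quat_alg RatF a b)"
proof -
  have add_inv: "\<exists>y. x + y = 0" for x :: rat
    by (rule exI[of _ "- x"]) simp
  show ?thesis
    by (intro ringI abelian_groupI monoidI)
      (auto simp: quat_rat_simps add_inv algebra_simps)
qed

lemma quat_alg_rat_uminus: "\<ominus>\<^bsub>quat_alg RatF a b\<^esub> (t, x, y, z) = (- t, - x, - y, - z)"
proof -
  interpret ring "quat_alg RatF a b" by (rule quat_alg_rat_ring)
  show ?thesis by (rule minus_equality) (simp_all add: quat_rat_simps)
qed

lemma quat_alg_rat_assoc_algebra: "assoc_algebra RatF (quat_alg RatF a b)"
proof -
  interpret field RatF by (rule RatF_field)
  interpret H: ring "quat_alg RatF a b" by (rule quat_alg_rat_ring)
  have "Module.module RatF (quat_alg RatF a b)"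
    by (intro moduleI is_cring H.abelian_group_axioms) (auto simp: quat_rat_simps algebra_simps)
  then show ?thesis
    unfolding assoc_algebra_def using quat_alg_rat_ring by (auto simp: quat_rat_simps algebra_simps)
qed

lemma quat_comb_quat_alg_rat:
  "quat_comb (quat_alg RatF a b) (0, i1, i2, i3) (0, j1, j2, j3) (t, x, y, z) =
    (t + z * (a * i1 * j1 + b * i2 * j2 - a * b * i3 * j3),
     x * i1 + y * j1 + z * (b * i3 * j2 - b * i2 * j3),
     x * i2 + y * j2 + z * (a * i1 * j3 - a * i3 * j1),
     x * i3 + y * j3 + z * (i1 * j2 - i2 * j1))"
  by (simp add: quat_comb_def quat_rat_simps)

lemma quat_comb_standard:
  "quat_comb (quat_alg RatF a b) (0, 1, 0, 0) (0, 0, 1, 0) w = w"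
  by (cases w) (simp add: quat_comb_quat_alg_rat)

lemma quat_alg_rat_standard_basis:
  assumes "a \<noteq> 0" "b \<noteq> 0"
  shows "quaternion_basis RatF (quat_alg RatF a b) a b (0, 1, 0, 0) (0, 0, 1, 0)"
  using assms unfolding quaternion_basis_def quat_comb_standard[abs_def]
  by (auto simp: quat_rat_simps quat_alg_rat_uminus bij_betw_def)

lemma quat_alg_rat_quaternion_algebra:
  "a \<noteq> 0 \<Longrightarrow> b \<noteq> 0 \<Longrightarrow> quaternion_algebra RatF (quat_alg RatF a b)"
  unfolding quaternion_algebra_def using quat_alg_rat_assoc_algebra quat_alg_rat_standard_basis by blast

context
  fixes A :: "(rat, 'b) module" and a b :: rat and i j :: 'b
  assumes alg: "assoc_algebra RatF A" and basis: "quaternion_basis RatF A a b i j"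
begin

text \<open>The relations of a quaternion basis determine all products of 1, i, j, ij by
  associativity. Computations in an abstract A can therefore be done on coordinate tuples.\<close>

lemma quat_comb_hom:
  shows "quat_comb A i j (w \<oplus>\<^bsub>quat_alg RatF a b\<^esub> w') = quat_comb A i j w \<oplus>\<^bsub>A\<^esub> quat_comb A i j w'"
    and "quat_comb A i j (c \<odot>\<^bsub>quat_alg RatF a b\<^esub> w) = c \<odot>\<^bsub>A\<^esub> quat_comb A i j w"
    and "quat_comb A i j (w \<otimes>\<^bsub>quat_alg RatF a b\<^esub> w') = quat_comb A i j w \<otimes>\<^bsub>A\<^esub> quat_comb A i j w'"
    and "quat_comb A i j (t, 0, 0, 0) = t \<odot>\<^bsub>A\<^esub> \<one>\<^bsub>A\<^esub>"
    and "quat_comb A i j w \<in> carrier A"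
proof -
  interpret R: ring A using alg by (simp add: assoc_algebra_def)
  interpret M: Module.module RatF A using alg by (simp add: assoc_algebra_def)
  have [simp]: "i \<in> carrier A" "j \<in> carrier A" using basis by (auto simp: quaternion_basis_def)
  have ii: "i \<otimes>\<^bsub>A\<^esub> i = a \<odot>\<^bsub>A\<^esub> \<one>\<^bsub>A\<^esub>" and jj: "j \<otimes>\<^bsub>A\<^esub> j = b \<odot>\<^bsub>A\<^esub> \<one>\<^bsub>A\<^esub>"
    and ji: "j \<otimes>\<^bsub>A\<^esub> i = \<ominus>\<^bsub>A\<^esub> (i \<otimes>\<^bsub>A\<^esub> j)"
    using basis by (auto simp: quaternion_basis_def)
  have cl [simp]: "c \<odot>\<^bsub>A\<^esub> u \<in> carrier A" if "u \<in> carrier A" for c u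
    using that by (simp add: RatF_simps)
  have ld: "(c + d) \<odot>\<^bsub>A\<^esub> u = c \<odot>\<^bsub>A\<^esub> u \<oplus>\<^bsub>A\<^esub> d \<odot>\<^bsub>A\<^esub> u" if "u \<in> carrier A" for c d u
    using M.smult_l_distr[of c d u] that by (simp add: RatF_simps)
  have rd: "c \<odot>\<^bsub>A\<^esub> (u \<oplus>\<^bsub>A\<^esub> v) = c \<odot>\<^bsub>A\<^esub> u \<oplus>\<^bsub>A\<^esub> c \<odot>\<^bsub>A\<^esub> v" if "u \<in> carrier A" "v \<in> carrier A" for c u v
    using M.smult_r_distr[of c u v] that by (simp add: RatF_simps)
  have as: "c \<odot>\<^bsub>A\<^esub> (d \<odot>\<^bsub>A\<^esub> u) = (c * d) \<odot>\<^bsub>A\<^esub> u" if "u \<in> carrier A" for c d u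
    using M.smult_assoc1[of c d u] that by (simp add: RatF_simps)
  have one: "1 \<odot>\<^bsub>A\<^esub> u = u" if "u \<in> carrier A" for u
    using M.smult_one[of u] that by (simp add: RatF_simps)
  have zero: "0 \<odot>\<^bsub>A\<^esub> u = \<zero>\<^bsub>A\<^esub>" if "u \<in> carrier A" for u
    using M.smult_l_null[of u] that by (simp add: RatF_simps)
  have neg: "\<ominus>\<^bsub>A\<^esub> u = (- 1) \<odot>\<^bsub>A\<^esub> u" if "u \<in> carrier A" for u
  proof (rule R.minus_equality)
    have "(- 1) \<odot>\<^bsub>A\<^esub> u \<oplus>\<^bsub>A\<^esub> u = (- 1 + 1) \<odot>\<^bsub>A\<^esub> u" using that one ld by metis
    then show "(- 1) \<odot>\<^bsub>A\<^esub> u \<oplus>\<^bsub>A\<^esub> u = \<zero>\<^bsub>A\<^esub>" using that zero by simp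
  qed (use that in auto)
  have ml: "(c \<odot>\<^bsub>A\<^esub> u) \<otimes>\<^bsub>A\<^esub> v = c \<odot>\<^bsub>A\<^esub> (u \<otimes>\<^bsub>A\<^esub> v)" "u \<otimes>\<^bsub>A\<^esub> (c \<odot>\<^bsub>A\<^esub> v) = c \<odot>\<^bsub>A\<^esub> (u \<otimes>\<^bsub>A\<^esub> v)"
    if "u \<in> carrier A" "v \<in> carrier A" for c u v
    using alg that by (auto simp: assoc_algebra_def RatF_simps)
  define k where "k = i \<otimes>\<^bsub>A\<^esub> j"
  have k [simp]: "k \<in> carrier A" by (simp add: k_def)
  have ji': "j \<otimes>\<^bsub>A\<^esub> i = (- 1) \<odot>\<^bsub>A\<^esub> k" using ji neg[of k] by (simp add: k_def)
  have ik: "i \<otimes>\<^bsub>A\<^esub> k = a \<odot>\<^bsub>A\<^esub> j"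
    unfolding k_def by (simp add: R.m_assoc[symmetric] ii ml)
  have kj: "k \<otimes>\<^bsub>A\<^esub> j = b \<odot>\<^bsub>A\<^esub> i"
    unfolding k_def by (simp add: R.m_assoc jj ml)
  have ki: "k \<otimes>\<^bsub>A\<^esub> i = (- a) \<odot>\<^bsub>A\<^esub> j"
  proof -
    have "k \<otimes>\<^bsub>A\<^esub> i = i \<otimes>\<^bsub>A\<^esub> (j \<otimes>\<^bsub>A\<^esub> i)" by (simp add: k_def R.m_assoc)
    then show ?thesis by (simp add: ji' ml ik as)
  qed
  have jk: "j \<otimes>\<^bsub>A\<^esub> k = (- b) \<odot>\<^bsub>A\<^esub> i"
  proof -
    have "j \<otimes>\<^bsub>A\<^esub> k = (j \<otimes>\<^bsub>A\<^esub> i) \<otimes>\<^bsub>A\<^esub> j" by (simp add: k_def R.m_assoc)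
    then show ?thesis by (simp add: ji' ml kj as)
  qed
  have kk: "k \<otimes>\<^bsub>A\<^esub> k = (- (a * b)) \<odot>\<^bsub>A\<^esub> \<one>\<^bsub>A\<^esub>"
  proof -
    have "k \<otimes>\<^bsub>A\<^esub> k = i \<otimes>\<^bsub>A\<^esub> (j \<otimes>\<^bsub>A\<^esub> k)" by (simp add: k_def R.m_assoc)
    then show ?thesis by (simp add: jk ml ii as mult.commute)
  qed
  have comb: "quat_comb A i j (t, x, y, z) =
      t \<odot>\<^bsub>A\<^esub> \<one>\<^bsub>A\<^esub> \<oplus>\<^bsub>A\<^esub> x \<odot>\<^bsub>A\<^esub> i \<oplus>\<^bsub>A\<^esub> y \<odot>\<^bsub>A\<^esub> j \<oplus>\<^bsub>A\<^esub> z \<odot>\<^bsub>A\<^esub> k" for t x y z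
    by (simp add: quat_comb_def k_def)
  show "quat_comb A i j w \<in> carrier A" by (cases w) (simp add: comb)
  show "quat_comb A i j (t, 0, 0, 0) = t \<odot>\<^bsub>A\<^esub> \<one>\<^bsub>A\<^esub>" by (simp add: comb zero)
  show "quat_comb A i j (w \<oplus>\<^bsub>quat_alg RatF a b\<^esub> w') = quat_comb A i j w \<oplus>\<^bsub>A\<^esub> quat_comb A i j w'"
    by (cases w; cases w') (simp add: quat_rat_simps comb ld R.a_ac)
  show "quat_comb A i j (c \<odot>\<^bsub>quat_alg RatF a b\<^esub> w) = c \<odot>\<^bsub>A\<^esub> quat_comb A i j w"
    by (cases w) (simp add: quat_rat_simps comb rd as)
  show "quat_comb A i j (w \<otimes>\<^bsub>quat_alg RatF a b\<^esub> w') = quat_comb A i j w \<otimes>\<^bsub>A\<^esub> quat_comb A i j w'"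
  proof (cases w; cases w')
    fix t x y z t' x' y' z' assume w: "w = (t, x, y, z)" "w' = (t', x', y', z')"
    show ?thesis
      unfolding w comb quat_rat_simps
      by (simp add: R.l_distr R.r_distr ml as ii jj ji' ik kj ki jk kk k_def[symmetric] ld rd
          diff_conv_add_uminus R.a_ac mult_ac del: add_uminus_conv_diff)
  qed
qed

lemma quat_comb_inj: "quat_comb A i j w = quat_comb A i j w' \<Longrightarrow> w = w'"
  using basis unfolding quaternion_basis_def bij_betw_def inj_on_def
  by (cases w; cases w') (auto simp: RatF_simps)

lemma quat_comb_surj: "u \<in> carrier A \<Longrightarrow> \<exists>w. u = quat_comb A i j w"
  using basis unfolding quaternion_basis_def bij_betw_def by (metis (no_types) imageE)

lemma quat_comb_iso: "quat_comb A i j \<in> ring_iso (quat_alg RatF a b) A"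
proof (rule ring_iso_memI)
  interpret R: ring A using alg by (simp add: assoc_algebra_def)
  interpret M: Module.module RatF A using alg by (simp add: assoc_algebra_def)
  show "quat_comb A i j \<one>\<^bsub>quat_alg RatF a b\<^esub> = \<one>\<^bsub>A\<^esub>"
    using M.smult_one[of "\<one>\<^bsub>A\<^esub>"] by (simp add: quat_rat_simps quat_comb_hom)
  show "bij_betw (quat_comb A i j) (carrier (quat_alg RatF a b)) (carrier A)"
    using basis by (simp add: quaternion_basis_def quat_alg_simps)
qed (auto simp: quat_comb_hom)

end

lemma quat_comb_fst_eq:
  assumes alg: "assoc_algebra RatF A"
    and basis: "quaternion_basis RatF A a b i j" and basis': "quaternion_basis RatF A a' b' i' j'"
    and eq: "quat_comb A i j (t, x, y, z) = quat_comb A i' j' (t', x', y', z')"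
  shows "t = t'"
proof -
  let ?h = "quat_comb A i j" and ?h' = "quat_comb A i' j'"
  interpret R: ring A using alg by (simp add: assoc_algebra_def)
  note h = quat_comb_hom[OF alg basis] and h' = quat_comb_hom[OF alg basis']
  \<comment> \<open>Subtracting \<open>t'\<close> from the element leaves a pure quaternion of the second basis, whose square is
    a scalar; in the first basis this forces \<open>t = t'\<close> unless the element itself is a scalar.\<close>
  have "?h (t - t', x, y, z) = ?h (t, x, y, z) \<oplus>\<^bsub>A\<^esub> ?h (- t', 0, 0, 0)"
    unfolding h(1)[symmetric] by (simp add: quat_rat_simps)
  also have "\<dots> = ?h' (t', x', y', z') \<oplus>\<^bsub>A\<^esub> ?h' (- t', 0, 0, 0)"
    by (simp add: eq h(4) h'(4))
  also have "\<dots> = ?h' (0, x', y', z')"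
    unfolding h'(1)[symmetric] by (simp add: quat_rat_simps)
  finally have "?h ((t - t', x, y, z) \<otimes>\<^bsub>quat_alg RatF a b\<^esub> (t - t', x, y, z)) =
      ?h' ((0, x', y', z') \<otimes>\<^bsub>quat_alg RatF a' b'\<^esub> (0, x', y', z'))"
    by (simp only: h(3) h'(3))
  also have "\<dots> = ?h' (a' * x' * x' + b' * y' * y' - a' * b' * z' * z', 0, 0, 0)"
    by (simp add: quat_rat_simps)
  also have "\<dots> = ?h (a' * x' * x' + b' * y' * y' - a' * b' * z' * z', 0, 0, 0)"
    by (simp only: h(4) h'(4))
  finally have "(t - t', x, y, z) \<otimes>\<^bsub>quat_alg RatF a b\<^esub> (t - t', x, y, z) =
      (a' * x' * x' + b' * y' * y' - a' * b' * z' * z', 0, 0, 0)"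
    by (rule quat_comb_inj[OF alg basis])
  then have *: "(t - t') * x = 0" "(t - t') * y = 0" "(t - t') * z = 0"
    by (simp_all add: quat_rat_simps algebra_simps)
  show ?thesis
  proof (rule ccontr)
    assume "t \<noteq> t'"
    then have "x = 0" "y = 0" "z = 0" using * by auto
    then have "?h' (t, 0, 0, 0) = ?h' (t', x', y', z')" using eq by (simp add: h(4) h'(4))
    then show False using quat_comb_inj[OF alg basis'] \<open>t \<noteq> t'\<close> by blast
  qed
qed

text \<open>The definite description in \<open>trd\<close> ranges over all quaternion bases; it is
  well defined because the scalar coordinate does not depend on the basis.\<close>

lemma trd_quat_comb:
  assumes alg: "assoc_algebra RatF A" and basis: "quaternion_basis RatF A a b i j"
  shows "trd RatF A (quat_comb A i j (t, x, y, z)) = 2 * t"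
  unfolding trd_def
proof (rule the_equality)
  show "\<exists>a b i' j' t' x' y' z'. quaternion_basis RatF A a b i' j' \<and>
     t' \<in> carrier RatF \<and> x' \<in> carrier RatF \<and> y' \<in> carrier RatF \<and> z' \<in> carrier RatF \<and>
     quat_comb A i j (t, x, y, z) = quat_comb A i' j' (t', x', y', z') \<and> 2 * t = t' \<oplus>\<^bsub>RatF\<^esub> t'"
    using basis by (intro exI[of _ a] exI[of _ b] exI[of _ i] exI[of _ j] exI[of _ t] exI[of _ x] exI[of _ y]
      exI[of _ z])
      (simp add: RatF_simps)
qed (auto simp: RatF_simps dest: quat_comb_fst_eq[OF alg basis])

section \<open>The reduced norm and change of quaternion basis\<close>

definition quat_norm :: "rat \<Rightarrow> rat \<Rightarrow> rat \<times> rat \<times> rat \<times> rat \<Rightarrow> rat" where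
  "quat_norm a b = (\<lambda>(t, x, y, z). t ^ 2 - a * x ^ 2 - b * y ^ 2 + a * b * z ^ 2)"

lemma quat_mult_conj:
  "(t, x, y, z) \<otimes>\<^bsub>quat_alg RatF a b\<^esub> (t, - x, - y, - z) = (quat_norm a b (t, x, y, z), 0, 0, 0)"
  by (simp add: quat_rat_simps quat_norm_def power2_eq_square)

text \<open>Conjugation is w -> trd(w) - w and thus intrinsic, since the scalar part is independent
  of the basis; so is the norm, the product of w with its conjugate.\<close>

lemma quat_norm_quat_comb:
  assumes ab: "a \<noteq> 0" "b \<noteq> 0" and basis: "quaternion_basis RatF (quat_alg RatF a b) a' b' i j"
  shows "quat_norm a b (quat_comb (quat_alg RatF a b) i j w) = quat_norm a' b' w"
proof -
  let ?H = "quat_alg RatF a b"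
  note alg = quat_alg_rat_assoc_algebra[of a b]
  let ?h = "quat_comb ?H i j"
  note h = quat_comb_hom[OF alg basis]
  obtain t x y z where w: "w = (t, x, y, z)" by (cases w)
  obtain t' x' y' z' where w': "?h w = (t', x', y', z')" by (cases "?h w")
  have "quat_comb ?H (0, 1, 0, 0) (0, 0, 1, 0) (t', x', y', z') = ?h (t, x, y, z)"
    using w' w by (simp add: quat_comb_standard)
  from quat_comb_fst_eq[OF alg quat_alg_rat_standard_basis[OF ab] basis this] have t: "t' = t" .
  have one: "\<one>\<^bsub>?H\<^esub> = (1, 0, 0, 0)" by (simp add: quat_rat_simps)
  \<comment> \<open>The conjugate is written as 2 t - w, using only operations that
    \<open>?h\<close> is known to preserve.\<close>
  have "?h (t, - x, - y, - z) = ?h ((2 * t, 0, 0, 0) \<oplus>\<^bsub>quat_alg RatF a' b'\<^esub> ((- 1) \<odot>\<^bsub>quat_alg RatF a' b'\<^esub> w))"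
    by (simp add: quat_rat_simps w)
  also have "\<dots> = (t', - x', - y', - z')"
    unfolding h(1,2,4) w' one by (simp add: quat_rat_simps t)
  finally have conj: "?h (t, - x, - y, - z) = (t', - x', - y', - z')" .
  have "?h (quat_norm a' b' w, 0, 0, 0) = ?h w \<otimes>\<^bsub>?H\<^esub> ?h (t, - x, - y, - z)"
    unfolding h(3)[symmetric] w quat_mult_conj ..
  also have "\<dots> = (quat_norm a b (?h w), 0, 0, 0)"
    unfolding conj w' quat_mult_conj ..
  finally show ?thesis unfolding h(4) one by (simp add: quat_rat_simps)
qed

lemma linear_functional_tuple:
  fixes L :: "rat \<times> rat \<times> rat \<times> rat \<Rightarrow> rat"
  assumes add: "\<And>u v. L (u + v) = L u + L v"
    and scale: "\<And>c t x y z. L (c * t, c * x, c * y, c * z) = c * L (t, x, y, z)"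
  shows "L (t, x, y, z) = t * L (1, 0, 0, 0) + x * L (0, 1, 0, 0) + y * L (0, 0, 1, 0) + z * L (0, 0, 0, 1)"
proof -
  have "(t, x, y, z) = (t * 1, t * 0, t * 0, t * 0) + (x * 0, x * 1, x * 0, x * 0) +
      (y * 0, y * 0, y * 1, y * 0) + (z * 0, z * 0, z * 0, z * 1)" by simp
  then show ?thesis by (simp only: add scale)
qed

text \<open>A rational linear functional is a fixed rational combination of the coordinates, so
  applying it termwise is continuous.\<close>

lemma linear_functional_padic:
  fixes L :: "rat \<times> rat \<times> rat \<times> rat \<Rightarrow> rat"
  assumes add: "\<And>u v. L (u + v) = L u + L v"
    and scale: "\<And>c t x y z. L (c * t, c * x, c * y, c * z) = c * L (t, x, y, z)"
    and p: "prime p"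
  shows "t \<in> padic_cauchy p \<Longrightarrow> x \<in> padic_cauchy p \<Longrightarrow> y \<in> padic_cauchy p \<Longrightarrow> z \<in> padic_cauchy p \<Longrightarrow>
      (\<lambda>n. L (t n, x n, y n, z n)) \<in> padic_cauchy p"
    and "t \<in> padic_null p \<Longrightarrow> x \<in> padic_null p \<Longrightarrow> y \<in> padic_null p \<Longrightarrow> z \<in> padic_null p \<Longrightarrow>
      (\<lambda>n. L (t n, x n, y n, z n)) \<in> padic_null p"
proof -
  have eq: "L (t n, x n, y n, z n) = L (1, 0, 0, 0) * t n + L (0, 1, 0, 0) * x n + L (0, 0, 1, 0) * y n + L (0,
    0, 0, 1) * z n" for n
    by (subst linear_functional_tuple[of L, OF add scale]) (simp only: mult.commute)
  show "t \<in> padic_cauchy p \<Longrightarrow> x \<in> padic_cauchy p \<Longrightarrow> y \<in> padic_cauchy p \<Longrightarrow> z \<in> padic_cauchy p \<Longrightarrow>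
      (\<lambda>n. L (t n, x n, y n, z n)) \<in> padic_cauchy p"
    unfolding eq by (intro padic_cauchy_intros p)
  show "t \<in> padic_null p \<Longrightarrow> x \<in> padic_null p \<Longrightarrow> y \<in> padic_null p \<Longrightarrow> z \<in> padic_null p \<Longrightarrow>
      (\<lambda>n. L (t n, x n, y n, z n)) \<in> padic_null p"
    unfolding eq by (intro padic_null_add padic_null_mult padic_cauchy_const p)
qed

lemma quat_alg_rat_add: "u \<oplus>\<^bsub>quat_alg RatF a b\<^esub> v = u + v"
  by (cases u; cases v) (simp add: quat_rat_simps)

text \<open>The change of coordinates is rational, so it acts termwise on a p-adic isotropic vector
  and preserves the norm at every index. The new vector cannot be null, for mapping it back would
  make the old one null.\<close>

lemma isotropic_basis_change:
  assumes p: "prime p" and ab: "a \<noteq> 0" "b \<noteq> 0"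
    and basis: "quaternion_basis RatF (quat_alg RatF a b) a' b' i j"
    and iso: "padic_isotropic p a b"
  shows "padic_isotropic p a' b'"
proof -
  let ?H = "quat_alg RatF a b" and ?H' = "quat_alg RatF a' b'"
  note alg = quat_alg_rat_assoc_algebra[of a b]
  define h where "h = quat_comb ?H i j"
  note h = quat_comb_hom(1,2)[OF alg basis, folded h_def, unfolded quat_alg_rat_add]
  have surj: "\<exists>w. u = h w" for u
    using quat_comb_surj[OF alg basis, folded h_def, of u] by (cases u) (simp add: quat_rat_simps)
  have inj: "h w = h w' \<Longrightarrow> w = w'" for w w'
    using quat_comb_inj[OF alg basis] by (simp add: h_def)
  \<comment> \<open>The inverse of \<open>h\<close>, obtained by choice; its linearity follows from
    that of \<open>h\<close> by injectivity.\<close>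
  define T where "T u = (SOME w. u = h w)" for u
  have hT: "h (T u) = u" for u using someI_ex[OF surj[of u]] by (simp add: T_def)
  have T_add: "T (u + v) = T u + T v" for u v by (rule inj) (simp add: h hT)
  have T_scale: "T (c * t, c * x, c * y, c * z) = c \<odot>\<^bsub>?H'\<^esub> T (t, x, y, z)" for c t x y z
    by (rule inj) (simp add: h hT quat_rat_simps)
  have h_scale: "h (c * t, c * x, c * y, c * z) = c \<odot>\<^bsub>?H\<^esub> h (t, x, y, z)" for c t x y z
    using h(2)[of c "(t, x, y, z)"] by (simp add: quat_rat_simps)
  have coord: "fst (c \<odot>\<^bsub>quat_alg RatF k l\<^esub> w) = c * fst w"
    "fst (snd (c \<odot>\<^bsub>quat_alg RatF k l\<^esub> w)) = c * fst (snd w)"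
    "fst (snd (snd (c \<odot>\<^bsub>quat_alg RatF k l\<^esub> w))) = c * fst (snd (snd w))"
    "snd (snd (snd (c \<odot>\<^bsub>quat_alg RatF k l\<^esub> w))) = c * snd (snd (snd w))" for c k l w
    by (cases w; simp add: quat_rat_simps)+
  obtain t x y z where C: "t \<in> padic_cauchy p" "x \<in> padic_cauchy p" "y \<in> padic_cauchy p" "z \<in> padic_cauchy p"
    and nn: "\<not> (t \<in> padic_null p \<and> x \<in> padic_null p \<and> y \<in> padic_null p \<and> z \<in> padic_null p)"
    and e: "(\<lambda>n. t n ^ 2 - a * x n ^ 2 - b * y n ^ 2 + a * b * z n ^ 2) \<in> padic_null p"
    using iso unfolding padic_isotropic_def by blast
  define w where "w n = T (t n, x n, y n, z n)" for n
  define t' x' y' z' where d: "t' n = fst (w n)" "x' n = fst (snd (w n))" "y' n = fst (snd (snd (w n)))"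
    "z' n = snd (snd (snd (w n)))" for n
  have w: "w n = (t' n, x' n, y' n, z' n)" for n by (simp add: d)
  have C': "t' \<in> padic_cauchy p" "x' \<in> padic_cauchy p" "y' \<in> padic_cauchy p" "z' \<in> padic_cauchy p"
  proof -
    have "(\<lambda>n. fst (T (t n, x n, y n, z n))) \<in> padic_cauchy p"
      by (rule linear_functional_padic(1)[of "\<lambda>u. fst (T u)"]) (simp_all add: T_add T_scale coord p C)
    moreover have "(\<lambda>n. fst (snd (T (t n, x n, y n, z n)))) \<in> padic_cauchy p"
      by (rule linear_functional_padic(1)[of "\<lambda>u. fst (snd (T u))"]) (simp_all add: T_add T_scale coord p C)
    moreover have "(\<lambda>n. fst (snd (snd (T (t n, x n, y n, z n))))) \<in> padic_cauchy p"
      by (rule linear_functional_padic(1)[of "\<lambda>u. fst (snd (snd (T u)))"]) (simp_all add: T_add T_scale coord p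
        C)
    moreover have "(\<lambda>n. snd (snd (snd (T (t n, x n, y n, z n))))) \<in> padic_cauchy p"
      by (rule linear_functional_padic(1)[of "\<lambda>u. snd (snd (snd (T u)))"]) (simp_all add: T_add T_scale coord p
        C)
    ultimately show "t' \<in> padic_cauchy p" "x' \<in> padic_cauchy p" "y' \<in> padic_cauchy p" "z' \<in> padic_cauchy p"
      unfolding d[abs_def] w_def by simp_all
  qed
  have hw: "h (t' n, x' n, y' n, z' n) = (t n, x n, y n, z n)" for n
    unfolding w[symmetric] by (simp add: w_def hT)
  have nn': "\<not> (t' \<in> padic_null p \<and> x' \<in> padic_null p \<and> y' \<in> padic_null p \<and> z' \<in> padic_null p)"
  proof
    assume N: "t' \<in> padic_null p \<and> x' \<in> padic_null p \<and> y' \<in> padic_null p \<and> z' \<in> padic_null p"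
    have "(\<lambda>n. fst (h (t' n, x' n, y' n, z' n))) \<in> padic_null p"
      by (rule linear_functional_padic(2)[of "\<lambda>u. fst (h u)"]) (use N in \<open>simp_all add: h(1) h_scale coord p\<close>)
    moreover have "(\<lambda>n. fst (snd (h (t' n, x' n, y' n, z' n)))) \<in> padic_null p"
      by (rule linear_functional_padic(2)[of "\<lambda>u. fst (snd (h u))"]) (use N in \<open>simp_all add: h(1) h_scale coord
        p\<close>)
    moreover have "(\<lambda>n. fst (snd (snd (h (t' n, x' n, y' n, z' n))))) \<in> padic_null p"
      by (rule linear_functional_padic(2)[of "\<lambda>u. fst (snd (snd (h u)))"]) (use N in \<open>simp_all add: h(1) h_scale
        coord p\<close>)
    moreover have "(\<lambda>n. snd (snd (snd (h (t' n, x' n, y' n, z' n))))) \<in> padic_null p"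
      by (rule linear_functional_padic(2)[of "\<lambda>u. snd (snd (snd (h u)))"]) (use N in \<open>simp_all add: h(1) h_scale
        coord p\<close>)
    ultimately show False using nn unfolding hw by simp
  qed
  have "quat_norm a b (t n, x n, y n, z n) = quat_norm a' b' (t' n, x' n, y' n, z' n)" for n
    using quat_norm_quat_comb[OF ab basis, of "w n", folded h_def] unfolding w hw .
  then have e': "(\<lambda>n. t' n ^ 2 - a' * x' n ^ 2 - b' * y' n ^ 2 + a' * b' * z' n ^ 2) \<in> padic_null p"
    using e unfolding quat_norm_def by simp
  show ?thesis unfolding padic_isotropic_def using C' nn' e' by blast
qed

text \<open>The witness in \<open>ramified_at\<close> may be any quaternion basis. If the standard
  constants split, the norm form is isotropic in every basis, so no choice yields a division
  algebra.\<close>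

lemma ramified_at_iff_not_split:
  assumes p: "prime p" and ab: "a \<noteq> 0" "b \<noteq> 0"
  shows "ramified_at (quat_alg RatF a b) p \<longleftrightarrow> \<not> padic_split p a b"
proof
  assume "\<not> padic_split p a b"
  then show "ramified_at (quat_alg RatF a b) p"
    unfolding ramified_at_def
    using quat_alg_rat_standard_basis[OF ab] division_ring_iff_not_split[OF p ab] by blast
next
  assume "ramified_at (quat_alg RatF a b) p"
  then obtain a' b' i j where basis: "quaternion_basis RatF (quat_alg RatF a b) a' b' i j"
    and div: "division_ring (quat_alg (Qp p) (Qp_of_rat p a') (Qp_of_rat p b'))"
    unfolding ramified_at_def by blast
  have ab': "a' \<noteq> 0" "b' \<noteq> 0" using basis by (auto simp: quaternion_basis_def RatF_simps)
  show "\<not> padic_split p a b"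
    using div division_ring_iff_not_split[OF p ab'] isotropic_imp_split[OF p _ ab'(1)]
      isotropic_basis_change[OF p ab basis] split_imp_isotropic[OF p] by blast
qed

section \<open>Linked embeddings\<close>

lemma of_int_eq_rat_square_imp:
  assumes "of_int D = (r :: rat)\<^sup>2"
  shows "\<exists>n. D = n\<^sup>2"
proof -
  obtain n d where r: "d > 0" "r = of_int n / of_int d"
    by (metis quotient_of_denom_pos quotient_of_div surj_pair)
  have "of_int (D * d\<^sup>2) = (of_int (n\<^sup>2) :: rat)"
    using assms r by (simp add: field_simps)
  then have eq: "D * d\<^sup>2 = n\<^sup>2" by linarith
  then have "d\<^sup>2 dvd n\<^sup>2" by (metis dvd_triv_right)
  then obtain k where "n = d * k" by (auto elim: dvdE)
  then have "D = k\<^sup>2" using eq r(1) by (simp add: power_mult_distrib mult.commute)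
  then show ?thesis ..
qed

lemma sqrtD_mult_self: "sqrtD D * sqrtD D = of_int D"
  using power2_csqrt[of "of_int D"] by (simp add: power2_eq_square)

lemma quad_irrational_unique:
  assumes D: "\<nexists>n. D = n\<^sup>2"
    and eq: "of_rat u + of_rat v * sqrtD D = of_rat u' + of_rat v' * sqrtD D"
  shows "u = u'" "v = v'"
proof -
  show v: "v = v'"
  proof (rule ccontr)
    assume "v \<noteq> v'"
    have "(of_rat (v - v') :: complex) * sqrtD D = of_rat (u' - u)"
      using eq by (simp add: of_rat_diff algebra_simps)
    then have "sqrtD D = of_rat ((u' - u) / (v - v'))"
      using \<open>v \<noteq> v'\<close> by (simp add: of_rat_divide of_rat_diff field_simps)
    then have "(of_rat (of_int D) :: complex) = of_rat (((u' - u) / (v - v'))\<^sup>2)"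
      using sqrtD_mult_self[of D] by (simp only: power2_eq_square of_rat_mult of_rat_of_int_eq)
    then have "of_int D = ((u' - u) / (v - v'))\<^sup>2" by (simp only: of_rat_eq_iff)
    then show False using of_int_eq_rat_square_imp D by blast
  qed
  show "u = u'" using eq unfolding v by simp
qed

text \<open>The map is transported to \<open>rat ^ 4\<close>, where injective linear endomorphisms
  are surjective by dimension.\<close>

lemma linear_inj_tuple_imp_surj:
  fixes f :: "rat \<times> rat \<times> rat \<times> rat \<Rightarrow> rat \<times> rat \<times> rat \<times> rat"
  assumes add: "\<And>u v. f (u + v) = f u + f v"
    and scale: "\<And>c w. f (c \<odot>\<^bsub>quat_alg RatF a b\<^esub> w) = c \<odot>\<^bsub>quat_alg RatF a b\<^esub> f w"
    and inj: "inj f"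
  shows "surj f"
proof -
  define vec :: "rat \<times> rat \<times> rat \<times> rat \<Rightarrow> rat ^ 4" where
    "vec = (\<lambda>(t, x, y, z). \<chi> k. if k = 1 then t else if k = 2 then x else if k = 3 then y else z)"
  define tup where "tup v = (v $ 1, v $ 2, v $ 3, v $ 4)" for v :: "rat ^ 4"
  have tv: "tup (vec w) = w" for w by (cases w) (simp add: tup_def vec_def)
  have vt: "vec (tup v) = v" for v
    unfolding vec_eq_iff tup_def vec_def by (simp add: forall_4)
  have vadd: "vec (u + v) = vec u + vec v" for u v
    by (cases u; cases v) (simp add: vec_def vec_eq_iff)
  have vscale: "vec (c \<odot>\<^bsub>quat_alg RatF a b\<^esub> w) = c *s vec w" for c w
    by (cases w) (simp add: vec_def vec_eq_iff quat_rat_simps)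
  have tadd: "tup (u + v) = tup u + tup v" for u v by (simp add: tup_def)
  have tscale: "tup (c *s v) = c \<odot>\<^bsub>quat_alg RatF a b\<^esub> tup v" for c v by (simp add: tup_def quat_rat_simps)
  have "Vector_Spaces.linear (*s) (*s) (\<lambda>v. vec (f (tup v)))"
    by (rule Vector_Spaces.linear.intro[OF vec.vector_space_axioms vec.vector_space_axioms], unfold_locales)
      (simp_all add: tadd tscale add scale vadd vscale)
  moreover have "inj (\<lambda>v. vec (f (tup v)))"
    using inj by (intro injI) (metis injD tv vt)
  ultimately have s: "surj (\<lambda>v. vec (f (tup v)))" by (rule vec.linear_inj_imp_surj)
  show ?thesis
    unfolding surj_def
  proof
    fix w
    obtain v where "vec w = vec (f (tup v))" using surjD[OF s, of "vec w"] by blast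
    then show "\<exists>u. w = f u" by (metis tv)
  qed
qed

text \<open>The pure part of the square is 2 t (x, y, z). If t were nonzero, the element would be
  the scalar t and D its square.\<close>

lemma quat_pure_of_square:
  assumes "(t, x, y, z) \<otimes>\<^bsub>quat_alg RatF a b\<^esub> (t, x, y, z) = (of_int D, 0, 0, 0)" and D: "\<nexists>n. D = n\<^sup>2"
  shows "t = 0" "a * x * x + b * y * y - a * b * z * z = of_int D"
proof -
  have e: "t * t + a * x * x + b * y * y - a * b * z * z = of_int D" "t * x = 0" "t * y = 0" "t * z = 0"
    using assms(1) by (auto simp: quat_rat_simps algebra_simps)
  show "t = 0"
  proof (rule ccontr)
    assume "t \<noteq> 0"
    then have "of_int D = t\<^sup>2" using e by (simp add: power2_eq_square)
    then show False using of_int_eq_rat_square_imp D by blast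
  qed
  then show "a * x * x + b * y * y - a * b * z * z = of_int D" using e by simp
qed

lemma linked_quaternion_basis:
  assumes I: "I \<otimes>\<^bsub>quat_alg RatF a b\<^esub> I = (of_int D1, 0, 0, 0)" and D1: "\<nexists>n. D1 = n\<^sup>2"
    and J: "J \<otimes>\<^bsub>quat_alg RatF a b\<^esub> J = (of_int D2, 0, 0, 0)" and D2: "\<nexists>n. D2 = n\<^sup>2"
    and x: "fst (I \<otimes>\<^bsub>quat_alg RatF a b\<^esub> J) = of_int x" and c: "x\<^sup>2 \<noteq> D1 * D2"
  shows "\<exists>K. quaternion_basis RatF (quat_alg RatF a b) (of_int D1) (of_int (x\<^sup>2 - D1 * D2)) I K"
proof -
  let ?H = "quat_alg RatF a b"
  obtain i0 i1 i2 i3 j0 j1 j2 j3 where IJ: "I = (i0, i1, i2, i3)" "J = (j0, j1, j2, j3)"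
    by (cases I; cases J)
  have i: "i0 = 0" "a * i1 * i1 + b * i2 * i2 - a * b * i3 * i3 = of_int D1"
    using quat_pure_of_square[OF I[unfolded IJ] D1] by auto
  have j: "j0 = 0" "a * j1 * j1 + b * j2 * j2 - a * b * j3 * j3 = of_int D2"
    using quat_pure_of_square[OF J[unfolded IJ] D2] by auto
  have x': "a * i1 * j1 + b * i2 * j2 - a * b * i3 * j3 = of_int x"
    using x by (simp add: IJ i j quat_rat_simps)
  \<comment> \<open>The vector k is the pure part of IJ, so K = IJ - x in coordinates, and m is the
    pure part of IK. The scalar part of IK vanishes by \<open>ik\<close>.\<close>
  define k1 k2 k3 where k: "k1 = b * (i3 * j2 - i2 * j3)" "k2 = a * (i1 * j3 - i3 * j1)"
    "k3 = i1 * j2 - i2 * j1"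
  define m1 m2 m3 where m: "m1 = b * i3 * k2 - b * i2 * k3" "m2 = a * i1 * k3 - a * i3 * k1"
    "m3 = i1 * k2 - i2 * k1"
  let ?K = "(0, k1, k2, k3)" and ?c = "of_int (x\<^sup>2 - D1 * D2) :: rat"
  have ik: "a * i1 * k1 + b * i2 * k2 - a * b * i3 * k3 = 0"
    unfolding k by (simp add: algebra_simps)
  have kk: "a * k1 * k1 + b * k2 * k2 - a * b * k3 * k3 = ?c"
    unfolding of_int_diff of_int_mult of_int_power i(2)[symmetric] j(2)[symmetric] x'[symmetric] k
    by (simp add: algebra_simps power2_eq_square)
  have im: "a * i1 * m1 + b * i2 * m2 - a * b * i3 * m3 = 0"
    and km: "a * k1 * m1 + b * k2 * m2 - a * b * k3 * m3 = 0"
    unfolding m by (simp_all add: algebra_simps)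
  \<comment> \<open>This is the square of IK, expected to be -I^2 K^2 because I and K anticommute;
    in coordinates it is a Lagrange identity for the form a X^2 + b Y^2 - a b Z^2.\<close>
  have mm: "a * m1 * m1 + b * m2 * m2 - a * b * m3 * m3 = - (of_int D1 * ?c)"
  proof -
    have "a * m1 * m1 + b * m2 * m2 - a * b * m3 * m3 =
      (a * i1 * k1 + b * i2 * k2 - a * b * i3 * k3)\<^sup>2 -
      (a * i1 * i1 + b * i2 * i2 - a * b * i3 * i3) * (a * k1 * k1 + b * k2 * k2 - a * b * k3 * k3)"
      unfolding m by (simp add: algebra_simps power2_eq_square)
    then show ?thesis unfolding ik kk i(2) by simp
  qed
  have c0: "?c \<noteq> 0" using c by (simp del: of_int_diff)
  have D0: "(of_int D1 :: rat) \<noteq> 0" using D1 by auto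
  have comb: "quat_comb ?H I ?K (t, x, y, z) =
      (t, x * i1 + y * k1 + z * m1, x * i2 + y * k2 + z * m2, x * i3 + y * k3 + z * m3)" for t x y z
    unfolding IJ i(1) quat_comb_quat_alg_rat ik m by simp
  have add: "quat_comb ?H I ?K (u + v) = quat_comb ?H I ?K u + quat_comb ?H I ?K v" for u v
    by (cases u; cases v) (simp add: comb algebra_simps)
  have scale: "quat_comb ?H I ?K (r \<odot>\<^bsub>?H\<^esub> w) = r \<odot>\<^bsub>?H\<^esub> quat_comb ?H I ?K w" for r w
    by (cases w) (simp add: quat_rat_simps comb algebra_simps)
  \<comment> \<open>\<open>1, I, K, IK\<close> are orthogonal for the trace form and none of them is isotropic.\<close>
  have ker: "w = 0" if "quat_comb ?H I ?K w = 0" for w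
  proof -
    obtain t x y z where w: "w = (t, x, y, z)" by (cases w)
    have z: "t = 0" "x * i1 + y * k1 + z * m1 = 0" "x * i2 + y * k2 + z * m2 = 0" "x * i3 + y * k3 + z * m3 = 0"
      using that unfolding w comb by (simp_all add: zero_prod_def)
    \<comment> \<open>A vanishing combination of I, K, IK is paired with an arbitrary pure vector l.
      Taking l to be each of the three in turn isolates one coefficient.\<close>
    have pair: "x * (a * i1 * l1 + b * i2 * l2 - a * b * i3 * l3) + y * (a * k1 * l1 + b * k2 * l2 - a * b * k3
      * l3)
        + z * (a * m1 * l1 + b * m2 * l2 - a * b * m3 * l3) = 0" for l1 l2 l3
    proof -
      have "x * (a * i1 * l1 + b * i2 * l2 - a * b * i3 * l3) + y * (a * k1 * l1 + b * k2 * l2 - a * b * k3 *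
        l3)
        + z * (a * m1 * l1 + b * m2 * l2 - a * b * m3 * l3)
        = a * l1 * (x * i1 + y * k1 + z * m1) + b * l2 * (x * i2 + y * k2 + z * m2) - a * b * l3 * (x * i3 + y *
          k3 + z * m3)"
        by (simp add: algebra_simps)
      then show ?thesis unfolding z by simp
    qed
    have "x * of_int D1 = 0"
      using pair[of i1 i2 i3] i(2) ik im by (simp add: mult_ac)
    moreover have "y * ?c = 0"
      using pair[of k1 k2 k3] kk ik km by (simp add: mult_ac)
    moreover have "z * (of_int D1 * ?c) = 0"
      using pair[of m1 m2 m3] mm im km by (simp add: mult_ac)
    ultimately show ?thesis using c0 D0 z(1) w by (simp add: zero_prod_def)
  qed
  have "inj (quat_comb ?H I ?K)"
  proof (rule injI)
    fix u v assume "quat_comb ?H I ?K u = quat_comb ?H I ?K v"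
    then have "quat_comb ?H I ?K (u - v) = 0"
      using add[of "u - v" v] by simp
    then show "u = v" using ker[of "u - v"] by simp
  qed
  then have bij: "bij (quat_comb ?H I ?K)"
    using linear_inj_tuple_imp_surj[of "quat_comb ?H I ?K", OF add scale] by (simp add: bij_def)
  have "quaternion_basis RatF ?H (of_int D1) ?c I ?K"
    unfolding quaternion_basis_def
  proof (intro conjI)
    show "I \<otimes>\<^bsub>?H\<^esub> I = of_int D1 \<odot>\<^bsub>?H\<^esub> \<one>\<^bsub>?H\<^esub>" using I by (simp add: quat_rat_simps)
    show "?K \<otimes>\<^bsub>?H\<^esub> ?K = ?c \<odot>\<^bsub>?H\<^esub> \<one>\<^bsub>?H\<^esub>" using kk by (simp add: quat_rat_simps)
    show "?K \<otimes>\<^bsub>?H\<^esub> I = \<ominus>\<^bsub>?H\<^esub> (I \<otimes>\<^bsub>?H\<^esub> ?K)"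
      using ik by (simp add: IJ i(1) quat_rat_simps quat_alg_rat_uminus algebra_simps)
    show "bij_betw (quat_comb ?H I ?K) (carrier RatF \<times> carrier RatF \<times> carrier RatF \<times> carrier RatF) (carrier ?H)"
      using bij by (simp add: quat_rat_simps)
  qed (use c0 D0 in \<open>auto simp: quat_rat_simps IJ simp del: of_int_diff\<close>)
  then show ?thesis ..
qed

lemma alg_isomorphic_sym:
  assumes B: "assoc_algebra K B" and iso: "alg_isomorphic K B A"
  shows "alg_isomorphic K A B"
proof -
  interpret M: Module.module K B using B by (simp add: assoc_algebra_def)
  obtain h where h: "h \<in> ring_iso B A" "\<And>c u. c \<in> carrier K \<Longrightarrow> u \<in> carrier B \<Longrightarrow> h (c \<odot>\<^bsub>B\<^esub> u) = c \<odot>\<^bsub>A\<^esub> h u"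
    using iso unfolding alg_isomorphic_def by blast
  have bij: "bij_betw h (carrier B) (carrier A)" using h(1) by (simp add: ring_iso_def)
  have "inv_into (carrier B) h \<in> ring_iso A B"
    using ring_iso_set_sym[OF _ h(1)] B by (simp add: assoc_algebra_def)
  moreover have "inv_into (carrier B) h (c \<odot>\<^bsub>A\<^esub> u) = c \<odot>\<^bsub>B\<^esub> inv_into (carrier B) h u"
    if c: "c \<in> carrier K" and u: "u \<in> carrier A" for c u
  proof -
    obtain v where v: "v \<in> carrier B" "u = h v" using bij u unfolding bij_betw_def by auto
    have "c \<odot>\<^bsub>A\<^esub> u = h (c \<odot>\<^bsub>B\<^esub> v)" using h(2)[OF c v(1)] v(2) by simp
    moreover have "c \<odot>\<^bsub>B\<^esub> v \<in> carrier B" using c v(1) by simp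
    ultimately show ?thesis using bij v by (simp add: bij_betw_inv_into_left)
  qed
  ultimately show ?thesis unfolding alg_isomorphic_def by blast
qed

lemma alg_isomorphic_trans:
  assumes "alg_isomorphic K A B" "alg_isomorphic K B C"
  shows "alg_isomorphic K A C"
proof -
  obtain h where h: "h \<in> ring_iso A B" "\<And>c u. c \<in> carrier K \<Longrightarrow> u \<in> carrier A \<Longrightarrow> h (c \<odot>\<^bsub>A\<^esub> u) = c \<odot>\<^bsub>B\<^esub> h u"
    using assms(1) unfolding alg_isomorphic_def by blast
  obtain g where g: "g \<in> ring_iso B C" "\<And>c u. c \<in> carrier K \<Longrightarrow> u \<in> carrier B \<Longrightarrow> g (c \<odot>\<^bsub>B\<^esub> u) = c \<odot>\<^bsub>C\<^esub> g u"
    using assms(2) unfolding alg_isomorphic_def by blast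
  show ?thesis
    unfolding alg_isomorphic_def
    using ring_iso_set_trans[OF h(1) g(1)] h(2) g(2) ring_iso_memE(1)[OF h(1)]
    by (intro bexI[of _ "g \<circ> h"]) auto
qed

lemma quat_alg_isomorphic_of_basis:
  assumes "assoc_algebra RatF A" "quaternion_basis RatF A a b i j"
  shows "alg_isomorphic RatF (quat_alg RatF a b) A"
  unfolding alg_isomorphic_def
  by (intro bexI[OF _ quat_comb_iso[OF assms]]) (auto simp: quat_comb_hom[OF assms])

section \<open>Quadratic orders and their embeddings\<close>

lemma complex_ring_simps:
  "\<one>\<^bsub>(ring_of_type_algebra :: complex ring)\<^esub> = 1" "\<zero>\<^bsub>(ring_of_type_algebra :: complex ring)\<^esub> = 0"
  "(x :: complex) \<otimes>\<^bsub>ring_of_type_algebra\<^esub> y = x * y" "(x :: complex) \<oplus>\<^bsub>ring_of_type_algebra\<^esub> y = x + y"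
  "carrier (ring_of_type_algebra :: complex ring) = UNIV"
  by (simp_all add: ring_of_type_algebra_def)

lemma complex_ring_uminus: "\<ominus>\<^bsub>ring_of_type_algebra\<^esub> (x :: complex) = - x"
proof -
  interpret ring "ring_of_type_algebra :: complex ring" by (rule ring_from_type_algebra)
  show ?thesis by (rule minus_equality) (simp_all add: complex_ring_simps)
qed

lemma quad_order_simps:
  "\<one>\<^bsub>quad_order D\<^esub> = 1" "\<zero>\<^bsub>quad_order D\<^esub> = 0" "x \<otimes>\<^bsub>quad_order D\<^esub> y = x * y" "x \<oplus>\<^bsub>quad_order D\<^esub> y = x + y"
  "carrier (quad_order D) = generate_ring ring_of_type_algebra {(of_int (D mod 2) + sqrtD D) / 2}"
  by (simp_all add: quad_order_def complex_ring_simps)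

lemma quad_order_ring: "ring (quad_order D)"
proof -
  interpret ring "ring_of_type_algebra :: complex ring" by (rule ring_from_type_algebra)
  show ?thesis unfolding quad_order_def
    by (rule generate_ring_is_ring) (simp add: complex_ring_simps)
qed

text \<open>Twice the generator minus the parity of D is the square root.\<close>

lemma sqrtD_in_quad_order: "sqrtD D \<in> carrier (quad_order D)"
proof -
  let ?w = "(of_int (D mod 2) + sqrtD D) / 2"
  let ?R = "ring_of_type_algebra :: complex ring"
  have w: "?w \<in> generate_ring ?R {?w}" by (rule generate_ring.incl) simp
  have s: "?w + ?w \<in> generate_ring ?R {?w}"
    using generate_ring.eng_add[OF w w] by (simp only: complex_ring_simps)
  have m1: "- 1 \<in> generate_ring ?R {?w}"
    using generate_ring.a_inv[OF generate_ring.one[of ?R "{?w}"]]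
      by (simp add: complex_ring_simps complex_ring_uminus)
  have s': "?w + ?w + - 1 \<in> generate_ring ?R {?w}"
    using generate_ring.eng_add[OF s m1] by (simp only: complex_ring_simps)
  have "D mod 2 = 0 \<or> D mod 2 = 1" by auto
  then show ?thesis
  proof
    assume "D mod 2 = 0"
    then have "?w + ?w = sqrtD D" by simp
    then show ?thesis using s by (simp add: quad_order_simps)
  next
    assume "D mod 2 = 1"
    then have "?w + ?w + - 1 = sqrtD D" by simp
    then show ?thesis using s' by (simp add: quad_order_simps)
  qed
qed

lemma quad_order_subset:
  "z \<in> carrier (quad_order D) \<Longrightarrow> \<exists>u v. z = of_rat u + of_rat v * sqrtD D"
  unfolding quad_order_simps
proof (induction rule: generate_ring.induct)
  case one
  show ?case by (rule exI[of _ 1], rule exI[of _ 0]) (simp add: complex_ring_simps)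
next
  case (incl h)
  have "h = of_rat (of_int (D mod 2) / 2) + of_rat (1 / 2) * sqrtD D"
    using incl by (simp add: of_rat_divide add_divide_distrib)
  then show ?case by blast
next
  case (a_inv h)
  then obtain u v where "h = of_rat u + of_rat v * sqrtD D" by blast
  then have "\<ominus>\<^bsub>ring_of_type_algebra\<^esub> h = of_rat (- u) + of_rat (- v) * sqrtD D"
    by (simp add: complex_ring_uminus of_rat_minus)
  then show ?case by blast
next
  case (eng_add h1 h2)
  then obtain u v u' v' where "h1 = of_rat u + of_rat v * sqrtD D" "h2 = of_rat u' + of_rat v' * sqrtD D"
    by blast
  then have "h1 \<oplus>\<^bsub>ring_of_type_algebra\<^esub> h2 = of_rat (u + u') + of_rat (v + v') * sqrtD D"
    by (simp add: complex_ring_simps of_rat_add algebra_simps)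
  then show ?case by blast
next
  case (eng_mult h1 h2)
  then obtain u v u' v' where "h1 = of_rat u + of_rat v * sqrtD D" "h2 = of_rat u' + of_rat v' * sqrtD D"
    by blast
  then have "h1 \<otimes>\<^bsub>ring_of_type_algebra\<^esub> h2 =
      of_rat u * of_rat u' + of_rat v * of_rat v' * (sqrtD D * sqrtD D) + (of_rat u * of_rat v' + of_rat v *
        of_rat u') * sqrtD D"
    by (simp add: complex_ring_simps algebra_simps)
  also have "\<dots> = of_rat (u * u' + v * v' * of_int D) + of_rat (u * v' + v * u') * sqrtD D"
    unfolding sqrtD_mult_self by (simp add: of_rat_add of_rat_mult)
  finally show ?case by blast
qed

lemma quad_order_hom_sqrtD_square:
  assumes alg: "assoc_algebra RatF A" and hom: "\<phi> \<in> ring_hom (quad_order D) A" and D: "D > 0"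
  shows "\<phi> (sqrtD D) \<otimes>\<^bsub>A\<^esub> \<phi> (sqrtD D) = of_int D \<odot>\<^bsub>A\<^esub> \<one>\<^bsub>A\<^esub>"
proof -
  interpret R: ring A using alg by (simp add: assoc_algebra_def)
  interpret M: Module.module RatF A using alg by (simp add: assoc_algebra_def)
  interpret O: ring "quad_order D" by (rule quad_order_ring)
  have nat_in: "of_nat n \<in> carrier (quad_order D)" for n
  proof (induction n)
    case (Suc n)
    then show ?case using O.add.m_closed[OF Suc O.one_closed] by (simp add: quad_order_simps(1,4) add.commute)
  qed (use O.zero_closed in \<open>simp add: quad_order_simps(2)\<close>)
  \<comment> \<open>A homomorphism out of the order is only additive and unital, so its agreement
    with rational scalars is derived by induction. Natural numbers suffice because D is
    positive.\<close>
  have nat: "\<phi> (of_nat n) = of_nat n \<odot>\<^bsub>A\<^esub> \<one>\<^bsub>A\<^esub>" for n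
  proof (induction n)
    case 0
    then show ?case
      using ring_hom_zero[OF hom O.ring_axioms R.ring_axioms] M.smult_l_null[of "\<one>\<^bsub>A\<^esub>"]
      by (simp add: quad_order_simps(2) RatF_simps)
  next
    case (Suc n)
    have "\<phi> (of_nat n \<oplus>\<^bsub>quad_order D\<^esub> \<one>\<^bsub>quad_order D\<^esub>) = of_nat n \<odot>\<^bsub>A\<^esub> \<one>\<^bsub>A\<^esub> \<oplus>\<^bsub>A\<^esub> \<one>\<^bsub>A\<^esub>"
      using ring_hom_add[OF hom nat_in O.one_closed] Suc ring_hom_one[OF hom] by simp
    moreover have "(of_nat n + 1) \<odot>\<^bsub>A\<^esub> \<one>\<^bsub>A\<^esub> = of_nat n \<odot>\<^bsub>A\<^esub> \<one>\<^bsub>A\<^esub> \<oplus>\<^bsub>A\<^esub> \<one>\<^bsub>A\<^esub>"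
      using M.smult_l_distr[of "of_nat n" 1 "\<one>\<^bsub>A\<^esub>"] M.smult_one[of "\<one>\<^bsub>A\<^esub>"] by (simp add: RatF_simps)
    ultimately show ?case by (simp add: quad_order_simps(1,4) add.commute)
  qed
  have "\<phi> (sqrtD D) \<otimes>\<^bsub>A\<^esub> \<phi> (sqrtD D) = \<phi> (of_int D)"
    using ring_hom_mult[OF hom sqrtD_in_quad_order sqrtD_in_quad_order]
    by (simp add: quad_order_simps(3) sqrtD_mult_self)
  then show ?thesis using nat[of "nat D"] D by simp
qed

lemma linked_embeddings_imp_isomorphic:
  assumes adm: "admissible D1 D2 x" and A: "quaternion_algebra RatF A"
    and emb: "admits_linked_embeddings A D1 D2 x"
  shows "alg_isomorphic RatF A (quat_alg RatF (of_int D1) (of_int (x\<^sup>2 - D1 * D2)))"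
proof -
  obtain a b i j where alg: "assoc_algebra RatF A" and basis: "quaternion_basis RatF A a b i j"
    using A unfolding quaternion_algebra_def by blast
  obtain \<phi>1 \<phi>2 where hom: "\<phi>1 \<in> ring_hom (quad_order D1) A" "\<phi>2 \<in> ring_hom (quad_order D2) A"
    and linked: "of_int x = trd RatF A (\<phi>1 (sqrtD D1) \<otimes>\<^bsub>A\<^esub> \<phi>2 (sqrtD D2)) / 2"
    using emb unfolding admits_linked_embeddings_def x_linked_def by blast
  let ?H = "quat_alg RatF a b" and ?h = "quat_comb A i j"
  note h = quat_comb_hom[OF alg basis]
  obtain I J where IJ: "\<phi>1 (sqrtD D1) = ?h I" "\<phi>2 (sqrtD D2) = ?h J"
    using quat_comb_surj[OF alg basis] ring_hom_closed[OF hom(1) sqrtD_in_quad_order]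
      ring_hom_closed[OF hom(2) sqrtD_in_quad_order] by metis
  have D: "\<nexists>n. D1 = n\<^sup>2" "D1 > 0" "\<nexists>n. D2 = n\<^sup>2" "D2 > 0" "x\<^sup>2 \<noteq> D1 * D2"
    using adm by (auto simp: admissible_def is_discriminant_def)
  have "?h (I \<otimes>\<^bsub>?H\<^esub> I) = ?h (of_int D1, 0, 0, 0)" "?h (J \<otimes>\<^bsub>?H\<^esub> J) = ?h (of_int D2, 0, 0, 0)"
    using quad_order_hom_sqrtD_square[OF alg hom(1) D(2)] quad_order_hom_sqrtD_square[OF alg hom(2) D(4)]
    unfolding h(3,4) IJ by auto
  then have sq: "I \<otimes>\<^bsub>?H\<^esub> I = (of_int D1, 0, 0, 0)" "J \<otimes>\<^bsub>?H\<^esub> J = (of_int D2, 0, 0, 0)"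
    using quat_comb_inj[OF alg basis] by blast+
  have tr: "fst (I \<otimes>\<^bsub>?H\<^esub> J) = of_int x"
    using linked trd_quat_comb[OF alg basis] unfolding IJ h(3)[symmetric]
    by (cases "I \<otimes>\<^bsub>?H\<^esub> J") simp
  obtain K where "quaternion_basis RatF ?H (of_int D1) (of_int (x\<^sup>2 - D1 * D2)) I K"
    using linked_quaternion_basis[OF sq(1) D(1) sq(2) D(3) tr D(5)] by blast
  then have "alg_isomorphic RatF (quat_alg RatF (of_int D1) (of_int (x\<^sup>2 - D1 * D2))) A"
    using alg_isomorphic_trans quat_alg_isomorphic_of_basis[OF quat_alg_rat_assoc_algebra]
      quat_alg_isomorphic_of_basis[OF alg basis] by blast
  then show ?thesis by (rule alg_isomorphic_sym[OF quat_alg_rat_assoc_algebra])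
qed

text \<open>The hypothesis says that the pure quaternion I with coordinates i1, i2, i3 squares to D.
  The map u + v sqrt D -> u + v I is defined on the whole quadratic field, by uniqueness of u and v,
  and used on the order.\<close>

lemma quad_order_embedding:
  assumes D: "\<nexists>n. D = n\<^sup>2" and I: "a * i1 * i1 + b * i2 * i2 - a * b * i3 * i3 = of_int D"
  shows "\<exists>\<phi> \<in> ring_hom (quad_order D) (quat_alg RatF a b). \<phi> (sqrtD D) = (0, i1, i2, i3)"
proof -
  define \<phi> where "\<phi> z = (THE w. \<exists>u v. z = of_rat u + of_rat v * sqrtD D \<and> w = (u, v * i1, v * i2, v * i3))" for
    z
  have \<phi>: "\<phi> (of_rat u + of_rat v * sqrtD D) = (u, v * i1, v * i2, v * i3)" for u v
    unfolding \<phi>_def by (rule the_equality) (auto dest: quad_irrational_unique[OF D])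
  let ?H = "quat_alg RatF a b"
  have "\<phi> \<in> ring_hom (quad_order D) ?H"
  proof (rule ring_hom_memI)
    show "\<phi> \<one>\<^bsub>quad_order D\<^esub> = \<one>\<^bsub>?H\<^esub>"
      using \<phi>[of 1 0] by (simp add: quad_order_simps quat_rat_simps)
    fix z z' assume "z \<in> carrier (quad_order D)" "z' \<in> carrier (quad_order D)"
    then obtain u v u' v' where z: "z = of_rat u + of_rat v * sqrtD D" "z' = of_rat u' + of_rat v' * sqrtD D"
      using quad_order_subset by meson
    have "z + z' = of_rat (u + u') + of_rat (v + v') * sqrtD D"
      by (simp add: z of_rat_add algebra_simps)
    then show "\<phi> (z \<oplus>\<^bsub>quad_order D\<^esub> z') = \<phi> z \<oplus>\<^bsub>?H\<^esub> \<phi> z'"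
      by (simp only: \<phi> quad_order_simps z quat_rat_simps) (simp add: algebra_simps)
    have "z * z' = of_rat u * of_rat u' + of_rat v * of_rat v' * (sqrtD D * sqrtD D) + (of_rat u * of_rat v' +
      of_rat v * of_rat u') * sqrtD D"
      by (simp add: z algebra_simps)
    also have "\<dots> = of_rat (u * u' + v * v' * of_int D) + of_rat (u * v' + v * u') * sqrtD D"
      unfolding sqrtD_mult_self by (simp add: of_rat_add of_rat_mult)
    finally have "\<phi> (z \<otimes>\<^bsub>quad_order D\<^esub> z') =
        (u * u' + v * v' * of_int D, (u * v' + v * u') * i1, (u * v' + v * u') * i2, (u * v' + v * u') * i3)"
      by (simp only: \<phi> quad_order_simps)
    then show "\<phi> (z \<otimes>\<^bsub>quad_order D\<^esub> z') = \<phi> z \<otimes>\<^bsub>?H\<^esub> \<phi> z'"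
      unfolding I[symmetric] z \<phi> by (simp add: quat_rat_simps algebra_simps)
  qed (auto simp: quat_rat_simps)
  moreover have "\<phi> (sqrtD D) = (0, i1, i2, i3)" using \<phi>[of 0 1] by simp
  ultimately show ?thesis by blast
qed

lemma quat_alg_admits_linked_embeddings:
  assumes adm: "admissible D1 D2 x"
  shows "admits_linked_embeddings (quat_alg RatF (of_int D1) (of_int (x\<^sup>2 - D1 * D2))) D1 D2 x"
proof -
  have D: "\<nexists>n. D1 = n\<^sup>2" "D1 > 0" "\<nexists>n. D2 = n\<^sup>2" "D2 > 0" "x\<^sup>2 \<noteq> D1 * D2"
    using adm by (auto simp: admissible_def is_discriminant_def)
  define a b :: rat where ab: "a = of_int D1" "b = of_int (x\<^sup>2 - D1 * D2)"
  have nz: "a \<noteq> 0" "b \<noteq> 0" using D by (auto simp: ab simp del: of_int_diff)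
  let ?H = "quat_alg RatF a b"
  obtain \<phi>1 where f1: "\<phi>1 \<in> ring_hom (quad_order D1) ?H" "\<phi>1 (sqrtD D1) = (0, 1, 0, 0)"
    using quad_order_embedding[OF D(1), of a 1 b 0 0] by (auto simp: ab)
  \<comment> \<open>The square of (x i + k)/a is (x^2 - b)/a, and b = x^2 - D1 D2 with a = D1. Its
    product with i has scalar part x.\<close>
  have "a * (of_int x / a) * (of_int x / a) + b * 0 * 0 - a * b * (1 / a) * (1 / a) = of_int D2"
    using nz(1) by (simp add: field_simps) (simp add: ab algebra_simps power2_eq_square)
  then obtain \<phi>2 where f2: "\<phi>2 \<in> ring_hom (quad_order D2) ?H" "\<phi>2 (sqrtD D2) = (0, of_int x / a, 0, 1 / a)"
    using quad_order_embedding[OF D(3)] by blast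
  have "trd RatF ?H w = 2 * fst w" for w
    using trd_quat_comb[OF quat_alg_rat_assoc_algebra quat_alg_rat_standard_basis[OF nz]]
    unfolding quat_comb_standard by (cases w) simp
  then have "x_linked ?H D1 D2 x \<phi>1 \<phi>2"
    using nz unfolding x_linked_def f1 f2 by (simp add: quat_rat_simps)
  then show ?thesis using f1 f2 unfolding admits_linked_embeddings_def ab by blast
qed

section \<open>Fundamental discriminants\<close>

text \<open>If e is the reduced denominator of r, every e^k divides N. For e at least 2 the choice k
  = N contradicts 2^N > N.\<close>

lemma rat_Ints_of_bounded_powers:
  fixes r :: rat
  assumes N: "N > 0" and int: "\<And>k. of_int N * r ^ k \<in> \<int>"
  shows "r \<in> \<int>"
proof -
  obtain a e where ae: "quotient_of r = (a, e)" by (cases "quotient_of r")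
  have e: "e > 0" "coprime a e" and r: "r = of_int a / of_int e"
    using ae quotient_of_denom_pos quotient_of_coprime quotient_of_div by auto
  have dvd: "e ^ k dvd N" for k
  proof -
    obtain m where "of_int N * r ^ k = of_int m" using int[of k] by (auto elim: Ints_cases)
    then have "(of_int (N * a ^ k) :: rat) = of_int (m * e ^ k)"
      using e by (simp add: r field_simps)
    then have "N * a ^ k = m * e ^ k" by (simp only: of_int_eq_iff)
    then have "e ^ k dvd N * a ^ k" by simp
    then show ?thesis using e(2) by (simp add: coprime_dvd_mult_left_iff coprime_commute)
  qed
  have "e = 1"
  proof (rule ccontr)
    assume "e \<noteq> 1"
    then have "e \<ge> 2" using e by simp
    then have "2 ^ nat N \<le> e ^ nat N" by (intro power_mono) simp_all
    moreover have "e ^ nat N \<le> N" using dvd N by (intro zdvd_imp_le) auto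
    moreover have "int (nat N) < int (2 ^ nat N)" by (simp only: of_nat_less_iff less_exp)
    ultimately show False using N by simp
  qed
  then show ?thesis by (simp add: r)
qed

text \<open>The norm is multiplicative, so a denominator N common to all powers of w gives the
  denominator N^2 for all powers of its norm.\<close>

lemma quad_norm_Ints:
  assumes D: "\<nexists>n. D = n\<^sup>2" and N: "N > 0"
    and w: "w = of_rat u + of_rat v * sqrtD D"
    and pow: "\<And>k. \<exists>a b. of_int N * w ^ k = of_int a + of_int b * sqrtD D"
  shows "u\<^sup>2 - of_int D * v\<^sup>2 \<in> \<int>"
proof (rule rat_Ints_of_bounded_powers[of "N\<^sup>2"])
  fix k
  have "\<exists>x y. w ^ k = of_rat x + of_rat y * sqrtD D \<and> x\<^sup>2 - of_int D * y\<^sup>2 = (u\<^sup>2 - of_int D * v\<^sup>2) ^ k"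
  proof (induction k)
    case 0 show ?case by (rule exI[of _ 1], rule exI[of _ 0]) simp
  next
    case (Suc k)
    then obtain x y where xy: "w ^ k = of_rat x + of_rat y * sqrtD D"
      "x\<^sup>2 - of_int D * y\<^sup>2 = (u\<^sup>2 - of_int D * v\<^sup>2) ^ k"
      by blast
    have "w ^ Suc k = (of_rat u + of_rat v * sqrtD D) * (of_rat x + of_rat y * sqrtD D)"
      unfolding xy(1)[symmetric] w[symmetric] by simp
    also have "\<dots> = of_rat u * of_rat x + of_rat v * of_rat y * (sqrtD D * sqrtD D) + (of_rat u * of_rat y +
      of_rat v * of_rat x) * sqrtD D"
      by (simp add: algebra_simps)
    also have "\<dots> = of_rat (u * x + v * y * of_int D) + of_rat (u * y + v * x) * sqrtD D"
      unfolding sqrtD_mult_self by (simp add: of_rat_add of_rat_mult)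
    finally have "w ^ Suc k = of_rat (u * x + v * y * of_int D) + of_rat (u * y + v * x) * sqrtD D" .
    moreover have "(u * x + v * y * of_int D)\<^sup>2 - of_int D * (u * y + v * x)\<^sup>2 = (u\<^sup>2 - of_int D * v\<^sup>2) ^ Suc k"
      unfolding power_Suc xy(2)[symmetric] by (simp add: power2_eq_square algebra_simps)
    ultimately show ?case by blast
  qed
  then obtain x y where xy: "w ^ k = of_rat x + of_rat y * sqrtD D"
    "x\<^sup>2 - of_int D * y\<^sup>2 = (u\<^sup>2 - of_int D * v\<^sup>2) ^ k"
    by blast
  obtain a b where ab: "of_int N * w ^ k = of_int a + of_int b * sqrtD D" using pow by blast
  have "of_rat (of_int N * x) + of_rat (of_int N * y) * sqrtD D = of_rat (of_int a) + of_rat (of_int b) * sqrtD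
    D"
    using ab by (simp add: xy of_rat_mult algebra_simps)
  from quad_irrational_unique[OF D this] have "of_int N * x = of_int a" "of_int N * y = of_int b" by auto
  moreover have "of_int (N\<^sup>2) * (u\<^sup>2 - of_int D * v\<^sup>2) ^ k = (of_int N * x)\<^sup>2 - of_int D * (of_int N * y)\<^sup>2"
    unfolding xy(2)[symmetric] by (simp add: power2_eq_square algebra_simps)
  ultimately have "of_int (N\<^sup>2) * (u\<^sup>2 - of_int D * v\<^sup>2) ^ k = of_int (a\<^sup>2 - D * b\<^sup>2)" by simp
  then show "of_int (N\<^sup>2) * (u\<^sup>2 - of_int D * v\<^sup>2) ^ k \<in> \<int>" by (metis Ints_of_int)
qed (use N in simp)

text \<open>Powers of an algebraic integer have bounded denominators, hence so do powers of its
  norm; the trace follows by shifting the element by \<open>1\<close>.\<close>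

lemma algebraic_int_quad_iff:
  assumes D: "\<nexists>n. D = n\<^sup>2" and z: "z = of_rat u + of_rat v * sqrtD D"
  shows "algebraic_int z \<longleftrightarrow> 2 * u \<in> \<int> \<and> u\<^sup>2 - of_int D * v\<^sup>2 \<in> \<int>"
proof
  assume "2 * u \<in> \<int> \<and> u\<^sup>2 - of_int D * v\<^sup>2 \<in> \<int>"
  then obtain t q where tq: "2 * u = of_int t" "u\<^sup>2 - of_int D * v\<^sup>2 = of_int q" by (auto elim!: Ints_cases)
  have t: "(2 * of_rat u :: complex) = of_int t"
    using arg_cong[OF tq(1), of "of_rat :: rat \<Rightarrow> complex"] by (simp add: of_rat_mult)
  have q: "((of_rat u)\<^sup>2 - of_int D * (of_rat v)\<^sup>2 :: complex) = of_int q"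
    using arg_cong[OF tq(2), of "of_rat :: rat \<Rightarrow> complex"] by (simp add: of_rat_mult of_rat_diff of_rat_power)
  have "z * z - of_int t * z + of_int q = (of_rat v)\<^sup>2 * (sqrtD D * sqrtD D - of_int D)"
    unfolding z t[symmetric] q[symmetric] by (simp add: algebra_simps power2_eq_square)
  then have 0: "z * z - of_int t * z + of_int q = 0" by (simp only: sqrtD_mult_self diff_self mult_zero_right)
  show "algebraic_int z"
  proof (rule algebraic_int.intros[of "[:of_int q, - of_int t, 1:]"])
    show "\<forall>i. coeff [:of_int q, - of_int t, 1:] i \<in> (\<int> :: complex set)"
      by (auto simp: coeff_pCons split: nat.splits)
    show "poly [:of_int q, - of_int t, 1:] z = 0" using 0 by (simp add: algebra_simps)
  qed simp
next
  assume "algebraic_int z"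
  then obtain P where P: "lead_coeff P = 1" "\<And>i. coeff P i \<in> \<int>" "poly P z = 0"
    by (auto elim: algebraic_int.cases)
  define n where "n = degree P"
  obtain a b e where abe: "e > 0" "u = of_int a / of_int e" "v = of_int b / of_int e"
    by (rule rat_common_denominator)
  have ez: "of_int e * z = of_int a + of_int b * sqrtD D"
    unfolding z abe(2,3) using abe(1) by (simp add: of_rat_divide field_simps)
  \<comment> \<open>The module Z + Z sqrt D divided by e^n. Powers of z below the degree n lie in it
    because e z has integral coordinates; the monic equation then keeps all higher powers in
    it.\<close>
  define S where "S = {w :: complex. \<exists>a b. of_int (e ^ n) * w = of_int a + of_int b * sqrtD D}"
  have S_int: "of_int k * w \<in> S" if w: "w \<in> S" for k w
  proof -
    obtain a b where "of_int (e ^ n) * w = of_int a + of_int b * sqrtD D" using w unfolding S_def by blast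
    then have "of_int (e ^ n) * (of_int k * w) = of_int k * (of_int a + of_int b * sqrtD D)"
      by (metis mult.left_commute)
    also have "\<dots> = of_int (k * a) + of_int (k * b) * sqrtD D"
      by (simp add: algebra_simps)
    finally have "of_int (e ^ n) * (of_int k * w) = of_int (k * a) + of_int (k * b) * sqrtD D" .
    then show ?thesis unfolding S_def by blast
  qed
  have S_add: "w + w' \<in> S" if w: "w \<in> S" "w' \<in> S" for w w'
  proof -
    obtain a b a' b' where "of_int (e ^ n) * w = of_int a + of_int b * sqrtD D"
      "of_int (e ^ n) * w' = of_int a' + of_int b' * sqrtD D" using w unfolding S_def by blast
    then have "of_int (e ^ n) * (w + w') = of_int (a + a') + of_int (b + b') * sqrtD D"
      by (simp add: algebra_simps)
    then show ?thesis unfolding S_def by blast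
  qed
  have S_sum: "(\<Sum>i\<in>A. f i) \<in> S" if "\<And>i. i \<in> A \<Longrightarrow> f i \<in> S" "finite A" for f and A :: "nat set"
    using that(2,1)
  proof (induction A rule: finite_induct)
    case empty
    have "of_int (e ^ n) * 0 = of_int 0 + of_int 0 * sqrtD D" by simp
    then show ?case unfolding S_def by (simp only: sum.empty mem_Collect_eq) blast
  qed (auto intro: S_add)
  have epow: "\<exists>a b. of_int (e ^ k) * z ^ k = of_int a + of_int b * sqrtD D" for k
  proof (induction k)
    case 0 show ?case by (rule exI[of _ 1], rule exI[of _ 0]) simp
  next
    case (Suc k)
    then obtain c d where "of_int (e ^ k) * z ^ k = of_int c + of_int d * sqrtD D" by blast
    then have "of_int (e ^ Suc k) * z ^ Suc k = (of_int a + of_int b * sqrtD D) * (of_int c + of_int d * sqrtD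
      D)"
      unfolding ez[symmetric] by (simp add: algebra_simps)
    also have "\<dots> = of_int a * of_int c + of_int b * of_int d * (sqrtD D * sqrtD D) + (of_int a * of_int d +
      of_int b * of_int c) * sqrtD D"
      by (simp add: algebra_simps)
    also have "\<dots> = of_int (a * c + b * d * D) + of_int (a * d + b * c) * sqrtD D"
      unfolding sqrtD_mult_self by simp
    finally show ?case by blast
  qed
  have zS: "z ^ k \<in> S" for k
  proof (induction k rule: less_induct)
    case (less k)
    show ?case
    proof (cases "k < n")
      case True
      obtain c d where "of_int (e ^ k) * z ^ k = of_int c + of_int d * sqrtD D" using epow by blast
      moreover have "e ^ n = e ^ (n - k) * e ^ k" using True by (simp flip: power_add)
      ultimately have "of_int (e ^ n) * z ^ k = of_int (e ^ (n - k)) * (of_int c + of_int d * sqrtD D)"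
        by (simp only: of_int_mult mult.assoc)
      also have "\<dots> = of_int (e ^ (n - k) * c) + of_int (e ^ (n - k) * d) * sqrtD D"
        by (simp add: algebra_simps)
      finally show ?thesis unfolding S_def by blast
    next
      case False
      have "0 = (\<Sum>i\<le>n. coeff P i * z ^ i)" using P(3) by (simp add: poly_altdef n_def)
      also have "\<dots> = (\<Sum>i<n. coeff P i * z ^ i) + z ^ n"
        using P(1) by (simp add: n_def lessThan_Suc_atMost[symmetric])
      finally have zn: "z ^ n = - (\<Sum>i<n. coeff P i * z ^ i)" by (simp add: eq_neg_iff_add_eq_0 add.commute)
      have "z ^ k = z ^ (k - n) * z ^ n" using False by (simp flip: power_add)
      also have "\<dots> = (\<Sum>i<n. - coeff P i * z ^ (k - n + i))"
        unfolding zn by (simp add: sum_distrib_left sum_negf power_add algebra_simps)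
      also have "\<dots> \<in> S"
      proof (rule S_sum)
        fix i assume "i \<in> {..<n}"
        then have "z ^ (k - n + i) \<in> S" using False by (intro less.IH) auto
        moreover obtain c where "- coeff P i = of_int c" using P(2)[of i] by (metis Ints_cases Ints_minus)
        ultimately show "- coeff P i * z ^ (k - n + i) \<in> S" using S_int by simp
      qed simp
      finally show ?thesis .
    qed
  qed
  \<comment> \<open>Bounds the denominators of the powers of z + 1. The extra factor z^i is what
    lets the induction on k go through.\<close>
  have zS': "z ^ i * (z + 1) ^ k \<in> S" for i k
  proof (induction k arbitrary: i)
    case (Suc k)
    have "z ^ i * (z + 1) ^ Suc k = z ^ Suc i * (z + 1) ^ k + z ^ i * (z + 1) ^ k" by (simp add: algebra_simps)
    then show ?case using S_add[OF Suc[of "Suc i"] Suc[of i]] by simp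
  qed (simp add: zS)
  have en: "e ^ n > 0" using abe by simp
  have N1: "u\<^sup>2 - of_int D * v\<^sup>2 \<in> \<int>"
    by (rule quad_norm_Ints[OF D en z]) (use zS in \<open>simp add: S_def\<close>)
  have z1: "z + 1 = of_rat (u + 1) + of_rat v * sqrtD D" by (simp add: z of_rat_add)
  have "(u + 1)\<^sup>2 - of_int D * v\<^sup>2 \<in> \<int>"
    by (rule quad_norm_Ints[OF D en z1]) (use zS'[of 0] in \<open>simp add: S_def\<close>)
  then have "((u + 1)\<^sup>2 - of_int D * v\<^sup>2) - (u\<^sup>2 - of_int D * v\<^sup>2) - 1 \<in> \<int>"
    by (rule Ints_diff[OF Ints_diff[OF _ N1] Ints_1])
  also have "((u + 1)\<^sup>2 - of_int D * v\<^sup>2) - (u\<^sup>2 - of_int D * v\<^sup>2) - 1 = 2 * u"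
    by (simp add: power2_eq_square algebra_simps)
  finally show "2 * u \<in> \<int> \<and> u\<^sup>2 - of_int D * v\<^sup>2 \<in> \<int>" using N1 by blast
qed

lemma quad_conj_eq:
  assumes D: "\<nexists>n. D = n\<^sup>2"
  shows "quad_conj D (of_rat u + of_rat v * sqrtD D) = of_rat u - of_rat v * sqrtD D"
  unfolding quad_conj_def by (rule the_equality) (auto dest: quad_irrational_unique[OF D])

text \<open>Any two integral bases differ by an integer matrix of determinant 1 or -1, which
  disappears on squaring; so the definite description in \<open>fund_disc\<close> may be evaluated
  on the basis 1, \<omega>.\<close>

lemma fund_disc_eqI:
  assumes D: "\<nexists>n. D = n\<^sup>2" and \<omega>: "\<omega> = of_rat w0 + of_rat w1 * sqrtD D"
    and bij: "bij_betw (\<lambda>(m, n). of_int m * 1 + of_int n * \<omega>) UNIV (quad_field_integers D)"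
    and F: "of_int F = 4 * w1\<^sup>2 * of_int D"
  shows "fund_disc D = F"
proof -
  define \<omega>' where "\<omega>' = of_rat w0 - of_rat w1 * sqrtD D"
  have conj: "quad_conj D (of_int m + of_int n * \<omega>) = of_int m + of_int n * \<omega>'" for m n
  proof -
    have eq: "of_int m + of_int n * \<omega> = of_rat (of_int m + of_int n * w0) + of_rat (of_int n * w1) * sqrtD D"
      by (simp add: \<omega> of_rat_add of_rat_mult algebra_simps)
    show ?thesis
      unfolding eq quad_conj_eq[OF D] by (simp add: \<omega>'_def of_rat_add of_rat_mult algebra_simps)
  qed
  have "of_int F = (of_rat (of_int F) :: complex)" by simp
  also have "\<dots> = 4 * (of_rat w1)\<^sup>2 * (sqrtD D * sqrtD D)"
    unfolding F sqrtD_mult_self by (simp add: of_rat_mult of_rat_power)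
  also have "\<dots> = (\<omega>' - \<omega>)\<^sup>2"
    by (simp add: \<omega> \<omega>'_def power2_eq_square algebra_simps)
  finally have F': "of_int F = (\<omega>' - \<omega>)\<^sup>2" .
  have uniq: "m = m' \<and> n = n'" if "of_int m + of_int n * \<omega> = of_int m' + of_int n' * \<omega>" for m n m' n'
  proof -
    have "(m, n) = (m', n')"
      by (rule inj_onD[OF bij_betw_imp_inj_on[OF bij]]) (use that in simp_all)
    then show ?thesis by simp
  qed
  have range: "quad_field_integers D = range (\<lambda>(m, n). of_int m + of_int n * \<omega>)"
    using bij_betw_imp_surj_on[OF bij] by simp
  show ?thesis
    unfolding fund_disc_def
  proof (rule the_equality)
    show "\<exists>\<alpha> \<beta>. bij_betw (\<lambda>(m, n). of_int m * \<alpha> + of_int n * \<beta>) UNIV (quad_field_integers D) \<and>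
        of_int F = (\<alpha> * quad_conj D \<beta> - \<beta> * quad_conj D \<alpha>)\<^sup>2"
      using bij F' conj[of 1 0] conj[of 0 1] by (intro exI[of _ 1] exI[of _ \<omega>]) simp
  next
    fix d assume "\<exists>\<alpha> \<beta>. bij_betw (\<lambda>(m, n). of_int m * \<alpha> + of_int n * \<beta>) UNIV (quad_field_integers D) \<and>
        of_int d = (\<alpha> * quad_conj D \<beta> - \<beta> * quad_conj D \<alpha>)\<^sup>2"
    then obtain \<alpha> \<beta> where bij': "bij_betw (\<lambda>(m, n). of_int m * \<alpha> + of_int n * \<beta>) UNIV (quad_field_integers D)"
      and d: "of_int d = (\<alpha> * quad_conj D \<beta> - \<beta> * quad_conj D \<alpha>)\<^sup>2" by blast
    have range': "quad_field_integers D = range (\<lambda>(m, n). of_int m * \<alpha> + of_int n * \<beta>)"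
      using bij_betw_imp_surj_on[OF bij'] by simp
    have mem': "of_int m * \<alpha> + of_int n * \<beta> \<in> quad_field_integers D" for m n
      unfolding range' by (rule range_eqI[of _ _ "(m, n)"]) simp
    have mem: "of_int m + of_int n * \<omega> \<in> quad_field_integers D" for m n
      unfolding range by (rule range_eqI[of _ _ "(m, n)"]) simp
    obtain a b where \<alpha>: "\<alpha> = of_int a + of_int b * \<omega>" using mem'[of 1 0] unfolding range by auto
    obtain c e where \<beta>: "\<beta> = of_int c + of_int e * \<omega>" using mem'[of 0 1] unfolding range by auto
    obtain k l where kl: "1 = of_int k * \<alpha> + of_int l * \<beta>" using mem[of 1 0] unfolding range' by auto
    obtain m n where mn: "\<omega> = of_int m * \<alpha> + of_int n * \<beta>" using mem[of 0 1] unfolding range' by auto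
    have "of_int 1 + of_int 0 * \<omega> = of_int (k * a + l * c) + of_int (k * b + l * e) * \<omega>"
      using kl by (simp add: \<alpha> \<beta> algebra_simps)
    from uniq[OF this] have 1: "k * a + l * c = 1" "k * b + l * e = 0" by auto
    have "of_int 0 + of_int 1 * \<omega> = of_int (m * a + n * c) + of_int (m * b + n * e) * \<omega>"
      using mn by (simp add: \<alpha> \<beta> algebra_simps)
    from uniq[OF this] have 2: "m * a + n * c = 0" "m * b + n * e = 1" by auto
    \<comment> \<open>The determinants of the two transition matrices multiply to 1.\<close>
    have "(k * n - l * m) * (a * e - b * c) = (k * a + l * c) * (m * b + n * e) - (k * b + l * e) * (m * a + n *
      c)"
      by (simp add: algebra_simps)
    then have "(k * n - l * m) * (a * e - b * c) = 1" using 1 2 by simp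
    then have "a * e - b * c = 1 \<or> a * e - b * c = -1" by (auto simp: zmult_eq_1_iff)
    then have det: "(a * e - b * c)\<^sup>2 = 1" by auto
    have "of_int d = (of_int (a * e - b * c) * (\<omega>' - \<omega>))\<^sup>2"
      unfolding d \<alpha> \<beta> conj by (rule arg_cong[of _ _ "\<lambda>z. z\<^sup>2"]) (simp add: algebra_simps)
    also have "\<dots> = of_int ((a * e - b * c)\<^sup>2) * (\<omega>' - \<omega>)\<^sup>2" by (simp add: power_mult_distrib)
    also have "\<dots> = of_int F" unfolding det F' by simp
    finally show "d = F" by (simp only: of_int_eq_iff)
  qed
qed

text \<open>The square of the reduced denominator of w has to divide d.\<close>

lemma squarefree_mult_square_Ints:
  fixes w :: rat
  assumes d: "squarefree d" and int: "of_int d * w\<^sup>2 \<in> \<int>"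
  shows "w \<in> \<int>"
proof -
  obtain a b where ab: "quotient_of w = (a, b)" by (cases "quotient_of w")
  have b: "b > 0" "coprime a b" and w: "w = of_int a / of_int b"
    using ab quotient_of_denom_pos quotient_of_coprime quotient_of_div by auto
  obtain k where "of_int d * w\<^sup>2 = of_int k" using int by (auto elim: Ints_cases)
  then have "(of_int (d * a\<^sup>2) :: rat) = of_int (k * b\<^sup>2)" using b by (simp add: w field_simps)
  then have "d * a\<^sup>2 = k * b\<^sup>2" by (simp only: of_int_eq_iff)
  then have "b\<^sup>2 dvd d * a\<^sup>2" by simp
  then have "b\<^sup>2 dvd d" using b(2) by (simp add: coprime_dvd_mult_left_iff coprime_commute)
  then have "b dvd 1" using d by (rule squarefreeD[rotated])
  then have "b = 1" using b by simp
  then show ?thesis by (simp add: w)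
qed

lemma square_mod_4: "x\<^sup>2 mod 4 = (if even x then 0 else 1)" for x :: int
proof (cases "even x")
  case True
  then obtain k where "x = 2 * k" by (rule evenE)
  then show ?thesis by (simp add: power2_eq_square)
next
  case False
  then obtain k where "x = 2 * k + 1" by (rule oddE)
  then have "x\<^sup>2 = 1 + 4 * (k\<^sup>2 + k)" by (simp add: power2_eq_square algebra_simps)
  then show ?thesis using False by (simp only: mod_mult_self2) simp
qed

lemma fund_disc_squarefree_part:
  assumes D: "\<nexists>n. D = n\<^sup>2" and f: "f \<noteq> 0" and d: "squarefree d" and Dd: "D = d * f\<^sup>2"
  shows "fund_disc D = (if d mod 4 = 1 then d else 4 * d)"
proof -
  let ?s = "sqrtD D"
  \<comment> \<open>As sqrt D / f is a square root of d, this makes \<omega> the classical generator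
    of the maximal order: (1 + sqrt d)/2 if d is 1 modulo 4, and sqrt d otherwise, up to the sign of
    the root.\<close>
  define w0 w1 :: rat where "w0 = (if d mod 4 = 1 then 1 / 2 else 0)"
    and "w1 = (if d mod 4 = 1 then 1 / (2 * of_int f) else 1 / of_int f)"
  define \<omega> where "\<omega> = of_rat w0 + of_rat w1 * ?s"
  have w1: "w1 \<noteq> 0" using f by (simp add: w1_def)
  have comb: "of_int m + of_int n * \<omega> = of_rat (of_int m + of_int n * w0) + of_rat (of_int n * w1) * ?s" for m n
    by (simp add: \<omega>_def of_rat_add of_rat_mult algebra_simps)
  have d4: "d mod 4 \<noteq> 0"
  proof
    assume "d mod 4 = 0"
    then have "2\<^sup>2 dvd d" by auto
    then show False using squarefreeD[OF d, of 2] by simp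
  qed
  have bij: "bij_betw (\<lambda>(m, n). of_int m * 1 + of_int n * \<omega>) UNIV (quad_field_integers D)"
    unfolding bij_betw_def
  proof
    show "inj_on (\<lambda>(m, n). of_int m * 1 + of_int n * \<omega>) UNIV"
    proof (rule inj_onI, clarify)
      fix m n m' n' assume "of_int m * 1 + of_int n * \<omega> = of_int m' * 1 + of_int n' * \<omega>"
      then have "of_rat (of_int m + of_int n * w0) + of_rat (of_int n * w1) * ?s =
          of_rat (of_int m' + of_int n' * w0) + of_rat (of_int n' * w1) * ?s"
        unfolding comb[symmetric] by simp
      from quad_irrational_unique[OF D this] show "m = m' \<and> n = n'" using w1 by auto
    qed
    show "range (\<lambda>(m, n). of_int m * 1 + of_int n * \<omega>) = quad_field_integers D"
    proof (intro equalityI subsetI)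
      fix z assume "z \<in> range (\<lambda>(m, n). of_int m * 1 + of_int n * \<omega>)"
      then obtain m n where z: "z = of_int m + of_int n * \<omega>" by auto
      have "2 * (of_int m + of_int n * w0) \<in> \<int>"
        by (simp add: w0_def distrib_left)
      moreover have "(of_int m + of_int n * w0)\<^sup>2 - of_int D * (of_int n * w1)\<^sup>2 \<in> \<int>"
      proof (cases "d mod 4 = 1")
        case True
        then obtain k where k: "d = 4 * k + 1" by (metis mult_div_mod_eq)
        have "of_int D * (of_int n * w1)\<^sup>2 = of_int d * (of_int n)\<^sup>2 / 4"
          using True f by (simp add: w1_def Dd power_mult_distrib power_divide)
        then have "(of_int m + of_int n * w0)\<^sup>2 - of_int D * (of_int n * w1)\<^sup>2 =
            (of_int m + of_int n / 2)\<^sup>2 - of_int (4 * k + 1) * (of_int n)\<^sup>2 / 4"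
          using True by (simp add: w0_def k)
        also have "\<dots> = of_int (m\<^sup>2 + m * n - k * n\<^sup>2)"
          by (simp add: power2_eq_square algebra_simps add_divide_distrib)
        finally have "(of_int m + of_int n * w0)\<^sup>2 - of_int D * (of_int n * w1)\<^sup>2 = of_int (m\<^sup>2 + m * n - k *
          n\<^sup>2)" .
        then show ?thesis by (metis Ints_of_int)
      next
        case False
        have "(of_int m + of_int n * w0)\<^sup>2 - of_int D * (of_int n * w1)\<^sup>2 = of_int (m\<^sup>2 - d * n\<^sup>2)"
          using False f by (simp add: w0_def w1_def Dd power_divide)
        then show ?thesis by (metis Ints_of_int)
      qed
      ultimately have "algebraic_int z" by (intro algebraic_int_quad_iff[OF D z[unfolded comb], THEN iffD2]
        conjI)
      then show "z \<in> quad_field_integers D"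
        unfolding quad_field_integers_def
        by (intro CollectI conjI exI[of _ "of_int m + of_int n * w0"] exI[of _
          "of_int n * w1"] z[unfolded comb])
    next
      fix z assume "z \<in> quad_field_integers D"
      then obtain u v where z: "z = of_rat u + of_rat v * ?s" and alg: "algebraic_int z"
        unfolding quad_field_integers_def by (elim CollectE conjE exE)
      have "2 * u \<in> \<int>" "u\<^sup>2 - of_int D * v\<^sup>2 \<in> \<int>"
        using algebraic_int_quad_iff[OF D z, THEN iffD1, OF alg] by simp_all
      then obtain U q where U: "2 * u = of_int U" and q: "u\<^sup>2 - of_int D * v\<^sup>2 = of_int q"
        by (elim Ints_cases)
      \<comment> \<open>Four times the norm equation bounds the denominator of 2 v f: d times its
        square is an integer and d is squarefree.\<close>
      have e: "of_int d * (2 * v * of_int f)\<^sup>2 = (of_int (U\<^sup>2 - 4 * q) :: rat)"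
      proof -
        have "(of_int (U\<^sup>2 - 4 * q) :: rat) = (2 * u)\<^sup>2 - 4 * (u\<^sup>2 - of_int D * v\<^sup>2)"
          unfolding U q by simp
        also have "\<dots> = of_int d * (2 * v * of_int f)\<^sup>2"
          by (simp add: Dd power2_eq_square)
        finally show ?thesis ..
      qed
      have "2 * v * of_int f \<in> \<int>"
        by (rule squarefree_mult_square_Ints[OF d]) (simp only: e Ints_of_int)
      then obtain V where V: "2 * v * of_int f = of_int V" by (auto elim: Ints_cases)
      have "(of_int (d * V\<^sup>2) :: rat) = of_int (U\<^sup>2 - 4 * q)" using e unfolding V by simp
      then have "d * V\<^sup>2 = U\<^sup>2 - 4 * q" by (simp only: of_int_eq_iff)
      then have eq: "U\<^sup>2 - d * V\<^sup>2 = 4 * q" by simp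
      have u: "u = of_int U / 2" and v: "v = of_int V / (2 * of_int f)" using f by (simp_all flip: U V)
      have "U\<^sup>2 mod 4 = (d mod 4 * (V\<^sup>2 mod 4)) mod 4"
      proof -
        have "U\<^sup>2 = d * V\<^sup>2 + 4 * q" using eq by linarith
        then show ?thesis by (simp add: mod_mult_eq)
      qed
      \<comment> \<open>U^2 = d V^2 modulo 4, read on parities. For d = 1 modulo 4 it gives U and V
        of equal parity; for d = 2 or 3 both must be even.\<close>
      then have m4: "(if even U then 0 else 1) = (d mod 4 * (if even V then 0 else 1)) mod (4::int)"
        unfolding square_mod_4 .
      have d4': "d mod 4 = 1 \<or> d mod 4 = 2 \<or> d mod 4 = 3" using d4 by presburger
      show "z \<in> range (\<lambda>(m, n). of_int m * 1 + of_int n * \<omega>)"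
      proof (cases "d mod 4 = 1")
        case True
        then have "even (U - V)" using m4 by (cases "even U"; cases "even V") simp_all
        then obtain m where "U - V = 2 * m" by (rule evenE)
        then have m: "U = 2 * m + V" by simp
        have "u = of_int m + of_int V * w0" "v = of_int V * w1"
          using True unfolding u v w0_def w1_def m by (simp_all add: add_divide_distrib)
        then have "z = of_int m + of_int V * \<omega>" unfolding comb z by simp
        then show ?thesis by (intro range_eqI[of _ _ "(m, V)"]) simp
      next
        case False
        then have "even U \<and> even V" using m4 d4' by (cases "even U"; cases "even V") auto
        then obtain m n where m: "U = 2 * m" "V = 2 * n" by (meson evenE)
        have "u = of_int m + of_int n * w0" "v = of_int n * w1"
          using False unfolding u v w0_def w1_def m by simp_all
        then have "z = of_int m + of_int n * \<omega>" unfolding comb z by simp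
        then show ?thesis by (intro range_eqI[of _ _ "(m, n)"]) simp
      qed
    qed
  qed
  show ?thesis
    by (rule fund_disc_eqI[OF D \<omega>_def bij]) (use f in \<open>simp add: w1_def Dd power_divide power_mult_distrib\<close>)
qed

text \<open>Let d be the squarefree part and D = d f^2. If d is not 1 modulo 4, an odd f would make
  D congruent to 2 or 3 modulo 4; so f is even, and its factor 2 passes into the fundamental
  discriminant 4 d.\<close>

lemma fund_disc_properties:
  assumes "is_discriminant D"
  shows "(\<exists>g. D = g\<^sup>2 * fund_disc D) \<and> (odd (fund_disc D) \<longrightarrow> fund_disc D mod 4 = 1) \<and>
    (even (fund_disc D) \<longrightarrow> 4 dvd fund_disc D)"
proof -
  have D: "\<nexists>n. D = n\<^sup>2" and D4: "D mod 4 = 0 \<or> D mod 4 = 1"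
    using assms by (auto simp: is_discriminant_def Cong.cong_def)
  have D0: "D \<noteq> 0" using D by (metis zero_power2)
  define d f where "d = squarefree_part D" and "f = square_part D"
  have Dd: "D = d * f\<^sup>2" unfolding d_def f_def by (rule squarefree_decompose)
  have f: "f \<noteq> 0" using D0 Dd by auto
  have F: "fund_disc D = (if d mod 4 = 1 then d else 4 * d)"
    by (rule fund_disc_squarefree_part[OF D f _ Dd]) (simp add: d_def)
  show ?thesis
  proof (cases "d mod 4 = 1")
    case True
    then have "odd d" by presburger
    moreover have "D = f\<^sup>2 * d" using Dd by (simp add: mult.commute)
    ultimately show ?thesis unfolding F using True by auto
  next
    case False
    have "even f"
    proof (rule ccontr)
      assume "odd f"
      then obtain k where k: "f = 2 * k + 1" by (rule oddE)
      have "D = d + 4 * (d * (k\<^sup>2 + k))" unfolding Dd k by (simp add: power2_eq_square algebra_simps)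
      then have "D mod 4 = d mod 4" by (simp only: mod_mult_self2)
      moreover have "d mod 4 \<noteq> 0"
      proof
        assume "d mod 4 = 0"
        then have "2\<^sup>2 dvd d" by auto
        then show False using squarefreeD[of d 2] by (simp add: d_def)
      qed
      ultimately show False using D4 False by auto
    qed
    then obtain g where "f = 2 * g" by (rule evenE)
    then have "D = g\<^sup>2 * (4 * d)" using Dd by (simp add: power2_eq_square)
    then show ?thesis unfolding F using False by auto
  qed
qed

section \<open>Local splitting criteria\<close>

lemma isotropic_commute: "padic_isotropic p a b \<Longrightarrow> padic_isotropic p b a"
  unfolding padic_isotropic_def
proof (elim bexE conjE)
  fix t x y z assume C: "t \<in> padic_cauchy p" "x \<in> padic_cauchy p" "y \<in> padic_cauchy p" "z \<in> padic_cauchy p"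
    and nn: "\<not> (t \<in> padic_null p \<and> x \<in> padic_null p \<and> y \<in> padic_null p \<and> z \<in> padic_null p)"
    and e: "(\<lambda>n. t n ^ 2 - a * x n ^ 2 - b * y n ^ 2 + a * b * z n ^ 2) \<in> padic_null p"
  have "(\<lambda>n. t n ^ 2 - b * y n ^ 2 - a * x n ^ 2 + b * a * z n ^ 2) \<in> padic_null p"
    using e by (simp add: algebra_simps)
  then show "\<exists>t\<in>padic_cauchy p. \<exists>x\<in>padic_cauchy p. \<exists>y\<in>padic_cauchy p. \<exists>z\<in>padic_cauchy p.
      \<not> (t \<in> padic_null p \<and> x \<in> padic_null p \<and> y \<in> padic_null p \<and> z \<in> padic_null p) \<and>
      (\<lambda>n. (t n)\<^sup>2 - b * (x n)\<^sup>2 - a * (y n)\<^sup>2 + b * a * (z n)\<^sup>2) \<in> padic_null p"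
    using C nn by blast
qed

lemma split_of_square:
  assumes "s \<in> padic_cauchy p" "(\<lambda>n. s n ^ 2 - b) \<in> padic_null p"
  shows "padic_split p a b"
  unfolding padic_split_def
  by (rule bexI[OF _ assms(1)], rule bexI[OF _ padic_cauchy_const[of 0]]) (use assms(2) in simp)

context
  fixes p :: nat
  assumes p: "prime p"
begin

text \<open>The symmetry is hidden in the norm equation but visible in the quaternary form, which is
  unchanged when a, x are exchanged with b, y.\<close>

lemma split_commute:
  assumes "a \<noteq> 0" "b \<noteq> 0"
  shows "padic_split p a b \<longleftrightarrow> padic_split p b a"
  using assms split_imp_isotropic[OF p] isotropic_imp_split[OF p] isotropic_commute by blast

lemma split_mult_square_left:
  assumes "c \<noteq> 0"
  shows "padic_split p (a * c\<^sup>2) b \<longleftrightarrow> padic_split p a b"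
proof
  assume "padic_split p (a * c\<^sup>2) b"
  then obtain u v where uv: "u \<in> padic_cauchy p" "v \<in> padic_cauchy p"
    "(\<lambda>n. u n ^ 2 - a * c\<^sup>2 * v n ^ 2 - b) \<in> padic_null p"
    unfolding padic_split_def by blast
  show "padic_split p a b"
    unfolding padic_split_def
    by (rule bexI[OF _ uv(1)], rule bexI[of _ "\<lambda>n. c * v n"])
      (use uv in \<open>simp_all add: power_mult_distrib mult.assoc padic_cauchy_intros p\<close>)
next
  assume "padic_split p a b"
  then obtain u v where uv: "u \<in> padic_cauchy p" "v \<in> padic_cauchy p"
    "(\<lambda>n. u n ^ 2 - a * v n ^ 2 - b) \<in> padic_null p"
    unfolding padic_split_def by blast
  show "padic_split p (a * c\<^sup>2) b"
    unfolding padic_split_def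
    by (rule bexI[OF _ uv(1)], rule bexI[of _ "\<lambda>n. v n / c"])
      (use uv assms in \<open>simp_all add: power_divide padic_cauchy_intros p\<close>)
qed

lemma split_mult_square_right:
  assumes "c \<noteq> 0" "a \<noteq> 0" "b \<noteq> 0"
  shows "padic_split p a (b * c\<^sup>2) \<longleftrightarrow> padic_split p a b"
  using assms split_commute[of a "b * c\<^sup>2"] split_commute[of a b] split_mult_square_left[of c b a] by simp

text \<open>Both a and a b = x^2 - c have the form u^2 - c v^2, hence so does their
  quotient.\<close>

lemma split_of_norm_product:
  assumes ab: "a \<noteq> 0" "c \<noteq> 0" "a * b = x\<^sup>2 - c" and s: "padic_split p c a"
  shows "padic_split p c b"
proof -
  obtain u v where uv: "u \<in> padic_cauchy p" "v \<in> padic_cauchy p" and e: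
    "(\<lambda>n. u n ^ 2 - c * v n ^ 2 - a) \<in> padic_null p"
    using s unfolding padic_split_def by blast
  \<comment> \<open>Coordinates of (x + sqrt c)(u - v sqrt c)/a. This is the quotient of x + sqrt c
    by u + v sqrt c, with the norm of the divisor replaced by its limit a.\<close>
  define s w where "s = (\<lambda>n. (x * u n - c * v n) / a)" and "w = (\<lambda>n. (u n - x * v n) / a)"
  have C: "s \<in> padic_cauchy p" "w \<in> padic_cauchy p"
    unfolding s_def w_def by (intro padic_cauchy_intros p uv)+
  have eq: "s n ^ 2 - c * w n ^ 2 - b = (b / a) * (u n ^ 2 - c * v n ^ 2 - a)" for n
  proof -
    have "s n ^ 2 - c * w n ^ 2 = (x\<^sup>2 - c) * (u n ^ 2 - c * v n ^ 2) / a\<^sup>2"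
      unfolding s_def w_def by (simp add: power_divide diff_divide_distrib[symmetric]) (simp add:
        power2_eq_square algebra_simps)
    also have "\<dots> = (b / a) * (u n ^ 2 - c * v n ^ 2)"
      unfolding ab(3)[symmetric] using ab(1) by (simp add: power2_eq_square)
    finally show ?thesis using ab(1) by (simp add: right_diff_distrib)
  qed
  have "(\<lambda>n. s n ^ 2 - c * w n ^ 2 - b) \<in> padic_null p"
    unfolding eq by (rule padic_null_mult[OF p padic_cauchy_const e])
  then show ?thesis unfolding padic_split_def using C by blast
qed

section \<open>Hensel lifting of square roots\<close>

lemma padic_int_sequence:
  fixes y :: "nat \<Rightarrow> int"
  assumes step: "\<And>n. int p ^ n dvd y (Suc n) - y n" and sq: "\<And>n. int p ^ n dvd (y n)\<^sup>2 - c"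
  shows "(\<lambda>n. of_int (y n)) \<in> padic_cauchy p" "(\<lambda>n. (of_int (y n))\<^sup>2 - of_int c) \<in> padic_null p"
proof -
  have small: "\<exists>n0. \<forall>n\<ge>n0. 1 / real p ^ n < \<delta>" if "\<delta> > 0" for \<delta> :: real
  proof -
    have "real p > 1" using p prime_gt_1_nat by simp
    then have "(\<lambda>n. 1 / real p ^ n) \<longlonglongrightarrow> 0" by (rule LIMSEQ_divide_realpow_zero)
    then have "eventually (\<lambda>n. 1 / real p ^ n < \<delta>) sequentially" using that by (rule order_tendstoD)
    then show ?thesis by (simp add: eventually_sequentially)
  qed
  have dvd: "int p ^ n dvd y m - y n" if "n \<le> m" for n m
    using that
  proof (induction m rule: dec_induct)
    case (step m)
    have "int p ^ n dvd y (Suc m) - y m" using assms(1)[of m] step.hyps by (meson le_imp_power_dvd dvd_trans)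
    then show ?case using step.IH by (metis dvd_add diff_add_cancel add_diff_eq)
  qed simp
  show "(\<lambda>n. of_int (y n)) \<in> padic_cauchy p"
    unfolding padic_cauchy_iff
  proof (intro allI impI)
    fix \<delta> :: real assume "\<delta> > 0"
    then obtain n0 where n0: "1 / real p ^ n0 < \<delta>" using small by blast
    have "padic_abs p (of_int (y m) - of_int (y n)) < \<delta>" if "m \<ge> n0" "n \<ge> n0" for m n
    proof -
      have "int p ^ n0 dvd (y m - y n0) - (y n - y n0)" using dvd[OF that(1)] dvd[OF that(2)] by (rule dvd_diff)
      then have "int p ^ n0 dvd y m - y n" by simp
      from padic_abs_of_int_le[OF p this] show ?thesis using n0 by simp
    qed
    then show "\<exists>n0. \<forall>m\<ge>n0. \<forall>n\<ge>n0. padic_abs p (of_int (y m) - of_int (y n)) < \<delta>" by blast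
  qed
  have "padic_abs p ((of_int (y n))\<^sup>2 - of_int c) \<le> 1 / real p ^ n" for n
    using padic_abs_of_int_le[OF p sq[of n]] by simp
  then show "(\<lambda>n. (of_int (y n))\<^sup>2 - of_int c) \<in> padic_null p"
    unfolding padic_null_iff using small by (meson le_less_trans)
qed

lemma hensel_sqrt_odd:
  assumes odd: "p \<noteq> 2" and c: "\<not> int p dvd c" and y0: "int p dvd y0\<^sup>2 - c"
  shows "\<exists>s \<in> padic_cauchy p. (\<lambda>n. s n ^ 2 - of_int c) \<in> padic_null p"
proof -
  have step: "\<exists>y'. int p ^ Suc (Suc n) dvd y'\<^sup>2 - c \<and> int p ^ Suc n dvd y' - y"
    if y: "int p ^ Suc n dvd y\<^sup>2 - c" for n y
  proof -
    obtain k where k: "y\<^sup>2 - c = int p ^ Suc n * k" using y by (rule dvdE)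
    have "int p dvd y\<^sup>2 - c" using y by (metis dvd_trans dvd_triv_left power_Suc)
    then have "\<not> int p dvd y" using c by (metis dvd_diff_right_iff dvd_power pos2 dvd_trans)
    moreover have "\<not> int p dvd 2"
      using odd p by (metis int_dvd_int_iff of_nat_numeral primes_dvd_imp_eq two_is_prime_nat)
    ultimately have "coprime (2 * y) (int p)"
      using p by (metis coprime_commute prime_dvd_mult_iff prime_imp_coprime prime_nat_int_transfer)
    \<comment> \<open>Newton step: adding p^(n+1) m to y changes y^2 by 2 y m p^(n+1) to the next
      order, and 2 y is invertible modulo p because p is odd and divides neither c nor y.\<close>
    then obtain m where m: "[2 * y * m = - k] (mod int p)"
      by (metis cong_solve_coprime_int cong_scalar_right mult.assoc mult.left_neutral)
    then have pk: "int p dvd k + 2 * y * m"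
      by (simp add: cong_iff_dvd_diff add.commute)
    define y' where "y' = y + int p ^ Suc n * m"
    have "y'\<^sup>2 - c = int p ^ Suc n * (k + 2 * y * m) + int p ^ Suc n * int p ^ Suc n * m\<^sup>2"
      using k by (simp add: y'_def power2_eq_square algebra_simps)
    moreover have "int p ^ Suc (Suc n) dvd int p ^ Suc n * (k + 2 * y * m)"
      using pk by (simp add: mult.commute mult_dvd_mono)
    moreover have "int p ^ Suc (Suc n) dvd int p ^ Suc n * int p ^ Suc n * m\<^sup>2"
      unfolding power_add[symmetric] by (intro dvd_mult2 le_imp_power_dvd) simp
    ultimately have "int p ^ Suc (Suc n) dvd y'\<^sup>2 - c" by (metis dvd_add)
    then show ?thesis by (intro exI[of _ y']) (simp add: y'_def)
  qed
  have y0': "int p ^ Suc 0 dvd y0\<^sup>2 - c" using y0 by simp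
  obtain y where y: "\<And>n. int p ^ Suc n dvd (y n)\<^sup>2 - c" "\<And>n. int p ^ Suc n dvd y (Suc n) - y n"
    using dependent_nat_choice[of "\<lambda>n y. int p ^ Suc n dvd y\<^sup>2 - c" "\<lambda>n y y'. int p ^ Suc n dvd y' - y"]
      y0' step by blast
  have "int p ^ n dvd (y n)\<^sup>2 - c" "int p ^ n dvd y (Suc n) - y n" for n
    using y[of n] by (meson dvd_trans le_imp_power_dvd le_SucI order_refl)+
  from padic_int_sequence[OF this(2,1)] show ?thesis
    by (auto intro!: bexI[of _ "\<lambda>n. of_int (y n)"])
qed

text \<open>The derivative 2 y costs one power of 2, so a square root modulo 2^(n+3) is corrected by
  a multiple of 2^(n+2). The start is y = 1 modulo 8. Taking the quotient k itself as correction
  works because y is odd and k + y k is then even.\<close>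

lemma hensel_sqrt_2:
  assumes p2: "p = 2" and c: "c mod 8 = 1"
  shows "\<exists>s \<in> padic_cauchy p. (\<lambda>n. s n ^ 2 - of_int c) \<in> padic_null p"
proof -
  have step: "\<exists>y'. 2 ^ (Suc n + 3) dvd y'\<^sup>2 - c \<and> 2 ^ (n + 2) dvd y' - y"
    if y: "2 ^ (n + 3) dvd y\<^sup>2 - c" for n and y :: int
  proof -
    obtain k where k: "y\<^sup>2 - c = 2 ^ (n + 3) * k" using y by (rule dvdE)
    have "odd c" using c by presburger
    moreover have "even (y\<^sup>2 - c)" using k by simp
    ultimately have "odd y" by simp
    then have "even (k + y * k)" by simp
    then obtain j where j: "k + y * k = 2 * j" by (rule evenE)
    define y' where "y' = y + 2 ^ (n + 2) * k"
    have "y'\<^sup>2 - c = 2 ^ (n + 3) * (k + y * k) + 2 ^ (n + 2) * 2 ^ (n + 2) * k\<^sup>2"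
      using k by (simp add: y'_def power2_eq_square algebra_simps power_add)
    moreover have "2 ^ (Suc n + 3) dvd 2 ^ (n + 3) * (k + y * k)"
    proof -
      have "2 ^ (n + 3) * (2 * j) = 2 ^ (Suc n + 3) * j" by (simp add: power_add)
      then show ?thesis by (simp only: j dvd_triv_left)
    qed
    moreover have "(2::int) ^ (Suc n + 3) dvd 2 ^ (n + 2) * 2 ^ (n + 2) * k\<^sup>2"
      unfolding power_add[symmetric] by (intro dvd_mult2 le_imp_power_dvd) simp
    ultimately have "2 ^ (Suc n + 3) dvd y'\<^sup>2 - c" by (metis dvd_add)
    then show ?thesis by (intro exI[of _ y']) (simp add: y'_def)
  qed
  have base: "2 ^ (0 + 3) dvd (1::int)\<^sup>2 - c" using c by (simp add: mod_eq_dvd_iff[symmetric])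
  obtain y where y: "\<And>n. 2 ^ (n + 3) dvd (y n)\<^sup>2 - c" "\<And>n. 2 ^ (n + 2) dvd y (Suc n) - y n"
    using dependent_nat_choice[of "\<lambda>n y. 2 ^ (n + 3) dvd y\<^sup>2 - c" "\<lambda>n y y'. 2 ^ (n + 2) dvd y' - y"]
      base step by blast
  have "int p ^ n dvd (y n)\<^sup>2 - c" "int p ^ n dvd y (Suc n) - y n" for n
    using y[of n] unfolding p2 of_nat_numeral by (meson dvd_trans le_imp_power_dvd le_add1)+
  from padic_int_sequence[OF this(2,1)] show ?thesis
    by (auto intro!: bexI[of _ "\<lambda>n. of_int (y n)"])
qed

text \<open>Pigeonhole: u^2 and m + D v^2 each take (p + 1)/2 values modulo p as u and v run through
  0, ..., (p - 1)/2, so the two sets of values meet.\<close>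

lemma norm_residue_exists:
  assumes odd: "p \<noteq> 2" and D: "\<not> int p dvd D"
  shows "\<exists>u v. int p dvd u\<^sup>2 - D * v\<^sup>2 - m"
proof -
  let ?S = "{0..(int p - 1) div 2}"
  let ?f = "\<lambda>u. u\<^sup>2 mod int p" and ?g = "\<lambda>v. (m + D * v\<^sup>2) mod int p"
  have pp: "prime (int p)" using p by simp
  have "p > 2" using p odd prime_ge_2_nat[of p] by linarith
  have oddp: "odd p" using p odd prime_odd_nat[of p] prime_ge_2_nat[of p] by linarith
  then have half: "2 * ((int p - 1) div 2) = int p - 1" by (simp add: even_two_times_div_two)
  have eq: "u = v" if uv: "u \<in> ?S" "v \<in> ?S" and d: "int p dvd u\<^sup>2 - v\<^sup>2" for u v
  proof -
    have "int p dvd (u + v) * (u - v)" using d by (simp add: power2_eq_square algebra_simps)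
    then have "int p dvd u + v \<or> int p dvd u - v" using pp by (simp add: prime_dvd_mult_iff)
    moreover have "u + v < int p" "u + v \<ge> 0" "\<bar>u - v\<bar> < int p" using uv half by auto
    ultimately have "u + v = 0 \<or> u - v = 0"
      by (metis abs_of_nonneg dvd_imp_le_int not_less abs_of_nat)
    then show ?thesis using uv by auto
  qed
  have injf: "inj_on ?f ?S"
    by (rule inj_onI) (auto intro: eq simp: mod_eq_dvd_iff)
  have injg: "inj_on ?g ?S"
  proof (rule inj_onI)
    fix u v assume uv: "u \<in> ?S" "v \<in> ?S" "?g u = ?g v"
    then have "int p dvd D * (u\<^sup>2 - v\<^sup>2)" by (simp add: mod_eq_dvd_iff algebra_simps)
    then have "int p dvd u\<^sup>2 - v\<^sup>2" using D pp by (simp add: prime_dvd_mult_iff)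
    then show "u = v" using eq uv by blast
  qed
  have sub: "?f ` ?S \<union> ?g ` ?S \<subseteq> {0..<int p}" using \<open>p > 2\<close> by auto
  have "?f ` ?S \<inter> ?g ` ?S \<noteq> {}"
  proof
    assume "?f ` ?S \<inter> ?g ` ?S = {}"
    then have "card (?f ` ?S \<union> ?g ` ?S) = card (?f ` ?S) + card (?g ` ?S)"
      by (intro card_Un_disjoint) auto
    also have "\<dots> = 2 * nat ((int p - 1) div 2 + 1)"
      by (simp add: card_image injf injg)
    also have "\<dots> = p + 1" using half by linarith
    finally have "p + 1 \<le> card {0..<int p}" using card_mono[OF _ sub] by simp
    then show False by simp
  qed
  then obtain u v where "?f u = ?g v" by blast
  then have "int p dvd u\<^sup>2 - (m + D * v\<^sup>2)" by (simp add: mod_eq_dvd_iff)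
  then show ?thesis by (intro exI[of _ u] exI[of _ v]) (simp add: algebra_simps)
qed

text \<open>One coordinate of the norm equation is fixed as the integer v and the other obtained as
  a square root: either s^2 = m + D v^2, with v in second place, or s^2 = D (v^2 - m), which solves
  v^2 - D (s/D)^2 = m.\<close>

lemma split_of_sqrt:
  assumes D: "D \<noteq> 0"
    and s: "(\<exists>s \<in> padic_cauchy p. (\<lambda>n. s n ^ 2 - of_int (m + D * v\<^sup>2)) \<in> padic_null p) \<or>
      (\<exists>s \<in> padic_cauchy p. (\<lambda>n. s n ^ 2 - of_int (D * (v\<^sup>2 - m))) \<in> padic_null p)"
  shows "padic_split p (of_int D) (of_int m)"
  using s
proof (elim disjE bexE)
  fix s assume s: "s \<in> padic_cauchy p" "(\<lambda>n. s n ^ 2 - of_int (m + D * v\<^sup>2)) \<in> padic_null p"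
  show ?thesis unfolding padic_split_def
    by (rule bexI[OF _ s(1)], rule bexI[OF _ padic_cauchy_const[of "of_int v"]])
      (use s(2) in \<open>simp add: algebra_simps\<close>)
next
  fix s assume s: "s \<in> padic_cauchy p" "(\<lambda>n. s n ^ 2 - of_int (D * (v\<^sup>2 - m))) \<in> padic_null p"
  have "(of_int v)\<^sup>2 - of_int D * (s n / of_int D)\<^sup>2 - of_int m = (- 1 / of_int D) * (s n ^ 2 - of_int (D * (v\<^sup>2
    - m)))" for n
    using D by (simp add: field_simps power2_eq_square)
  then have "(\<lambda>n. (of_int v)\<^sup>2 - of_int D * (s n / of_int D)\<^sup>2 - of_int m) \<in> padic_null p"
    using padic_null_mult[OF p padic_cauchy_const[of "- 1 / of_int D"] s(2)] by simp
  then show ?thesis unfolding padic_split_def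
    by (intro bexI[OF _ padic_cauchy_const[of "of_int v"]] bexI[of _
      "\<lambda>n. s n / of_int D"] padic_cauchy_intros p s)
qed

lemma split_units:
  assumes D: "\<not> int p dvd D" and m: "\<not> int p dvd m" and D2: "p = 2 \<Longrightarrow> D mod 4 = 1"
  shows "padic_split p (of_int D) (of_int m)"
proof (cases "p = 2")
  case False
  have pp: "prime (int p)" using p by simp
  obtain u v where uv: "int p dvd u\<^sup>2 - D * v\<^sup>2 - m" using norm_residue_exists[OF False D] by blast
  show ?thesis
  proof (cases "int p dvd m + D * v\<^sup>2")
    case unit: False
    have "int p dvd u\<^sup>2 - (m + D * v\<^sup>2)" using uv by (simp add: algebra_simps)
    from hensel_sqrt_odd[OF False unit this] show ?thesis
      using split_of_sqrt[of D m v] D by blast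
  next
    case True
    \<comment> \<open>Here u vanishes modulo p and cannot be lifted. But then -m is D v^2 modulo p,
      so -D m is the square of D v modulo p and a unit.\<close>
    have "D * (0\<^sup>2 - m) = (D * v)\<^sup>2 - D * (m + D * v\<^sup>2)" by (simp add: power2_eq_square algebra_simps)
    then have "int p dvd (D * v)\<^sup>2 - D * (0\<^sup>2 - m)" using True by simp
    moreover have "\<not> int p dvd D * (0\<^sup>2 - m)" using D m pp by (simp add: prime_dvd_mult_iff)
    ultimately have "\<exists>s \<in> padic_cauchy p. (\<lambda>n. s n ^ 2 - of_int (D * (0\<^sup>2 - m))) \<in> padic_null p"
      using hensel_sqrt_odd[OF False] by blast
    then show ?thesis using split_of_sqrt[of D m 0] D by blast
  qed
next
  case True
  have "odd m" using m True by simp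
  then have m8: "m mod 8 = 1 \<or> m mod 8 = 3 \<or> m mod 8 = 5 \<or> m mod 8 = 7" by presburger
  have D8: "D mod 8 = 1 \<or> D mod 8 = 5" using D2[OF True] by presburger
  \<comment> \<open>By inspection of the residues modulo 8, some v among 0, 1, 2 makes one of the
    two radicands of \<open>split_of_sqrt\<close> congruent to 1.\<close>
  obtain v where "(m + D * v\<^sup>2) mod 8 = 1 \<or> (D * (v\<^sup>2 - m)) mod 8 = 1"
  proof -
    have 1: "(m + D * v\<^sup>2) mod 8 = (m mod 8 + (D mod 8) * v\<^sup>2) mod 8"
      "(D * (v\<^sup>2 - m)) mod 8 = ((D mod 8) * (v\<^sup>2 - m mod 8)) mod 8" for v
      by (intro mod_add_cong mod_mult_cong mod_diff_cong; simp)+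
    have "\<exists>v. (m0 + D0 * v\<^sup>2) mod 8 = 1 \<or> (D0 * (v\<^sup>2 - m0)) mod 8 = 1"
      if "m0 = 1 \<or> m0 = 3 \<or> m0 = 5 \<or> m0 = 7" "D0 = 1 \<or> D0 = 5" for m0 D0 :: int
      using that by (auto intro: exI[of _ 0] exI[of _ 1] exI[of _ 2])
    from this[OF m8 D8] show thesis using that unfolding 1 by blast
  qed
  then show ?thesis using hensel_sqrt_2[OF True] split_of_sqrt[of D m v] D by blast
qed

text \<open>Descent: a common factor p of a and b contributes p^2. Once there is none, the
  multiplicity is 0 for odd p because D is not a square modulo p, and 0 or 2 for p = 2.\<close>

lemma even_multiplicity_norm:
  assumes D: "\<not> int p dvd D" and kr: "kronecker D p = -1" and D2: "p = 2 \<Longrightarrow> D mod 4 = 1"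
    and nz: "a\<^sup>2 - D * b\<^sup>2 \<noteq> 0"
  shows "even (multiplicity (int p) (a\<^sup>2 - D * b\<^sup>2))"
  using nz
proof (induction "nat (\<bar>a\<bar> + \<bar>b\<bar>)" arbitrary: a b rule: less_induct)
  case less
  have pp: "prime (int p)" using p by simp
  show ?case
  proof (cases "int p dvd a \<and> int p dvd b")
    case True
    then obtain a' b' where ab: "a = int p * a'" "b = int p * b'" unfolding dvd_def by blast
    have eq: "a\<^sup>2 - D * b\<^sup>2 = int p * (int p * (a'\<^sup>2 - D * b'\<^sup>2))"
      by (simp add: ab power2_eq_square algebra_simps)
    then have nz': "a'\<^sup>2 - D * b'\<^sup>2 \<noteq> 0" using less.prems by auto
    have p2: "int p \<ge> 2" using p prime_ge_2_nat by fastforce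
    have "a' \<noteq> 0 \<or> b' \<noteq> 0" using nz' by auto
    then have "\<bar>a'\<bar> + \<bar>b'\<bar> < int p * (\<bar>a'\<bar> + \<bar>b'\<bar>)" using p2 by (intro mult_less_cancel_right1[THEN iffD2]) auto
    then have "nat (\<bar>a'\<bar> + \<bar>b'\<bar>) < nat (\<bar>a\<bar> + \<bar>b\<bar>)" by (simp add: ab abs_mult distrib_left)
    from less.hyps[OF this nz'] show ?thesis
      using p2 nz' p unfolding eq by (simp add: multiplicity_times_same)
  next
    case False
    show ?thesis
    proof (cases "p = 2")
      case False': False
      have "\<not> int p dvd a\<^sup>2 - D * b\<^sup>2"
      proof
        assume d: "int p dvd a\<^sup>2 - D * b\<^sup>2"
        have nb: "\<not> int p dvd b"
        proof
          assume b: "int p dvd b"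
          then have "int p dvd D * b\<^sup>2" by (simp add: power2_eq_square)
          then have "int p dvd a\<^sup>2" using d by (metis dvd_diff_left_iff)
          then show False using False b pp by (simp add: prime_dvd_power_iff)
        qed
        then have "coprime b (int p)" using pp by (metis coprime_commute prime_imp_coprime)
        then obtain c where c: "[b * c = 1] (mod int p)" using cong_solve_coprime_int by blast
        have "[a\<^sup>2 = D * b\<^sup>2] (mod int p)" using d by (simp add: cong_iff_dvd_diff)
        then have "[a\<^sup>2 * c\<^sup>2 = D * b\<^sup>2 * c\<^sup>2] (mod int p)" by (rule cong_scalar_right)
        moreover have "[D * (b * c)\<^sup>2 = D * 1\<^sup>2] (mod int p)" using c by (intro cong_scalar_left cong_pow)
        ultimately have "[(a * c)\<^sup>2 = D] (mod int p)"
          by (simp add: power_mult_distrib mult.assoc) (metis cong_trans)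
        then have "QuadRes (int p) D" unfolding QuadRes_def by blast
        then show False using kr False' by (simp add: kronecker_def Legendre_def split: if_splits)
      qed
      then show ?thesis by (simp add: not_dvd_imp_multiplicity_0)
    next
      case True
      \<comment> \<open>The symbol -1 at 2 means 3 or 5 modulo 8, and D is 1 modulo 4.\<close>
      have D8: "D mod 8 = 5"
        using kr D2[OF True] True unfolding kronecker_def by (simp split: if_splits) presburger
      show ?thesis
      proof (cases "even a \<or> even b")
        case eo: True
        then have "odd (a\<^sup>2 - D * b\<^sup>2)" using False D8 True by (auto; presburger)
        then show ?thesis using True by (simp add: not_dvd_imp_multiplicity_0)
      next
        case False
        obtain k l where kl: "a = 2 * k + 1" "b = 2 * l + 1" using False by (auto elim!: oddE)
        obtain d where d: "D = 8 * d + 5" using D8 by (metis mult_div_mod_eq)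
        have "even (k * (k + 1))" "even (l * (l + 1))" by auto
        then obtain k' l' where k': "k * (k + 1) = 2 * k'" "l * (l + 1) = 2 * l'" by (meson evenE)
        have a2: "a\<^sup>2 = 8 * k' + 1" and b2: "b\<^sup>2 = 8 * l' + 1"
          using k' unfolding kl by (simp_all add: power2_eq_square algebra_simps)
        \<comment> \<open>Odd squares are 1 modulo 8, so the value is 1 - 5 = 4 modulo 8 and has
          multiplicity exactly 2.\<close>
        have eq: "a\<^sup>2 - D * b\<^sup>2 = 2 * (2 * (2 * (k' - 5 * l' - 8 * d * l' - d) - 1))"
          unfolding a2 b2 d by (simp add: algebra_simps)
        have mult: "multiplicity 2 (2 * (2 * q)) = 2" if "odd q" for q :: int
        proof -
          have "q \<noteq> 0" using that by auto
          then have "multiplicity 2 (2 * q) = Suc (multiplicity 2 q)"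
            "multiplicity 2 (2 * (2 * q)) = Suc (multiplicity 2 (2 * q))"
            by (intro multiplicity_times_same; simp)+
          then show ?thesis using that by (simp add: not_dvd_imp_multiplicity_0)
        qed
        show ?thesis unfolding eq True of_nat_numeral by (subst mult) simp_all
      qed
    qed
  qed
qed

text \<open>A rational value u^2 - D v^2 close enough to b has the valuation of b by the ultrametric
  inequality; cleared of a square denominator it is an integral norm, whose multiplicity is
  even.\<close>

lemma not_split_of_odd_val:
  assumes D: "\<not> int p dvd D" and kr: "kronecker D p = -1" and D2: "p = 2 \<Longrightarrow> D mod 4 = 1"
    and b: "b \<noteq> 0" "odd (padic_val p b)"
  shows "\<not> padic_split p (of_int D) b"
proof
  assume "padic_split p (of_int D) b"
  then obtain u v where uv: "u \<in> padic_cauchy p" "v \<in> padic_cauchy p"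
    "(\<lambda>n. u n ^ 2 - of_int D * v n ^ 2 - b) \<in> padic_null p"
    unfolding padic_split_def by blast
  have pb: "padic_abs p b > 0" using b(1) padic_abs_eq_0_iff[OF p, of b] padic_abs_nonneg[of p b] by linarith
  then obtain n where n: "padic_abs p (u n ^ 2 - of_int D * v n ^ 2 - b) < padic_abs p b"
    using uv(3) unfolding padic_null_iff by blast
  let ?N = "u n ^ 2 - of_int D * v n ^ 2"
  have le: "padic_abs p ?N \<le> padic_abs p b"
    using padic_abs_add_max[OF p, of "?N - b" b] n by simp
  have "padic_abs p b \<le> max (padic_abs p (b - ?N)) (padic_abs p ?N)"
    using padic_abs_add_max[OF p, of "b - ?N" ?N] by simp
  then have abs: "padic_abs p ?N = padic_abs p b"
    using n le padic_abs_minus_commute[of p b ?N] by linarith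
  then have N0: "?N \<noteq> 0" using pb by auto
  have p1: "real p > 1" using p prime_gt_1_nat by simp
  have "padic_val p ?N = padic_val p b"
    using abs N0 b(1) power_int_strict_increasing[OF _ p1, of "- padic_val p ?N" "- padic_val p b"]
      power_int_strict_increasing[OF _ p1, of "- padic_val p b" "- padic_val p ?N"]
    by (cases "padic_val p ?N" "padic_val p b" rule: linorder_cases) (auto simp: padic_abs_def)
  moreover obtain k l d where kld: "d > 0" "u n = of_int k / of_int d" "v n = of_int l / of_int d"
    by (rule rat_common_denominator)
  have N: "?N = of_int (k\<^sup>2 - D * l\<^sup>2) / of_int (d\<^sup>2)"
    unfolding kld by (simp add: power_divide diff_divide_distrib)
  have nz: "k\<^sup>2 - D * l\<^sup>2 \<noteq> 0"
  proof
    assume "k\<^sup>2 - D * l\<^sup>2 = 0"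
    then have "?N = 0" unfolding N by (simp del: of_int_diff)
    then show False using N0 by blast
  qed
  have "padic_val p ?N = int (multiplicity (int p) (k\<^sup>2 - D * l\<^sup>2)) - int (multiplicity (int p) (d\<^sup>2))"
    unfolding N using nz kld(1) by (intro padic_val_divide[OF p]) auto
  moreover have "even (multiplicity (int p) (d\<^sup>2))"
    using kld(1) p by (simp add: prime_elem_multiplicity_power_distrib)
  moreover have "even (multiplicity (int p) (k\<^sup>2 - D * l\<^sup>2))"
    by (rule even_multiplicity_norm[OF D kr D2 nz])
  ultimately have "even (padic_val p b)" by (metis dvd_diff even_of_nat)
  then show False using b(2) by blast
qed

text \<open>If the symbol is -1 and the multiplicity even, removing an even power of p leaves a
  unit, which is a norm. If the symbol is 1, F is a square in Q_p and everything is a norm.\<close>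

lemma split_unramified_iff:
  assumes F: "\<not> int p dvd F" and F2: "p = 2 \<Longrightarrow> F mod 4 = 1" and M: "M \<noteq> 0"
  shows "padic_split p (of_int F) (of_int M) \<longleftrightarrow> \<not> (kronecker F p = -1 \<and> odd (multiplicity (int p) M))"
proof (cases "kronecker F p = -1")
  case kr: True
  show ?thesis
  proof (cases "even (multiplicity (int p) M)")
    case True
    then obtain l where l: "multiplicity (int p) M = l * 2" by (metis evenE mult.commute)
    obtain m where m: "M = int p ^ multiplicity (int p) M * m" "\<not> int p dvd m"
      using M p by (rule_tac multiplicity_decompose'[of M "int p"]) auto
    have "(of_int M :: rat) = of_int m * (of_nat p ^ l)\<^sup>2"
      by (subst m(1)) (simp add: l power_mult mult.commute)
    moreover have "(of_nat p ^ l :: rat) \<noteq> 0" using p prime_gt_0_nat by auto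
    moreover have "F \<noteq> 0" "m \<noteq> 0" using F m by auto
    ultimately show ?thesis
      using split_units[OF F m(2) F2] True by (simp add: split_mult_square_right)
  next
    case False
    have "padic_val p (of_int M) = int (multiplicity (int p) M)"
      using padic_val_divide[OF p M, of 1] by simp
    then show ?thesis using not_split_of_odd_val[OF F kr F2, of "of_int M"] False kr M by simp
  qed
next
  case False
  have "\<exists>s \<in> padic_cauchy p. (\<lambda>n. s n ^ 2 - of_int F) \<in> padic_null p"
  proof (cases "p = 2")
    case True
    \<comment> \<open>Of the residues 1 and 7 with symbol 1 at 2, only the first is 1 modulo
      4.\<close>
    have "F mod 8 = 1"
      using False F2[OF True] F True unfolding kronecker_def by (simp split: if_splits) presburger
    then show ?thesis using hensel_sqrt_2[OF True] by blast
  next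
    case odd: False
    have "QuadRes (int p) F"
      using False odd F by (auto simp: kronecker_def Legendre_def cong_0_iff split: if_splits)
    then obtain y where "int p dvd y\<^sup>2 - F" unfolding QuadRes_def by (auto simp: cong_iff_dvd_diff)
    then show ?thesis using hensel_sqrt_odd[OF odd F] by blast
  qed
  then have "padic_split p (of_int M) (of_int F)" using split_of_square by blast
  moreover have "F \<noteq> 0" using F by auto
  ultimately show ?thesis using False split_commute[of "of_int F" "of_int M"] M by simp
qed

end

section \<open>Ramified primes\<close>

lemma kronecker_unit: "\<not> int p dvd a \<Longrightarrow> kronecker a p = 1 \<or> kronecker a p = -1"
  by (auto simp: kronecker_def Legendre_def cong_0_iff)

lemma kronecker_dvd: "int p dvd a \<Longrightarrow> kronecker a p = 0"
  by (auto simp: kronecker_def Legendre_def cong_0_iff)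

text \<open>Used to show that the ramified primes away from N lie in the domain of \<epsilon>. At 2
  both factors are 5 modulo 8 and 5 * 5 is 1 modulo 8; at odd p Euler's criterion gives
  multiplicativity.\<close>

lemma kronecker_mult_not_minus_one:
  assumes p: "prime p" and a: "kronecker a p = -1" "p = 2 \<Longrightarrow> a mod 4 = 1"
    and b: "kronecker b p = -1" "p = 2 \<Longrightarrow> b mod 4 = 1"
  shows "kronecker (a * b) p \<noteq> -1"
proof (cases "p = 2")
  case True
  have *: "c mod 8 = 5" if "kronecker c p = -1" "c mod 4 = 1" for c
    using that True unfolding kronecker_def by (simp split: if_splits) presburger
  have "a mod 8 = 5" "b mod 8 = 5" using * a b True by auto
  then have "(a * b) mod 8 = 1" using mod_mult_eq[of a 8 b] by simp
  then show ?thesis using True by (simp add: kronecker_def)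
next
  case False
  have p2: "2 < p" using p False prime_ge_2_nat[of p] by linarith
  have L: "Legendre a (int p) = -1" "Legendre b (int p) = -1"
    using a b False by (auto simp: kronecker_def)
  have "[a ^ ((p - 1) div 2) * b ^ ((p - 1) div 2) = (-1) * (-1)] (mod int p)"
    using euler_criterion[OF p p2, of a] euler_criterion[OF p p2, of b] unfolding L
    by (intro cong_mult) (simp_all add: cong_sym)
  then have "[Legendre (a * b) (int p) = 1] (mod int p)"
    using euler_criterion[OF p p2, of "a * b"] by (simp add: power_mult_distrib) (metis cong_trans)
  then have "int p dvd Legendre (a * b) (int p) - 1" by (simp add: cong_iff_dvd_diff)
  moreover have "\<not> int p dvd - 1 - 1" using p2 zdvd_imp_le[of "int p" 2] by auto
  ultimately have "Legendre (a * b) (int p) \<noteq> -1" by metis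
  then show ?thesis using False by (simp add: kronecker_def)
qed

section \<open>The cofactor N' and multiplicities of primes\<close>

lemma cofactor_multiplicity:
  assumes M: "M \<noteq> 0" and n: "int n dvd M" "coprime (M div int n) N"
    and p: "prime p" "int p dvd N"
  shows "multiplicity (int p) (int n) = multiplicity (int p) M"
proof -
  have Mn: "M = int n * (M div int n)" using n(1) by simp
  have "\<not> int p dvd M div int n"
  proof
    assume "int p dvd M div int n"
    then have "is_unit (int p)" using n(2) p(2) by (rule_tac coprime_common_divisor[of "M div int n" N]) auto
    then show False using p(1) by auto
  qed
  then have "multiplicity (int p) (M div int n) = 0" by (rule not_dvd_imp_multiplicity_0)
  moreover have "int n \<noteq> 0" "M div int n \<noteq> 0" using Mn M by (metis mult_zero_left, metis mult_zero_right)
  moreover have "multiplicity (int p) M = multiplicity (int p) (int n * (M div int n))"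
    using Mn by (rule arg_cong)
  ultimately show ?thesis
    using p(1) prime_elem_multiplicity_mult_distrib[of "int p" "int n" "M div int n"] by simp
qed

lemma multiplicity_int_nat: "prime p \<Longrightarrow> multiplicity (int p) (int n) = multiplicity p n"
proof (cases "n = 0")
  case False
  assume p: "prime p"
  have dvd: "int p ^ k dvd int n \<longleftrightarrow> k \<le> multiplicity p n" for k
  proof -
    have "int p ^ k dvd int n \<longleftrightarrow> p ^ k dvd n" by (simp flip: of_nat_power)
    also have "\<dots> \<longleftrightarrow> k \<le> multiplicity p n"
      using False p by (intro power_dvd_iff_le_multiplicity) auto
    finally show ?thesis .
  qed
  show ?thesis by (rule multiplicity_eqI) (simp_all only: dvd order_refl Suc_n_not_le_n not_False_eq_True)
qed simp

lemma finite_prime_dvd_int: "M \<noteq> 0 \<Longrightarrow> finite {p. prime p \<and> int p dvd M}"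
proof -
  assume "M \<noteq> 0"
  then have "finite {p. p dvd nat \<bar>M\<bar>}" by (intro finite_divisors_nat) simp
  moreover have "{p. prime p \<and> int p dvd M} \<subseteq> {p. p dvd nat \<bar>M\<bar>}" by (auto simp: nat_dvd_iff)
  ultimately show ?thesis by (rule finite_subset[rotated])
qed

lemma multiplicity_nat_abs: "prime q \<Longrightarrow> multiplicity (int q) M = multiplicity q (nat \<bar>M\<bar>)"
  using multiplicity_int_nat[of q "nat \<bar>M\<bar>"] by (simp add: abs_if split: if_splits)

text \<open>Any n competing for the minimum must absorb the full power in M of each prime dividing
  N. It is thus a multiple of the displayed product, so minimality in size agrees with minimality
  for divisibility.\<close>

lemma least_cofactor_eq:
  assumes M: "M \<noteq> 0" and L: "L = (LEAST n. n > 0 \<and> int n dvd M \<and> coprime (M div int n) N)"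
  shows "L = (\<Prod>p | prime p \<and> int p dvd M \<and> int p dvd N. p ^ multiplicity (int p) M)"
    and "int L dvd M" and "coprime (M div int L) N"
proof -
  define S where "S = {p. prime p \<and> int p dvd M \<and> int p dvd N}"
  define n0 where "n0 = (\<Prod>p\<in>S. p ^ multiplicity (int p) M)"
  have fin: "finite S" unfolding S_def by (rule finite_subset[OF _ finite_prime_dvd_int[OF M]]) blast
  have S: "prime p" if "p \<in> S" for p using that by (simp add: S_def)
  have pos: "n0 > 0" unfolding n0_def using S prime_gt_0_nat by (intro prod_pos) auto
  have mult: "multiplicity q n0 = (if q \<in> S then multiplicity (int q) M else 0)" if "prime q" for q
    unfolding n0_def by (rule multiplicity_prod_prime_powers[OF fin S that])
  have "n0 dvd nat \<bar>M\<bar>"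
  proof (rule multiplicity_le_imp_dvd)
    show "multiplicity q n0 \<le> multiplicity q (nat \<bar>M\<bar>)" if "prime q" for q
      using mult[OF that] multiplicity_nat_abs[OF that, of M] by simp
  qed (use pos in simp)
  then have dvd: "int n0 dvd M" by (simp add: nat_abs_dvd_iff dvd_nat_abs_iff)
  have cop: "coprime (M div int n0) N"
  proof (rule ccontr)
    assume nc: "\<not> coprime (M div int n0) N"
    have Mn: "M = int n0 * (M div int n0)" using dvd by simp
    have nz: "int n0 \<noteq> 0" "M div int n0 \<noteq> 0" using Mn M by (metis mult_zero_left, metis mult_zero_right)
    have "gcd (M div int n0) N \<noteq> 0" using nz(2) by simp
    moreover have "\<not> is_unit (gcd (M div int n0) N)"
      using nc by (simp only: is_unit_gcd not_False_eq_True)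
    ultimately obtain r where r: "r dvd gcd (M div int n0) N" "prime r" using prime_divisor_exists by blast
    define q where "q = nat r"
    have rq: "r = int q" using r(2) prime_gt_0_int[of r] by (simp add: q_def)
    have q: "prime q" "int q dvd M div int n0" "int q dvd N"
      using r unfolding rq by simp_all
    have "int q dvd int n0 * (M div int n0)" using q(2) by (rule dvd_mult)
    then have "int q dvd M" using Mn by simp
    then have "multiplicity (int q) (int n0) = multiplicity (int q) M"
      using mult[OF q(1)] q multiplicity_int_nat[OF q(1)] by (simp add: S_def)
    moreover have "multiplicity (int q) M = multiplicity (int q) (int n0 * (M div int n0))"
      using Mn by (rule arg_cong)
    moreover have "multiplicity (int q) (int n0 * (M div int n0)) = multiplicity (int q) (int n0) + multiplicity
      (int q) (M div int n0)"
      by (rule prime_elem_multiplicity_mult_distrib) (use q(1) nz in simp_all)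
    ultimately have "multiplicity (int q) (M div int n0) = 0" by linarith
    moreover have "multiplicity (int q) (M div int n0) > 0"
      using q nz by (intro prime_multiplicity_gt_zero_iff[THEN iffD2]) auto
    ultimately show False by simp
  qed
  have Ln0: "L = n0"
    unfolding L
  proof (rule Least_equality)
    show "n0 > 0 \<and> int n0 dvd M \<and> coprime (M div int n0) N" using pos dvd cop by blast
    fix n assume n: "n > 0 \<and> int n dvd M \<and> coprime (M div int n) N"
    have "n0 dvd n"
    proof (rule multiplicity_le_imp_dvd)
      fix q :: nat assume q: "prime q"
      show "multiplicity q n0 \<le> multiplicity q n"
      proof (cases "q \<in> S")
        case True
        then have "multiplicity (int q) (int n) = multiplicity (int q) M"
          using n by (intro cofactor_multiplicity[OF M]) (auto simp: S_def)
        then show ?thesis using mult[OF q] True multiplicity_int_nat[OF q, of n] by simp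
      qed (simp add: mult[OF q])
    qed (use pos in simp)
    then show "n0 \<le> n" using n by (intro dvd_imp_le) auto
  qed
  show "L = (\<Prod>p | prime p \<and> int p dvd M \<and> int p dvd N. p ^ multiplicity (int p) M)"
    unfolding Ln0 n0_def S_def ..
  show "int L dvd M" "coprime (M div int L) N" unfolding Ln0 using dvd cop by auto
qed

lemma coefficients_nonzero:
  assumes adm: "admissible D1 D2 x"
  shows "(of_int D1 :: rat) \<noteq> 0" "(of_int (x\<^sup>2 - D1 * D2) :: rat) \<noteq> 0"
proof -
  have "D1 \<noteq> 0" "x\<^sup>2 - D1 * D2 \<noteq> 0" using adm unfolding admissible_def by auto
  then show "(of_int D1 :: rat) \<noteq> 0" "(of_int (x\<^sup>2 - D1 * D2) :: rat) \<noteq> 0"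
    by (simp_all only: of_int_eq_0_iff not_False_eq_True)
qed

section \<open>Local behaviour of the algebra of an admissible triple\<close>

context
  fixes D1 D2 x M :: int
  assumes adm: "admissible D1 D2 x" and M: "M = (D1 * D2 - x\<^sup>2) div 4"
begin

text \<open>Modulo 4 the product D1 D2 is 0 or 1, so it is determined by its parity, which is that
  of x; hence it agrees with x^2.\<close>

lemma four_times_quotient: "4 * M = D1 * D2 - x\<^sup>2"
proof -
  have d: "D1 mod 4 = 0 \<or> D1 mod 4 = 1" "D2 mod 4 = 0 \<or> D2 mod 4 = 1" "even (x - D1 * D2)"
    using adm by (auto simp: admissible_def is_discriminant_def Cong.cong_def mod_eq_dvd_iff)
  have prod: "(D1 * D2) mod 4 = (D1 mod 4 * (D2 mod 4)) mod 4" by (simp add: mod_mult_eq)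
  then have "(D1 * D2) mod 4 = 0 \<or> (D1 * D2) mod 4 = 1" using d by auto
  then have "(D1 * D2) mod 4 = (if even x then 0 else 1)"
    using d(3) by (cases "even x") presburger+
  then have "(D1 * D2) mod 4 = x\<^sup>2 mod 4" by (simp add: square_mod_4)
  then have "4 dvd D1 * D2 - x\<^sup>2" by (simp add: mod_eq_dvd_iff)
  then show ?thesis using M by simp
qed

lemma quotient_nonzero: "M \<noteq> 0"
  using four_times_quotient adm by (auto simp: admissible_def)

lemma split_iff_fund_disc:
  assumes p: "prime p"
  shows "padic_split p (of_int D1) (of_int (x\<^sup>2 - D1 * D2)) \<longleftrightarrow> padic_split p (of_int (fund_disc D1)) (of_int (-
    M))"
    and "padic_split p (of_int D1) (of_int (x\<^sup>2 - D1 * D2)) \<longleftrightarrow> padic_split p (of_int (fund_disc D2)) (of_int (-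
      M))"
proof -
  have D: "is_discriminant D1" "is_discriminant D2" "D1 > 0" "D2 > 0" using adm by (auto simp: admissible_def)
  obtain g1 where g1: "D1 = g1\<^sup>2 * fund_disc D1" using fund_disc_properties[OF D(1)] by blast
  obtain g2 where g2: "D2 = g2\<^sup>2 * fund_disc D2" using fund_disc_properties[OF D(2)] by blast
  have nz: "g1 \<noteq> 0" "g2 \<noteq> 0" "fund_disc D1 \<noteq> 0" "fund_disc D2 \<noteq> 0"
  proof -
    have "g1\<^sup>2 * fund_disc D1 > 0" "g2\<^sup>2 * fund_disc D2 > 0" using D(3,4) g1 g2 by linarith+
    then show "g1 \<noteq> 0" "g2 \<noteq> 0" "fund_disc D1 \<noteq> 0" "fund_disc D2 \<noteq> 0" by auto
  qed
  have D1_eq: "(of_int D1 :: rat) = of_int (fund_disc D1) * (of_int g1)\<^sup>2"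
    using arg_cong[OF g1, of "of_int :: int \<Rightarrow> rat"] by (simp add: mult.commute)
  have D2_eq: "(of_int D2 :: rat) = of_int (fund_disc D2) * (of_int g2)\<^sup>2"
    using arg_cong[OF g2, of "of_int :: int \<Rightarrow> rat"] by (simp add: mult.commute)
  define c :: rat where "c = of_int (x\<^sup>2 - D1 * D2)"
  have c: "c = of_int (- M) * 2\<^sup>2" and c': "c = (of_int x)\<^sup>2 - of_int D1 * of_int D2"
    using arg_cong[OF four_times_quotient, of "of_int :: int \<Rightarrow> rat"] unfolding c_def by simp_all
  have c0: "c \<noteq> 0" using c quotient_nonzero by simp
  have E1: "padic_split p (of_int D1) c \<longleftrightarrow> padic_split p (of_int (fund_disc D1)) (of_int (- M))"
    unfolding c D1_eq using split_mult_square_left[OF p, of "of_int g1" "of_int (fund_disc D1)"]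
      split_mult_square_right[OF p, of 2 "of_int (fund_disc D1)" "of_int (- M)"] nz quotient_nonzero by simp
  have E2: "padic_split p (of_int D2) c \<longleftrightarrow> padic_split p (of_int (fund_disc D2)) (of_int (- M))"
    unfolding c D2_eq using split_mult_square_left[OF p, of "of_int g2" "of_int (fund_disc D2)"]
      split_mult_square_right[OF p, of 2 "of_int (fund_disc D2)" "of_int (- M)"] nz quotient_nonzero by simp
  have prod: "of_int D1 * of_int D2 = (of_int x)\<^sup>2 - c" "of_int D2 * of_int D1 = (of_int x)\<^sup>2 - c"
    using c' by simp_all
  have D0: "(of_int D1 :: rat) \<noteq> 0" "(of_int D2 :: rat) \<noteq> 0" using D by simp_all
  \<comment> \<open>After exchanging the arguments, the claim is that D1 has the form u^2 - c v^2
    iff D2 has. Their product x^2 - c is visibly of this form.\<close>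
  have E3: "padic_split p (of_int D1) c \<longleftrightarrow> padic_split p (of_int D2) c"
    unfolding split_commute[OF p D0(1) c0] split_commute[OF p D0(2) c0]
    using split_of_norm_product[OF p D0(1) c0 prod(1)] split_of_norm_product[OF p D0(2) c0 prod(2)] by blast
  show "padic_split p (of_int D1) (of_int (x\<^sup>2 - D1 * D2)) \<longleftrightarrow> padic_split p (of_int (fund_disc D1)) (of_int (-
    M))"
    and "padic_split p (of_int D1) (of_int (x\<^sup>2 - D1 * D2)) \<longleftrightarrow> padic_split p (of_int (fund_disc D2)) (of_int (-
      M))"
    unfolding c_def[symmetric] using E1 E2 E3 by auto
qed

lemma split_iff_kronecker:
  assumes p: "prime p"
  shows "\<not> int p dvd fund_disc D1 \<Longrightarrow> padic_split p (of_int D1) (of_int (x\<^sup>2 - D1 * D2)) \<longleftrightarrow>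
      \<not> (kronecker (fund_disc D1) p = -1 \<and> odd (multiplicity (int p) M))"
    and "\<not> int p dvd fund_disc D2 \<Longrightarrow> padic_split p (of_int D1) (of_int (x\<^sup>2 - D1 * D2)) \<longleftrightarrow>
      \<not> (kronecker (fund_disc D2) p = -1 \<and> odd (multiplicity (int p) M))"
proof -
  have D: "is_discriminant D1" "is_discriminant D2" using adm by (auto simp: admissible_def)
  have M: "- M \<noteq> 0" using quotient_nonzero by simp
  have mod4: "p = 2 \<Longrightarrow> fund_disc D mod 4 = 1" if "is_discriminant D" "\<not> int p dvd fund_disc D" for D
    using fund_disc_properties[OF that(1)] that(2) by simp
  show "padic_split p (of_int D1) (of_int (x\<^sup>2 - D1 * D2)) \<longleftrightarrow>
      \<not> (kronecker (fund_disc D1) p = -1 \<and> odd (multiplicity (int p) M))"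
    if np: "\<not> int p dvd fund_disc D1"
  proof -
    have "padic_split p (of_int (fund_disc D1)) (of_int (- M)) \<longleftrightarrow>
        \<not> (kronecker (fund_disc D1) p = -1 \<and> odd (multiplicity (int p) (- M)))"
      by (rule split_unramified_iff[OF p np _ M]) (rule mod4[OF D(1) np])
    then show ?thesis unfolding split_iff_fund_disc(1)[OF p] by simp
  qed
  show "padic_split p (of_int D1) (of_int (x\<^sup>2 - D1 * D2)) \<longleftrightarrow>
      \<not> (kronecker (fund_disc D2) p = -1 \<and> odd (multiplicity (int p) M))"
    if np: "\<not> int p dvd fund_disc D2"
  proof -
    have "padic_split p (of_int (fund_disc D2)) (of_int (- M)) \<longleftrightarrow>
        \<not> (kronecker (fund_disc D2) p = -1 \<and> odd (multiplicity (int p) (- M)))"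
      by (rule split_unramified_iff[OF p np _ M]) (rule mod4[OF D(2) np])
    then show ?thesis unfolding split_iff_fund_disc(2)[OF p] by simp
  qed
qed

text \<open>Membership in \<open>eps_dom\<close> is part of the conclusion. If p divides neither
  fundamental discriminant, applying \<open>split_iff_kronecker\<close> to each shows that at a
  ramified prime both symbols are -1, so the symbol of the product is not -1.\<close>

lemma not_split_iff_eps:
  assumes p: "prime p" and pN: "\<not> int p dvd gcd (fund_disc D1) (fund_disc D2)"
  shows "\<not> padic_split p (of_int D1) (of_int (x\<^sup>2 - D1 * D2)) \<longleftrightarrow>
    eps_dom D1 D2 p \<and> eps D1 D2 p = -1 \<and> int p dvd M \<and> odd (multiplicity (int p) M)"
proof -
  have D: "is_discriminant D1" "is_discriminant D2" using adm by (auto simp: admissible_def)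
  have odd_dvd: "int p dvd M" if "odd (multiplicity (int p) M)"
    using that not_dvd_imp_multiplicity_0[of "int p" M] by (cases "int p dvd M") auto
  show ?thesis
  proof (cases "int p dvd fund_disc D1")
    case True
    then have "\<not> int p dvd fund_disc D2" using pN by simp
    moreover have "kronecker (fund_disc D1 * fund_disc D2) p = 0" using True by (intro kronecker_dvd) simp
    ultimately show ?thesis
      using True split_iff_kronecker(2)[OF p] odd_dvd pN p by (auto simp: eps_dom_def eps_def)
  next
    case False
    have "kronecker (fund_disc D1 * fund_disc D2) p \<noteq> -1"
      if ns: "\<not> padic_split p (of_int D1) (of_int (x\<^sup>2 - D1 * D2))"
    proof (cases "int p dvd fund_disc D2")
      case True
      then have "kronecker (fund_disc D1 * fund_disc D2) p = 0" by (intro kronecker_dvd) simp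
      then show ?thesis by simp
    next
      case F2: False
      have "p = 2 \<Longrightarrow> fund_disc D1 mod 4 = 1" "p = 2 \<Longrightarrow> fund_disc D2 mod 4 = 1"
        using False F2 fund_disc_properties[OF D(1)] fund_disc_properties[OF D(2)] by auto
      then show ?thesis
        using split_iff_kronecker(1)[OF p False] split_iff_kronecker(2)[OF p F2] ns
        by (intro kronecker_mult_not_minus_one[OF p]) auto
    qed
    then show ?thesis
      using False split_iff_kronecker(1)[OF p False] odd_dvd pN p by (auto simp: eps_dom_def eps_def)
  qed
qed

lemma split_of_not_dvd_quotient:
  assumes p: "prime p" and pN: "int p dvd gcd (fund_disc D1) (fund_disc D2)" and pM: "\<not> int p dvd M"
  shows "padic_split p (of_int D1) (of_int (x\<^sup>2 - D1 * D2))"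
proof (cases "p = 2")
  case False
  have D: "is_discriminant D1" using adm by (auto simp: admissible_def)
  obtain g1 where g1: "D1 = g1\<^sup>2 * fund_disc D1" using fund_disc_properties[OF D] by blast
  have "int p dvd g1\<^sup>2 * fund_disc D1" using pN by simp
  then have pD: "int p dvd D1" using g1 by metis
  have "\<not> int p dvd 4"
  proof
    assume "int p dvd 4"
    then have "p dvd 2 * 2" by presburger
    then have "p dvd 2" using prime_dvd_mult_nat[OF p] by blast
    then show False using False p by (metis primes_dvd_imp_eq two_is_prime_nat)
  qed
  then have "\<not> int p dvd 4 * M" using pM p by (simp add: prime_dvd_mult_iff)
  then have "\<not> int p dvd x\<^sup>2 - D1 * D2" unfolding four_times_quotient by (metis dvd_minus_iff minus_diff_eq)
  moreover have "int p dvd x\<^sup>2 - (x\<^sup>2 - D1 * D2)" using pD by simp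
  ultimately show ?thesis
    using hensel_sqrt_odd[OF p False] split_of_square by blast
next
  case True
  have D: "is_discriminant D1" "is_discriminant D2" "D1 > 0" using adm by (auto simp: admissible_def)
  have "even (fund_disc D1)" "even (fund_disc D2)" using pN True by simp_all
  then obtain g1 g2 where g1: "D1 = g1\<^sup>2 * fund_disc D1" "4 dvd fund_disc D1"
    and g2: "D2 = g2\<^sup>2 * fund_disc D2" "4 dvd fund_disc D2"
    using fund_disc_properties[OF D(1)] fund_disc_properties[OF D(2)] by blast
  have "4 dvd D1" "4 dvd D2" using g1 g2 by (metis dvd_mult)+
  then obtain d1 d2 where d: "D1 = 4 * d1" "D2 = 4 * d2" by (meson dvdE)
  have "even x" using adm d by (auto simp: admissible_def Cong.cong_def mod_eq_dvd_iff)
  then obtain y where y: "x = 2 * y" by (rule evenE)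
  \<comment> \<open>All factors 4 cancel: D1 = 4 d1 and x^2 - D1 D2 = 4 (-M), so the pair to be
    split is (d1, -M), with -M congruent to 1 or 5 modulo 8 according to the parity of d1
    d2.\<close>
  have My: "- M = y\<^sup>2 - 4 * (d1 * d2)" using four_times_quotient unfolding d y by (simp add: power2_eq_square)
  have oM: "odd M" using pM True by simp
  then have "odd (- M)" by simp
  then have "odd y" unfolding My by simp
  then obtain k where k: "y = 2 * k + 1" by (rule oddE)
  have "even (k * (k + 1))" by simp
  then obtain l where "k * (k + 1) = 2 * l" by (rule evenE)
  then have y2: "y\<^sup>2 = 8 * l + 1" unfolding k by (simp add: power2_eq_square algebra_simps)
  have nz: "d1 \<noteq> 0" "M \<noteq> 0" using D(3) d oM by auto
  have "padic_split p (of_int d1) (of_int (- M))"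
  proof (cases "even (d1 * d2)")
    case even: True
    then obtain m where "d1 * d2 = 2 * m" by (rule evenE)
    then have "(- M) mod 8 = 1" unfolding My y2 by presburger
    then show ?thesis using hensel_sqrt_2[OF p True] split_of_square by blast
  next
    case False
    then have "\<not> int p dvd d1" using True by simp
    moreover have "(- M) mod 4 = 1" unfolding My y2 by presburger
    moreover have "\<not> int p dvd - M" using pM by simp
    \<comment> \<open>\<open>split_units\<close> at 2 asks its first argument to be 1 modulo 4. This
      is known for -M but not for d1, so the arguments are exchanged afterwards.\<close>
    ultimately have "padic_split p (of_int (- M)) (of_int d1)" using split_units[OF p] by blast
    then show ?thesis using split_commute[OF p, of "of_int d1" "of_int (- M)"] nz by simp
  qed
  moreover have "(of_int D1 :: rat) = of_int d1 * 2\<^sup>2" by (simp add: d)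
  moreover have "(of_int (x\<^sup>2 - D1 * D2) :: rat) = of_int (- M) * 2\<^sup>2"
    using arg_cong[OF four_times_quotient, of "of_int :: int \<Rightarrow> rat"] by simp
  ultimately show ?thesis
    using split_mult_square_left[OF p, of 2 "of_int d1"] split_mult_square_right[OF p, of 2 "of_int D1"
      "of_int (- M)"] nz D(3)
    by (simp del: of_int_minus of_int_diff)
qed

text \<open>Primes not dividing N are governed by \<epsilon>. A ramified prime dividing N must
  divide M, hence divides n, and for it the Hilbert symbol merely restates ramification.\<close>

lemma ramified_primes:
  assumes N: "N = gcd (fund_disc D1) (fund_disc D2)"
    and N': "int n dvd M" "coprime (M div int n) N"
  shows "{p. prime p \<and> ramified_at (quat_alg RatF (of_int D1) (of_int (x\<^sup>2 - D1 * D2))) p} =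
    {p. eps_dom D1 D2 p \<and> eps D1 D2 p = -1 \<and> int p dvd M \<and> odd (multiplicity (int p) M)} \<union>
    {p. prime p \<and> p dvd n \<and> hilbert_symbol p (of_int D1) (of_int (x\<^sup>2 - D1 * D2)) = -1}"
proof -
  let ?a = "of_int D1 :: rat" and ?b = "of_int (x\<^sup>2 - D1 * D2) :: rat"
  have nz: "?a \<noteq> 0" "?b \<noteq> 0"
    using coefficients_nonzero[OF adm] by blast+
  have ram: "ramified_at (quat_alg RatF ?a ?b) p \<longleftrightarrow> \<not> padic_split p ?a ?b"
    and hil: "hilbert_symbol p ?a ?b = -1 \<longleftrightarrow> \<not> padic_split p ?a ?b" if "prime p" for p
    by (rule ramified_at_iff_not_split[OF that nz], rule hilbert_symbol_iff_not_split[OF that nz])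
  \<comment> \<open>The cofactor M / n is prime to N, so the whole p-part of M sits in n.\<close>
  have dvd_n: "p dvd n" if "prime p" "int p dvd N" "int p dvd M" for p
  proof -
    have "multiplicity (int p) M > 0"
      using that quotient_nonzero by (intro prime_multiplicity_gt_zero_iff[THEN iffD2]) auto
    then have "multiplicity (int p) (int n) \<noteq> 0"
      using cofactor_multiplicity[OF quotient_nonzero N' that(1,2)] by simp
    then have "int p dvd int n" by (rule contrapos_np) (rule not_dvd_imp_multiplicity_0)
    then show ?thesis by simp
  qed
  show ?thesis
  proof (intro equalityI subsetI)
    fix p assume "p \<in> {p. prime p \<and> ramified_at (quat_alg RatF ?a ?b) p}"
    then have p: "prime p" and ns: "\<not> padic_split p ?a ?b" using ram by blast+
    show "p \<in> {p. eps_dom D1 D2 p \<and> eps D1 D2 p = -1 \<and> int p dvd M \<and> odd (multiplicity (int p) M)} \<union>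
        {p. prime p \<and> p dvd n \<and> hilbert_symbol p ?a ?b = -1}"
    proof (cases "int p dvd N")
      case False
      then show ?thesis using not_split_iff_eps[OF p] ns unfolding N by blast
    next
      case True
      then have "int p dvd M" using split_of_not_dvd_quotient[OF p] ns unfolding N by blast
      then show ?thesis using dvd_n[OF p True] hil[OF p] ns p by blast
    qed
  next
    fix p assume "p \<in> {p. eps_dom D1 D2 p \<and> eps D1 D2 p = -1 \<and> int p dvd M \<and> odd (multiplicity (int p) M)} \<union>
        {p. prime p \<and> p dvd n \<and> hilbert_symbol p ?a ?b = -1}"
    then show "p \<in> {p. prime p \<and> ramified_at (quat_alg RatF ?a ?b) p}"
    proof
      assume *: "p \<in> {p. eps_dom D1 D2 p \<and> eps D1 D2 p = -1 \<and> int p dvd M \<and> odd (multiplicity (int p) M)}"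
      then have p: "prime p" "\<not> int p dvd gcd (fund_disc D1) (fund_disc D2)" by (auto simp: eps_dom_def)
      then show ?thesis using * not_split_iff_eps[OF p] ram[OF p(1)] by blast
    next
      assume "p \<in> {p. prime p \<and> p dvd n \<and> hilbert_symbol p ?a ?b = -1}"
      then show ?thesis using ram hil by blast
    qed
  qed
qed

end

lemma signed_prime_factorization:
  assumes M: "M \<noteq> 0" and fin: "finite S" "finite P" "finite Q" "finite W"
    and disj: "S \<inter> P = {}" "S \<inter> Q = {}" "S \<inter> W = {}" "P \<inter> Q = {}" "P \<inter> W = {}" "Q \<inter> W = {}"
    and un: "S \<union> P \<union> Q \<union> W = {p. prime p \<and> int p dvd M}"
  shows "\<exists>\<sigma> \<in> {1, -1}. M = \<sigma> * int ((\<Prod>p\<in>S. p ^ multiplicity (int p) M) * (\<Prod>p\<in>P. p ^ multiplicity (int p) M) *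
    (\<Prod>p\<in>Q. p ^ multiplicity (int p) M) * (\<Prod>p\<in>W. p ^ multiplicity (int p) M))"
proof -
  let ?m = "nat \<bar>M\<bar>" and ?f = "\<lambda>p. p ^ multiplicity (int p) M"
  have pf: "prime_factors ?m = S \<union> P \<union> Q \<union> W"
    unfolding un using M by (auto simp: prime_factors_dvd nat_dvd_iff dvd_nat_abs_iff)
  have "?m = (\<Prod>p\<in>prime_factors ?m. p ^ multiplicity p ?m)"
    using M by (intro prime_factorization_nat) simp
  also have "\<dots> = (\<Prod>p\<in>S \<union> P \<union> Q \<union> W. ?f p)"
    unfolding pf using un by (intro prod.cong) (auto simp: multiplicity_nat_abs)
  also have "\<dots> = prod ?f S * prod ?f P * prod ?f Q * prod ?f W"
    using fin disj by (simp add: prod.union_disjoint Int_Un_distrib2)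
  finally have "\<bar>M\<bar> = int (prod ?f S * prod ?f P * prod ?f Q * prod ?f W)" by linarith
  then have "M = sgn M * int (prod ?f S * prod ?f P * prod ?f Q * prod ?f W)" using mult_sgn_abs[of M] by simp
  moreover have "sgn M \<in> {1, -1}" using M by (simp add: sgn_if)
  ultimately show ?thesis by (rule bexI)
qed

text \<open>The premise of the factorization clause can fail: D1 = 45, D2 = 13, x = 3 give M = 144
  and N = 1, while (5 * 13 / 3) = -1 puts 3 outside \<open>eps_dom\<close>, so 3 occurs in none of
  the products. At such a prime one of the two symbols is 1 and the algebra splits, so the ramified
  set is unaffected.\<close>

theorem theorem4p13:
  fixes D1 D2 x M N :: int and N' :: nat and P Q W :: "nat set"
    and B :: "(rat, rat \<times> rat \<times> rat \<times> rat) module"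
  assumes adm: "admissible D1 D2 x"
    and B: "B = quat_alg RatF (of_int D1) (of_int (x\<^sup>2 - D1 * D2))"
    and M: "M = (D1 * D2 - x\<^sup>2) div 4"
    and N: "N = gcd (fund_disc D1) (fund_disc D2)"
    and N': "N' = (LEAST n. n > 0 \<and> int n dvd M \<and> coprime (M div int n) N)"
    and P: "P = {p. eps_dom D1 D2 p \<and> eps D1 D2 p = -1 \<and> int p dvd M \<and> odd (multiplicity (int p) M)}"
    and Q: "Q = {p. eps_dom D1 D2 p \<and> eps D1 D2 p = -1 \<and> int p dvd M \<and> even (multiplicity (int p) M)}"
    and W: "W = {p. eps_dom D1 D2 p \<and> eps D1 D2 p = 1 \<and> int p dvd M}"
  shows
    "quaternion_algebra RatF B \<and> admits_linked_embeddings B D1 D2 x \<and>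
     (\<forall>A :: (rat, 'b) module.
        quaternion_algebra RatF A \<and> admits_linked_embeddings A D1 D2 x \<longrightarrow>
        alg_isomorphic RatF A B) \<and>
     4 * M = D1 * D2 - x\<^sup>2 \<and>
     finite P \<and> finite Q \<and> finite W \<and>
     ((\<forall>p. prime p \<and> int p dvd M \<and> \<not> int p dvd N \<longrightarrow> eps_dom D1 D2 p) \<longrightarrow>
        (\<exists>\<sigma> \<in> {1, -1}. \<exists>e f g.
           M = \<sigma> * int (N' * (\<Prod>p\<in>P. p ^ (2 * e p + 1)) * (\<Prod>q\<in>Q. q ^ (2 * f q)) * (\<Prod>w\<in>W. w ^ g w)))) \<and>
     {p. prime p \<and> ramified_at B p} =
       P \<union> {p. prime p \<and> p dvd N' \<and> hilbert_symbol p (of_int D1) (of_int (x\<^sup>2 - D1 * D2)) = -1}"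
proof (intro conjI impI allI; (elim conjE)?)
  note M0 = quotient_nonzero[OF adm M]
  have nz: "(of_int D1 :: rat) \<noteq> 0" "(of_int (x\<^sup>2 - D1 * D2) :: rat) \<noteq> 0"
    using coefficients_nonzero[OF adm] by blast+
  show "quaternion_algebra RatF B" unfolding B by (rule quat_alg_rat_quaternion_algebra[OF nz])
  show "admits_linked_embeddings B D1 D2 x" unfolding B by (rule quat_alg_admits_linked_embeddings[OF adm])
  show "alg_isomorphic RatF A B"
    if "quaternion_algebra RatF A" "admits_linked_embeddings A D1 D2 x" for A :: "(rat, 'b) module"
    unfolding B by (rule linked_embeddings_imp_isomorphic[OF adm that])
  show "4 * M = D1 * D2 - x\<^sup>2" by (rule four_times_quotient[OF adm M])
  have sub: "P \<subseteq> {p. prime p \<and> int p dvd M}" "Q \<subseteq> {p. prime p \<and> int p dvd M}" "W \<subseteq> {p. prime p \<and> int p dvd M}"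
    unfolding P Q W eps_dom_def by auto
  show fin: "finite P" "finite Q" "finite W"
    using sub finite_prime_dvd_int[OF M0] finite_subset by blast+
  note N'_props = least_cofactor_eq[OF M0 N']
  show "{p. prime p \<and> ramified_at B p} =
       P \<union> {p. prime p \<and> p dvd N' \<and> hilbert_symbol p (of_int D1) (of_int (x\<^sup>2 - D1 * D2)) = -1}"
    unfolding B P by (rule ramified_primes[OF adm M N N'_props(2,3)])
  assume dom: "\<forall>p. prime p \<and> int p dvd M \<and> \<not> int p dvd N \<longrightarrow> eps_dom D1 D2 p"
  let ?S = "{p. prime p \<and> int p dvd M \<and> int p dvd N}"
  \<comment> \<open>On the domain the value is never 0, because p misses the fundamental
    discriminant whose symbol is taken. Hence P, Q and W exhaust the primes of M away from
    N.\<close>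
  have eps: "eps D1 D2 p = 1 \<or> eps D1 D2 p = -1" if "eps_dom D1 D2 p" for p
    using that kronecker_unit[of p] unfolding eps_dom_def eps_def by auto
  have "\<exists>\<sigma> \<in> {1, -1}. M = \<sigma> * int ((\<Prod>p\<in>?S. p ^ multiplicity (int p) M) * (\<Prod>p\<in>P. p ^ multiplicity (int p) M) *
    (\<Prod>p\<in>Q. p ^ multiplicity (int p) M) * (\<Prod>p\<in>W. p ^ multiplicity (int p) M))"
  proof (rule signed_prime_factorization[OF M0])
    show "finite ?S" by (rule finite_subset[OF _ finite_prime_dvd_int[OF M0]]) auto
    show "?S \<union> P \<union> Q \<union> W = {p. prime p \<and> int p dvd M}"
    proof
      show "?S \<union> P \<union> Q \<union> W \<subseteq> {p. prime p \<and> int p dvd M}" using sub by blast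
      show "{p. prime p \<and> int p dvd M} \<subseteq> ?S \<union> P \<union> Q \<union> W"
      proof
        fix p assume p: "p \<in> {p. prime p \<and> int p dvd M}"
        show "p \<in> ?S \<union> P \<union> Q \<union> W"
          using p dom eps[of p] by (cases "int p dvd N") (auto simp: P Q W)
      qed
    qed
    show "?S \<inter> P = {}" "?S \<inter> Q = {}" "?S \<inter> W = {}" unfolding P Q W N eps_dom_def by auto
    show "P \<inter> Q = {}" "P \<inter> W = {}" "Q \<inter> W = {}" unfolding P Q W by auto
  qed (use fin in auto)
  then obtain \<sigma> where \<sigma>: "\<sigma> \<in> {1, -1}" and eq: "M = \<sigma> * int ((\<Prod>p\<in>?S. p ^ multiplicity (int p) M) *
      (\<Prod>p\<in>P. p ^ multiplicity (int p) M) * (\<Prod>p\<in>Q. p ^ multiplicity (int p) M) * (\<Prod>p\<in>W. p ^ multiplicity (int p)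
        M))"
    by blast
  have S: "(\<Prod>p\<in>?S. p ^ multiplicity (int p) M) = N'" by (rule N'_props(1)[symmetric])
  have P': "(\<Prod>p\<in>P. p ^ multiplicity (int p) M) = (\<Prod>p\<in>P. p ^ (2 * (multiplicity (int p) M div 2) + 1))"
    by (rule prod.cong) (auto simp: P)
  have Q': "(\<Prod>p\<in>Q. p ^ multiplicity (int p) M) = (\<Prod>p\<in>Q. p ^ (2 * (multiplicity (int p) M div 2)))"
    by (rule prod.cong) (auto simp: Q)
  show "\<exists>\<sigma> \<in> {1, -1}. \<exists>e f g.
      M = \<sigma> * int (N' * (\<Prod>p\<in>P. p ^ (2 * e p + 1)) * (\<Prod>q\<in>Q. q ^ (2 * f q)) * (\<Prod>w\<in>W. w ^ g w))"
    by (intro bexI[OF _ \<sigma>] exI[of _ "\<lambda>p. multiplicity (int p) M div 2"] exI[of _ "\<lambda>p. multiplicity (int p) M"]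
        eq[unfolded S P' Q'])
qed

end
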